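(* Let $\mathcal{E}=(L|K,v)$ be a Galois defect extension of prime degree with Galois group $G$. Then the set $\Sigma_\sigma$ does not depend on the choice of the generator $\sigma$ of $G$; writing $\Sigma_\mathcal{E}$ for it, $\Sigma_\mathcal{E}$ is a final segment of $vK^{>0}$ and $$\Sigma_\mathcal{E}=\Sigma_+(1)=\Sigma_-(G).$$ Hence the ramification ideal $I_-(G)=I_+(1)$ equals the ideal of $\mathcal{O}_L$ generated by $\{(\sigma f-f)/f\mid f\in L^\times\}$, for any generator $\sigma$ of $G$. If $\operatorname{char}K=p$ and $a$ is any Artin–Schreier generator of $L|K$ (i.e. $L=K(a)$ and $a^p-a\in K$), then $\Sigma_\mathcal{E}=-v(a-K)$. If $K$ contains a primitive $p$-th root of unity and $a$ is a Kummer generator of $L|K$ (i.e. $L=K(a)$, $a^p\in K$) which is a 1-unit, then $\Sigma_\mathcal{E}=\frac{vp}{p-1}-v(a-K)$.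
   Context: A Galois defect extension of prime degree is a Galois extension $(L|K,v)$ of prime degree such that $v$ extends uniquely from $K$ to $L$ and the extension has nontrivial defect; then $[L:K]=p=\operatorname{char}Kv$ and $vL=vK$, $Lv=Kv$. For $\sigma\in G$, $\Sigma_\sigma=\{v((\sigma f-f)/f)\mid f\in L^\times,\ \sigma f\ne f\}$. $v(a-K)=\{v(a-c)\mid c\in K\}$; $-v(a-K)=\{-\gamma\mid\gamma\in v(a-K)\}$ and $\frac{vp}{p-1}-v(a-K)=\{\frac{vp}{p-1}-\gamma\mid\gamma\in v(a-K)\}$. A 1-unit is an element $u$ with $v(u-1)>0$. Higher ramification groups: for an ideal $I$ of $\mathcal{O}_L$, $G_I=\{\sigma\in G\mid(\sigma f-f)/f\in I\ \forall f\in L^\times\}$; for a final segment $\Sigma$ of $(vL)^{\ge0}$, $I_\Sigma=\{b\in L\mid vb\in\Sigma\}\cup\{0\}$, $G_\Sigma=G_{I_\Sigma}$; for a subgroup $H$ of $G$, $\Sigma_-(H)=\bigcap\{\Sigma\mid H\subseteq G_\Sigma\}$, $\Sigma_+(H)=\bigcup\{\Sigma\mid G_\Sigma\subseteq H\}$, $I_-(H)=\bigcap\{I\mid H\subseteq G_I\}$, $I_+(H)=\bigcup\{I\mid G_I\subseteq H\}$. Here $1$ denotes the trivial subgroup. *)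

theory Defs
  imports Main "HOL-Computational_Algebra.Primes"
begin

text \<open>Setting: the top field L is the whole type 'a; K is a subfield given as a set;
  v : 'a => 'b is a (Krull) valuation on L, where only values at nonzero elements matter
  (v 0 is meaningless, playing the role of infinity).\<close>

definition subfield :: "'a::field set \<Rightarrow> bool" where
  "subfield F \<longleftrightarrow> 0 \<in> F \<and> 1 \<in> F \<and> (\<forall>x\<in>F. \<forall>y\<in>F. x + y \<in> F \<and> x - y \<in> F \<and> x * y \<in> F)
      \<and> (\<forall>x\<in>F. inverse x \<in> F)"

definition valuation :: "('a::field \<Rightarrow> 'b::linordered_ab_group_add) \<Rightarrow> bool" where
  "valuation v \<longleftrightarrow> (\<forall>x y. x \<noteq> 0 \<longrightarrow> y \<noteq> 0 \<longrightarrow> v (x * y) = v x + v y)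
      \<and> (\<forall>x y. x \<noteq> 0 \<longrightarrow> y \<noteq> 0 \<longrightarrow> x + y \<noteq> 0 \<longrightarrow> min (v x) (v y) \<le> v (x + y))"

definition value_group :: "('a::field \<Rightarrow> 'b) \<Rightarrow> 'a set \<Rightarrow> 'b set" where
  "value_group v F = v ` (F - {0})"

definition val_ring :: "('a::field \<Rightarrow> 'b::linordered_ab_group_add) \<Rightarrow> 'a set" where
  "val_ring v = {x. x = 0 \<or> 0 \<le> v x}"

definition val_ideal :: "('a::field \<Rightarrow> 'b::linordered_ab_group_add) \<Rightarrow> 'a set" where
  "val_ideal v = {x. x = 0 \<or> 0 < v x}"

definition has_degree :: "'a::field set \<Rightarrow> nat \<Rightarrow> bool" where
  "has_degree K n \<longleftrightarrow> (\<exists>b::nat \<Rightarrow> 'a. \<forall>x. \<exists>!c::nat \<Rightarrow> 'a.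
       (\<forall>i<n. c i \<in> K) \<and> (\<forall>i\<ge>n. c i = 0) \<and> x = (\<Sum>i<n. c i * b i))"

definition Gal :: "'a::field set \<Rightarrow> ('a \<Rightarrow> 'a) set" where
  "Gal K = {\<sigma>. bij \<sigma> \<and> (\<forall>x y. \<sigma> (x + y) = \<sigma> x + \<sigma> y) \<and> (\<forall>x y. \<sigma> (x * y) = \<sigma> x * \<sigma> y)
               \<and> (\<forall>x\<in>K. \<sigma> x = x)}"

definition galois_ext :: "'a::field set \<Rightarrow> bool" where
  "galois_ext K \<longleftrightarrow> (\<exists>n. has_degree K n) \<and> {x. \<forall>\<sigma>\<in>Gal K. \<sigma> x = x} = K"

text \<open>Valuation rings of L (extensions of valuations up to equivalence).\<close>
definition is_valuation_ring :: "'a::field set \<Rightarrow> bool" where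
  "is_valuation_ring R \<longleftrightarrow> 0 \<in> R \<and> 1 \<in> R \<and> (\<forall>x\<in>R. \<forall>y\<in>R. x + y \<in> R \<and> x - y \<in> R \<and> x * y \<in> R)
      \<and> (\<forall>x. x \<noteq> 0 \<longrightarrow> x \<in> R \<or> inverse x \<in> R)"

text \<open>v|K extends uniquely to L: v is the only extension (up to equivalence), i.e. O_v is the
  only valuation ring of L lying over O_v \<inter> K.\<close>
definition unique_extension :: "'a::field set \<Rightarrow> ('a \<Rightarrow> 'b::linordered_ab_group_add) \<Rightarrow> bool" where
  "unique_extension K v \<longleftrightarrow>
     (\<forall>R. is_valuation_ring R \<and> R \<inter> K = val_ring v \<inter> K \<longrightarrow> R = val_ring v)"

definition ram_index :: "'a::field set \<Rightarrow> ('a \<Rightarrow> 'b::linordered_ab_group_add) \<Rightarrow> nat" where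
  "ram_index K v = card {{v x + h | h. h \<in> value_group v K} | x. x \<noteq> 0}"

text \<open>Residue degree f = [Lv:Kv]: maximal number of elements of O_L whose residues are
  linearly independent over Kv.\<close>
definition res_indep :: "'a::field set \<Rightarrow> ('a \<Rightarrow> 'b::linordered_ab_group_add) \<Rightarrow> nat \<Rightarrow> bool" where
  "res_indep K v n \<longleftrightarrow> (\<exists>u::nat \<Rightarrow> 'a. (\<forall>i<n. u i \<in> val_ring v) \<and>
      (\<forall>c. (\<forall>i<n. c i \<in> K \<inter> val_ring v) \<and> (\<Sum>i<n. c i * u i) \<in> val_ideal v
            \<longrightarrow> (\<forall>i<n. c i \<in> val_ideal v)))"

definition res_degree :: "'a::field set \<Rightarrow> ('a \<Rightarrow> 'b::linordered_ab_group_add) \<Rightarrow> nat" where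
  "res_degree K v = (GREATEST n. res_indep K v n)"

text \<open>Nontrivial defect: d = [L:K]/(e f) > 1, i.e. e f < [L:K].\<close>
definition nontrivial_defect :: "'a::field set \<Rightarrow> ('a \<Rightarrow> 'b::linordered_ab_group_add) \<Rightarrow> bool" where
  "nontrivial_defect K v \<longleftrightarrow> (\<exists>n. has_degree K n \<and> ram_index K v * res_degree K v < n)"

definition galois_defect_ext_prime :: "'a::field set \<Rightarrow> ('a \<Rightarrow> 'b::linordered_ab_group_add) \<Rightarrow> nat \<Rightarrow> bool" where
  "galois_defect_ext_prime K v p \<longleftrightarrow> subfield K \<and> valuation v \<and> prime p \<and> has_degree K p
     \<and> galois_ext K \<and> unique_extension K v \<and> nontrivial_defect K v"

definition generator :: "('a \<Rightarrow> 'a) set \<Rightarrow> ('a \<Rightarrow> 'a) \<Rightarrow> bool" where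
  "generator G \<sigma> \<longleftrightarrow> \<sigma> \<in> G \<and> G = range (\<lambda>n. \<sigma> ^^ n)"

definition Sigma_sigma :: "('a::field \<Rightarrow> 'b) \<Rightarrow> ('a \<Rightarrow> 'a) \<Rightarrow> 'b set" where
  "Sigma_sigma v \<sigma> = {v ((\<sigma> f - f) / f) | f. f \<noteq> 0 \<and> \<sigma> f \<noteq> f}"

definition OL_ideal :: "('a::field \<Rightarrow> 'b::linordered_ab_group_add) \<Rightarrow> 'a set \<Rightarrow> bool" where
  "OL_ideal v I \<longleftrightarrow> I \<subseteq> val_ring v \<and> 0 \<in> I \<and> (\<forall>x\<in>I. \<forall>y\<in>I. x + y \<in> I)
      \<and> (\<forall>r\<in>val_ring v. \<forall>x\<in>I. r * x \<in> I)"

definition OL_ideal_gen :: "('a::field \<Rightarrow> 'b::linordered_ab_group_add) \<Rightarrow> 'a set \<Rightarrow> 'a set" where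
  "OL_ideal_gen v S = \<Inter> {I. OL_ideal v I \<and> S \<subseteq> I}"

definition final_seg_vL :: "('a::field \<Rightarrow> 'b::linordered_ab_group_add) \<Rightarrow> 'b set \<Rightarrow> bool" where
  "final_seg_vL v S \<longleftrightarrow> S \<subseteq> {g \<in> value_group v UNIV. 0 \<le> g}
      \<and> (\<forall>a\<in>S. \<forall>b\<in>value_group v UNIV. a \<le> b \<longrightarrow> b \<in> S)"

definition final_seg_vK_pos :: "'a::field set \<Rightarrow> ('a \<Rightarrow> 'b::linordered_ab_group_add) \<Rightarrow> 'b set \<Rightarrow> bool" where
  "final_seg_vK_pos K v S \<longleftrightarrow> S \<subseteq> {g \<in> value_group v K. 0 < g}
      \<and> (\<forall>a\<in>S. \<forall>b\<in>value_group v K. a \<le> b \<longrightarrow> b \<in> S)"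

definition I_of_Sigma :: "('a::field \<Rightarrow> 'b) \<Rightarrow> 'b set \<Rightarrow> 'a set" where
  "I_of_Sigma v S = {b. b \<noteq> 0 \<and> v b \<in> S} \<union> {0}"

definition G_I :: "'a::field set \<Rightarrow> 'a set \<Rightarrow> ('a \<Rightarrow> 'a) set" where
  "G_I K I = {\<sigma> \<in> Gal K. \<forall>f. f \<noteq> 0 \<longrightarrow> (\<sigma> f - f) / f \<in> I}"

definition G_Sigma :: "'a::field set \<Rightarrow> ('a \<Rightarrow> 'b) \<Rightarrow> 'b set \<Rightarrow> ('a \<Rightarrow> 'a) set" where
  "G_Sigma K v S = G_I K (I_of_Sigma v S)"

definition Sigma_minus :: "'a::field set \<Rightarrow> ('a \<Rightarrow> 'b::linordered_ab_group_add) \<Rightarrow> ('a \<Rightarrow> 'a) set \<Rightarrow> 'b set" where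
  "Sigma_minus K v H = \<Inter> {S. final_seg_vL v S \<and> H \<subseteq> G_Sigma K v S}"

definition Sigma_plus :: "'a::field set \<Rightarrow> ('a \<Rightarrow> 'b::linordered_ab_group_add) \<Rightarrow> ('a \<Rightarrow> 'a) set \<Rightarrow> 'b set" where
  "Sigma_plus K v H = \<Union> {S. final_seg_vL v S \<and> G_Sigma K v S \<subseteq> H}"

definition I_minus :: "'a::field set \<Rightarrow> ('a \<Rightarrow> 'b::linordered_ab_group_add) \<Rightarrow> ('a \<Rightarrow> 'a) set \<Rightarrow> 'a set" where
  "I_minus K v H = \<Inter> {I. OL_ideal v I \<and> H \<subseteq> G_I K I}"

definition I_plus :: "'a::field set \<Rightarrow> ('a \<Rightarrow> 'b::linordered_ab_group_add) \<Rightarrow> ('a \<Rightarrow> 'a) set \<Rightarrow> 'a set" where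
  "I_plus K v H = \<Union> {I. OL_ideal v I \<and> G_I K I \<subseteq> H}"

definition gen_field :: "'a::field set \<Rightarrow> 'a \<Rightarrow> 'a set" where
  "gen_field K a = \<Inter> {F. subfield F \<and> K \<subseteq> F \<and> a \<in> F}"

definition dist_set :: "('a::field \<Rightarrow> 'b) \<Rightarrow> 'a set \<Rightarrow> 'a \<Rightarrow> 'b set" where
  "dist_set v K a = {v (a - c) | c. c \<in> K}"

end

theory Submission
  imports Defs "HOL-Computational_Algebra.Polynomial"
begin

text \<open>Write \<open>D f = v (\<sigma> f - f) - v f\<close>. Uniqueness of the extension gives \<open>v \<circ> \<sigma> = v\<close>, so that
  \<open>v (\<sigma> f - f)\<close> is the same for all nontrivial \<open>\<sigma>\<close>. The defect forces \<open>L|K\<close> to be immediate with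
  residue characteristic \<open>p\<close>: the norm shows that a value outside \<open>vK\<close> has order \<open>p\<close> modulo \<open>vK\<close>,
  and a residue outside \<open>Kv\<close> has either \<open>p\<close> distinct conjugates or is purely inseparable, hence has
  degree \<open>p\<close>. Immediacy makes the set of all \<open>D f\<close> a final segment without minimum, from which the
  statements on \<open>\<Sigma>\<^sub>\<plusminus>\<close> and \<open>I\<^sub>\<plusminus>\<close> follow.

  For the explicit descriptions, every \<open>a\<close> outside \<open>K\<close> satisfies \<open>{D f} = {D (a - c) | c \<in> K}\<close>. This
  rests on Kaplansky's principle: for \<open>F\<close> over \<open>K\<close> of degree less than \<open>p\<close>, \<open>F c\<close> approximates \<open>F a\<close>
  for \<open>c\<close> close enough to \<open>a\<close>. Otherwise \<open>F\<close> has a root, in a suitable coarsening of \<open>v\<close>, at the residue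
  of \<open>a\<close>, which is purely inseparable of degree \<open>p\<close>.\<close>

section \<open>Linear algebra over a subfield\<close>

text \<open>Since the group has prime order, a ramification group is trivial or everything,
  according to whether the given segment or ideal contains all the \<open>D f\<close>. This settles
  \<open>\<Sigma>\<^sub>-\<close> of the whole group at once. But \<open>\<Sigma>\<^sub>+\<close> of
  the trivial group is the union of the final segments that miss some \<open>D f\<close>, and would
  lose a smallest \<open>D f\<close> if there were one.

  The reduction to one generator works because \<open>D\<close> of a product is at least the minimum
  over the factors, and because subtracting an element of \<open>K\<close> that increases the value
  lowers \<open>D\<close>. So if \<open>F = F c + (X - c) G\<close> and \<open>F c\<close>
  approximates \<open>F a\<close>, then \<open>D (F a)\<close> is bounded below through
  \<open>a - c\<close> and \<open>G a\<close>.

  Finding \<open>c\<close> is the hard point. \<open>K\<close> is not assumed henselian, so Newton's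
  method runs inside \<open>K\<close> without reaching a root; passing to a residue field replaces
  the limit. Inseparability is needed there and for \<open>v\<close> itself, so it is proved for a
  local ring \<open>R\<close> with ideal \<open>M\<close> inside the field, and the coarsening is
  never built as a valuation.\<close>

lemma subfieldD:
  assumes "subfield F"
  shows "0 \<in> F" "1 \<in> F" "x \<in> F \<Longrightarrow> y \<in> F \<Longrightarrow> x + y \<in> F" "x \<in> F \<Longrightarrow> y \<in> F \<Longrightarrow> x - y \<in> F"
    "x \<in> F \<Longrightarrow> y \<in> F \<Longrightarrow> x * y \<in> F" "x \<in> F \<Longrightarrow> inverse x \<in> F"
    "x \<in> F \<Longrightarrow> y \<in> F \<Longrightarrow> x / y \<in> F" "x \<in> F \<Longrightarrow> - x \<in> F"
proof -
  show "0 \<in> F" "1 \<in> F" "x \<in> F \<Longrightarrow> y \<in> F \<Longrightarrow> x + y \<in> F" "x \<in> F \<Longrightarrow> y \<in> F \<Longrightarrow> x - y \<in> F"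
    "x \<in> F \<Longrightarrow> y \<in> F \<Longrightarrow> x * y \<in> F" "x \<in> F \<Longrightarrow> inverse x \<in> F" for x y
    using assms unfolding subfield_def by auto
  from this(5)[of x "inverse y"] this(6)[of y] this(4)[of 0 x] this(1)
  show "x \<in> F \<Longrightarrow> y \<in> F \<Longrightarrow> x / y \<in> F" "x \<in> F \<Longrightarrow> - x \<in> F"
    by (simp_all add: divide_inverse)
qed

text \<open>Coefficients range not only over \<open>K\<close> but also over valuation rings
  \<open>R\<close> and over \<open>K \<inter> R\<close>, hence this weaker notion beside
  \<open>subfield\<close>.\<close>

definition subring_set :: "'a::field set \<Rightarrow> bool" where
  "subring_set A \<longleftrightarrow> 0 \<in> A \<and> 1 \<in> A \<and> (\<forall>x\<in>A. \<forall>y\<in>A. x + y \<in> A \<and> x - y \<in> A \<and> x * y \<in> A)"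

lemma subring_setD:
  assumes "subring_set A"
  shows "0 \<in> A" "1 \<in> A" "x \<in> A \<Longrightarrow> y \<in> A \<Longrightarrow> x + y \<in> A" "x \<in> A \<Longrightarrow> y \<in> A \<Longrightarrow> x - y \<in> A"
    "x \<in> A \<Longrightarrow> y \<in> A \<Longrightarrow> x * y \<in> A" "x \<in> A \<Longrightarrow> - x \<in> A"
proof -
  show "0 \<in> A" "1 \<in> A" "x \<in> A \<Longrightarrow> y \<in> A \<Longrightarrow> x + y \<in> A" "x \<in> A \<Longrightarrow> y \<in> A \<Longrightarrow> x - y \<in> A"
    "x \<in> A \<Longrightarrow> y \<in> A \<Longrightarrow> x * y \<in> A" for x y
    using assms unfolding subring_set_def by auto
  from this(4)[of 0 x] this(1) show "x \<in> A \<Longrightarrow> - x \<in> A" by simp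
qed

lemma subfield_imp_subring: "subfield F \<Longrightarrow> subring_set F"
  unfolding subfield_def subring_set_def by auto

lemma subring_sum: "subring_set A \<Longrightarrow> (\<And>i. i \<in> I \<Longrightarrow> f i \<in> A) \<Longrightarrow> sum f I \<in> A"
  by (induction I rule: infinite_finite_induct) (auto simp: subring_setD)

lemma subring_power: "subring_set A \<Longrightarrow> x \<in> A \<Longrightarrow> x ^ n \<in> A"
  by (induction n) (auto simp: subring_setD)

lemma subring_of_nat: "subring_set A \<Longrightarrow> of_nat n \<in> A"
  by (induction n) (auto simp: subring_setD)

text \<open>Indexed families rather than sets: powers are indexed by numbers, products of two bases
  by pairs, and a set \<open>E\<close> is the family \<open>id\<close> on \<open>E\<close>.\<close>

definition lin_span :: "'a::field set \<Rightarrow> 'i set \<Rightarrow> ('i \<Rightarrow> 'a) \<Rightarrow> 'a set" where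
  "lin_span F J b = {\<Sum>j\<in>J. c j * b j | c. \<forall>j\<in>J. c j \<in> F}"

definition lin_dep :: "'a::field set \<Rightarrow> 'i set \<Rightarrow> ('i \<Rightarrow> 'a) \<Rightarrow> bool" where
  "lin_dep F I x \<longleftrightarrow> (\<exists>c. (\<forall>i\<in>I. c i \<in> F) \<and> (\<exists>i\<in>I. c i \<noteq> 0) \<and> (\<Sum>i\<in>I. c i * x i) = 0)"

text \<open>Gaussian elimination: a vector \<open>x k\<close> that involves \<open>b j\<close> is
  used to clear \<open>b j\<close> from all the others, which leaves one spanning vector and one
  vector fewer.\<close>

lemma steinitz:
  assumes F: "subfield F" and "finite J" "finite I" "card J < card I"
    and "\<And>i. i \<in> I \<Longrightarrow> x i \<in> lin_span F J b"
  shows "lin_dep F I x"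
  using assms(2-)
proof (induction J arbitrary: I x rule: finite_induct)
  case empty
  then obtain i where "i \<in> I" by fastforce
  moreover have "(\<Sum>i\<in>I. 1 * x i) = 0"
    using empty by (intro sum.neutral) (auto simp: lin_span_def)
  ultimately show ?case unfolding lin_dep_def
    by (intro exI[of _ "\<lambda>_. 1"]) (auto simp: subfieldD[OF F])
next
  case (insert j J)
  have "\<forall>i\<in>I. \<exists>c. (\<forall>k\<in>insert j J. c k \<in> F) \<and> x i = (\<Sum>k\<in>insert j J. c k * b k)"
    using insert.prems(3) unfolding lin_span_def by blast
  then obtain A where A: "\<And>i k. i \<in> I \<Longrightarrow> k \<in> insert j J \<Longrightarrow> A i k \<in> F"
    and x: "\<And>i. i \<in> I \<Longrightarrow> x i = (\<Sum>k\<in>insert j J. A i k * b k)"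
    by metis
  have x': "x i = A i j * b j + (\<Sum>k\<in>J. A i k * b k)" if "i \<in> I" for i
    using x[OF that] insert.hyps by simp
  show ?case
  proof (cases "\<forall>i\<in>I. A i j = 0")
    case True
    show ?thesis
    proof (rule insert.IH)
      show "x i \<in> lin_span F J b" if "i \<in> I" for i
        using x'[OF that] True that A[OF that] unfolding lin_span_def by auto
    qed (use insert in auto)
  next
    case False
    then obtain k where k: "k \<in> I" "A k j \<noteq> 0" by auto
    let ?r = "\<lambda>i. A i j / A k j"
    have r: "?r i \<in> F" if "i \<in> I" for i
      using A[of i j] A[of k j] that k subfieldD[OF F] by auto
    have "lin_dep F (I - {k}) (\<lambda>i. x i - ?r i * x k)"
    proof (rule insert.IH)
      show "card J < card (I - {k})" using insert k by auto
      show "x i - ?r i * x k \<in> lin_span F J b" if "i \<in> I - {k}" for i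
      proof -
        have "x i - ?r i * x k = (\<Sum>l\<in>J. A i l * b l) - ?r i * (\<Sum>l\<in>J. A k l * b l)"
          using x'[of i] x'[of k] that k by (simp add: field_simps)
        also have "\<dots> = (\<Sum>l\<in>J. (A i l - ?r i * A k l) * b l)"
          by (simp add: sum_distrib_left sum_subtractf algebra_simps)
        finally show ?thesis unfolding lin_span_def
          using A[of i] A[of k] k that r[of i] subfieldD[OF F] 
          by (intro CollectI exI[of _ "\<lambda>l. A i l - ?r i * A k l"]) auto
      qed
    qed (use insert in auto)
    then obtain c where c: "\<forall>i\<in>I-{k}. c i \<in> F" "\<exists>i\<in>I-{k}. c i \<noteq> 0"
      "(\<Sum>i\<in>I-{k}. c i * (x i - ?r i * x k)) = 0" unfolding lin_dep_def by blast
    \<comment> \<open>The coefficient of \<open>x k\<close> collects all multiples of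
      \<open>x k\<close> that were subtracted.\<close>
    define d where "d = c(k := - (\<Sum>i\<in>I-{k}. c i * ?r i))"
    have "(\<Sum>i\<in>I. d i * x i) = d k * x k + (\<Sum>i\<in>I-{k}. d i * x i)"
      using k insert.prems by (simp add: sum.remove)
    also have "(\<Sum>i\<in>I-{k}. d i * x i) = (\<Sum>i\<in>I-{k}. c i * x i)"
      by (rule sum.cong) (auto simp: d_def)
    also have "d k * x k + \<dots> = (\<Sum>i\<in>I-{k}. c i * (x i - ?r i * x k))"
      by (simp add: d_def sum_distrib_left sum_subtractf algebra_simps)
    finally have "(\<Sum>i\<in>I. d i * x i) = 0" using c(3) by simp
    moreover have "d k \<in> F" unfolding d_def fun_upd_same
      using c(1) r
      by (intro subfieldD(8)[OF F] subring_sum[OF subfield_imp_subring[OF F]] subfieldD(5)[OF F]) auto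
    then have "\<forall>i\<in>I. d i \<in> F" using c(1) by (auto simp: d_def)
    moreover have "\<exists>i\<in>I. d i \<noteq> 0" using c(2) by (auto simp: d_def)
    ultimately show ?thesis unfolding lin_dep_def by blast
  qed
qed

text \<open>The bound makes an independent subset of largest cardinality available, and such a
  subset spans.\<close>

lemma lin_basis_exists:
  assumes F: "subfield F"
    and bound: "\<And>E. E \<subseteq> V \<Longrightarrow> finite E \<Longrightarrow> \<not> lin_dep F E id \<Longrightarrow> card E \<le> n"
  obtains E where "finite E" "E \<subseteq> V" "\<not> lin_dep F E id" "V \<subseteq> lin_span F E id"
proof -
  let ?P = "\<lambda>E. E \<subseteq> V \<and> finite E \<and> \<not> lin_dep F E id"
  have "?P {}" by (auto simp: lin_dep_def)
  then obtain E where E: "?P E" and mx: "\<And>E'. ?P E' \<Longrightarrow> card E' \<le> card E"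
    using ex_has_greatest_nat[of ?P "{}" card "Suc n"] bound by (auto simp: less_Suc_eq_le)
  have "x \<in> lin_span F E id" if x: "x \<in> V" for x
  proof (cases "x \<in> E")
    case True
    have "x = (\<Sum>e\<in>E. (if e = x then 1 else 0) * id e)"
      using E True by (simp add: if_distrib[of "\<lambda>t. t * _"] cong: if_cong)
    then show ?thesis unfolding lin_span_def
      by (intro CollectI exI[of _ "\<lambda>e. if e = x then 1 else 0"]) (auto simp: subfieldD[OF F])
  next
    case False
    have "lin_dep F (insert x E) id"
      using mx[of "insert x E"] E x False by auto
    then obtain c where c: "\<forall>i\<in>insert x E. c i \<in> F" "\<exists>i\<in>insert x E. c i \<noteq> 0"
      "(\<Sum>i\<in>insert x E. c i * i) = 0" unfolding lin_dep_def by auto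
    have s: "c x * x + (\<Sum>i\<in>E. c i * i) = 0" using c(3) E False by simp
    have "c x \<noteq> 0"
    proof
      assume "c x = 0"
      then have "lin_dep F E id" unfolding lin_dep_def using c s False
        by (intro exI[of _ c]) auto
      then show False using E by blast
    qed
    then have "x = - (\<Sum>i\<in>E. c i * i) / c x" using s by (simp add: field_simps eq_neg_iff_add_eq_0)
    also have "\<dots> = (\<Sum>i\<in>E. (- c i / c x) * id i)"
      by (simp add: sum_divide_distrib sum_negf)
    finally show ?thesis unfolding lin_span_def
      using c(1) subfieldD[OF F] by (intro CollectI exI[of _ "\<lambda>i. - c i / c x"]) auto
  qed
  then show ?thesis using that E by blast
qed

lemma lin_dep_mono:
  assumes "K \<subseteq> F" "lin_dep K I x" shows "lin_dep F I x"
  using assms unfolding lin_dep_def by blast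

lemma has_degree_basis:
  assumes K: "subfield K" and "has_degree K n"
  obtains b where "lin_span K {..<n} b = UNIV" "\<not> lin_dep K {..<n} b"
proof -
  obtain b where b: "\<And>x. \<exists>!c. (\<forall>i<n. c i \<in> K) \<and> (\<forall>i\<ge>n. c i = 0) \<and> x = (\<Sum>i<n. c i * b i)"
    using assms(2) unfolding has_degree_def by blast
  let ?P = "\<lambda>x c. (\<forall>i<n. c i \<in> K) \<and> (\<forall>i\<ge>n. c i = 0) \<and> x = (\<Sum>i<n. c i * b i)"
  have uniq: "?P x c \<Longrightarrow> ?P x c' \<Longrightarrow> c = c'" for x c c'
    by (rule ex1E[OF b[of x]]) (metis (no_types, lifting))
  have "x \<in> lin_span K {..<n} b" for x
  proof -
    obtain c where "?P x c" using b[of x] by (rule ex1E)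
    then show ?thesis unfolding lin_span_def by auto
  qed
  then have "lin_span K {..<n} b = UNIV" by blast
  moreover have "\<not> lin_dep K {..<n} b"
  proof
    assume "lin_dep K {..<n} b"
    then obtain c where c: "\<forall>i<n. c i \<in> K" "\<exists>i<n. c i \<noteq> 0" "(\<Sum>i<n. c i * b i) = 0"
      unfolding lin_dep_def by auto
    \<comment> \<open>Coordinates are unique only among functions that vanish from \<open>n\<close>
      on, so the relation is truncated before it is compared with the zero function.\<close>
    let ?c = "\<lambda>i. if i < n then c i else 0"
    have "(\<forall>i<n. ?c i \<in> K) \<and> (\<forall>i\<ge>n. ?c i = 0) \<and> 0 = (\<Sum>i<n. ?c i * b i)"
      using c by auto
    moreover have "(\<forall>i<n. (\<lambda>_. 0) i \<in> K) \<and> (\<forall>i\<ge>n. (\<lambda>_. 0::'a) i = 0) \<and> 0 = (\<Sum>i<n. (\<lambda>_. 0) i * b i)"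
      using subfieldD[OF K] by simp
    ultimately have "?c = (\<lambda>_. 0)" by (rule uniq)
    then have "?c i = 0" for i by (rule fun_cong)
    then show False using c(2) by (metis (full_types))
  qed
  ultimately show ?thesis using that by blast
qed

lemma has_degree_lin_dep:
  assumes "subfield K" "has_degree K n" "finite I" "n < card I"
  shows "lin_dep K I x"
proof -
  obtain b where "lin_span K {..<n} b = UNIV"
    using has_degree_basis[OF assms(1,2)] by metis
  then show ?thesis using assms by (intro steinitz[of K "{..<n}" I x b]) auto
qed

lemma has_degree_span_card:
  assumes "subfield K" "has_degree K n" "finite J" "lin_span K J b = UNIV"
  shows "n \<le> card J"
proof (rule ccontr)
  assume "\<not> n \<le> card J"
  moreover obtain b' where "\<not> lin_dep K {..<n} b'"
    using has_degree_basis[OF assms(1,2)] by metis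
  moreover have "lin_dep K {..<n} b'" if "card J < n"
    using assms that by (intro steinitz[of K J "{..<n}" b' b]) auto
  ultimately show False by auto
qed

lemma has_degree_unique:
  assumes "subfield K" "has_degree K n" "has_degree K m"
  shows "n = m"
proof -
  have "n \<le> m" if "has_degree K n" "has_degree K m" for n m
    using has_degree_basis[OF assms(1) that(2)] has_degree_span_card[OF assms(1) that(1), of "{..<m}"]
    by (metis card_lessThan finite_lessThan)
  then show ?thesis using assms by (simp add: antisym)
qed

lemma lin_span_singleton:
  assumes F: "subfield F" and V: "subfield V" "F \<subseteq> V" "V \<subseteq> lin_span F E id" "card E = 1"
  shows "V = F"
proof -
  obtain e where E: "E = {e}" using V(4) card_1_singletonE by blast
  have *: "\<exists>c\<in>F. x = c * e" if "x \<in> V" for x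
    using V(3) that unfolding lin_span_def E by auto
  obtain c where c: "c \<in> F" "1 = c * e" using *[of 1] subfieldD[OF V(1)] by auto
  then have "e = inverse c" by (metis inverse_unique)
  then have "e \<in> F" using c subfieldD[OF F] by auto
  then show ?thesis using * V(2) subfieldD[OF F] by fastforce
qed

text \<open>The tower law: products of a basis of \<open>F\<close> over \<open>K\<close> and a basis
  of the whole field over \<open>F\<close> form a basis over \<open>K\<close>, so the two
  cardinalities multiply to the prime \<open>p\<close>.\<close>

lemma intermediate_field_prime_degree:
  assumes K: "subfield K" and p: "prime p" and deg: "has_degree K p"
    and F: "subfield F" and KF: "K \<subseteq> F"
  shows "F = K \<or> F = UNIV"
proof -
  have bK: "card E \<le> p" if "finite E" "\<not> lin_dep K E id" for E :: "'a set"
    using has_degree_lin_dep[OF K deg that(1)] that(2) not_le by blast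
  have bF: "card E \<le> p" if "finite E" "\<not> lin_dep F E id" for E :: "'a set"
    using bK that lin_dep_mono[OF KF] by blast
  obtain E where E: "finite E" "E \<subseteq> F" "\<not> lin_dep K E id" "F \<subseteq> lin_span K E id"
    using lin_basis_exists[OF K, of F p] bK by metis
  obtain B where B: "finite B" "B \<subseteq> (UNIV :: 'a set)" "\<not> lin_dep F B id" "UNIV \<subseteq> lin_span F B id"
    using lin_basis_exists[OF F, of UNIV p] bF by metis
  let ?b = "\<lambda>(e, b). e * b :: 'a"
  have "\<not> lin_dep K (E \<times> B) ?b"
  proof
    assume "lin_dep K (E \<times> B) ?b"
    then obtain c where c: "\<And>e b. e \<in> E \<Longrightarrow> b \<in> B \<Longrightarrow> c (e, b) \<in> K"
      "\<exists>i\<in>E \<times> B. c i \<noteq> 0" "(\<Sum>i\<in>E\<times>B. c i * ?b i) = 0" unfolding lin_dep_def by auto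
    define d where "d b = (\<Sum>e\<in>E. c (e, b) * e)" for b
    have "(\<Sum>b\<in>B. d b * id b) = (\<Sum>b\<in>B. \<Sum>e\<in>E. c (e, b) * (e * b))"
      by (simp add: d_def sum_distrib_right mult.assoc)
    also have "\<dots> = (\<Sum>i\<in>E\<times>B. c i * ?b i)"
      by (subst sum.swap) (simp add: sum.cartesian_product case_prod_unfold)
    finally have s: "(\<Sum>b\<in>B. d b * id b) = 0" using c(3) by simp
    have "d b \<in> F" if "b \<in> B" for b unfolding d_def
      using that c(1) KF E(2) subfieldD[OF F] 
      by (intro subring_sum[OF subfield_imp_subring[OF F]]) blast
    then have d0: "d b = 0" if "b \<in> B" for b
      using s B(3) that unfolding lin_dep_def by blast
    obtain e b where eb: "e \<in> E" "b \<in> B" "c (e, b) \<noteq> 0" using c(2) by auto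
    have "lin_dep K E id" unfolding lin_dep_def
      using d0[OF eb(2)] eb c(1) by (intro exI[of _ "\<lambda>e. c (e, b)"]) (auto simp: d_def)
    then show False using E by blast
  qed
  moreover have fin: "finite (E \<times> B)" using E B by blast
  ultimately have le: "card (E \<times> B) \<le> p"
    using has_degree_lin_dep[OF K deg fin] not_le by blast
  have "x \<in> lin_span K (E \<times> B) ?b" for x
  proof -
    obtain d where d: "\<forall>b\<in>B. d b \<in> F" "x = (\<Sum>b\<in>B. d b * b)"
      using B(4) unfolding lin_span_def by auto
    have "\<forall>b\<in>B. \<exists>c. (\<forall>e\<in>E. c e \<in> K) \<and> d b = (\<Sum>e\<in>E. c e * e)"
      using d(1) E(4) unfolding lin_span_def by fastforce
    then obtain c where c: "\<And>b e. b \<in> B \<Longrightarrow> e \<in> E \<Longrightarrow> c b e \<in> K"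
      "\<And>b. b \<in> B \<Longrightarrow> d b = (\<Sum>e\<in>E. c b e * e)" by metis
    have "x = (\<Sum>b\<in>B. \<Sum>e\<in>E. c b e * (e * b))"
      unfolding d(2) by (rule sum.cong) (auto simp: c(2) sum_distrib_right mult.assoc)
    also have "\<dots> = (\<Sum>i\<in>E\<times>B. c (snd i) (fst i) * ?b i)"
      by (subst sum.swap) (simp add: sum.cartesian_product case_prod_unfold)
    finally show ?thesis unfolding lin_span_def
      using c(1) by (intro CollectI exI[of _ "\<lambda>i. c (snd i) (fst i)"]) auto
  qed
  then have "p \<le> card (E \<times> B)"
    using has_degree_span_card[OF K deg fin] by blast
  with le have "card E * card B = p" by (simp add: card_cartesian_product)
  then have "card E = 1 \<or> card B = 1" using p by (metis prime_product)
  moreover have "subfield (UNIV :: 'a set)" by (auto simp: subfield_def)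
  ultimately show ?thesis
    using lin_span_singleton[OF K F KF E(4)] lin_span_singleton[OF F _ _ B(4)] by auto
qed

section \<open>Polynomials over a subring\<close>

definition polys_over :: "'a::field set \<Rightarrow> 'a poly set" where
  "polys_over A = {P. \<forall>i. coeff P i \<in> A}"

lemma polys_overD: "P \<in> polys_over A \<Longrightarrow> coeff P i \<in> A"
  by (simp add: polys_over_def)

context
  fixes A :: "'a::field set"
  assumes A: "subring_set A"
begin

lemma polys_over_add: "P \<in> polys_over A \<Longrightarrow> Q \<in> polys_over A \<Longrightarrow> P + Q \<in> polys_over A"
  and polys_over_diff: "P \<in> polys_over A \<Longrightarrow> Q \<in> polys_over A \<Longrightarrow> P - Q \<in> polys_over A"
  and polys_over_smult: "c \<in> A \<Longrightarrow> P \<in> polys_over A \<Longrightarrow> smult c P \<in> polys_over A"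
  and polys_over_0: "0 \<in> polys_over A"
  by (auto simp: polys_over_def subring_setD[OF A])

lemma polys_over_mult: "P \<in> polys_over A \<Longrightarrow> Q \<in> polys_over A \<Longrightarrow> P * Q \<in> polys_over A"
  unfolding polys_over_def
  by (auto simp: coeff_mult intro!: subring_sum[OF A] subring_setD(5)[OF A])

lemma polys_over_monom: "c \<in> A \<Longrightarrow> monom c n \<in> polys_over A"
  by (auto simp: polys_over_def coeff_monom subring_setD[OF A])

lemma polys_over_pCons: "pCons c P \<in> polys_over A \<longleftrightarrow> c \<in> A \<and> P \<in> polys_over A"
  unfolding polys_over_def
  by (auto simp: coeff_pCons split: nat.splits)

lemma polys_over_pcompose: "P \<in> polys_over A \<Longrightarrow> Q \<in> polys_over A \<Longrightarrow> pcompose P Q \<in> polys_over A"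
  by (induction P)
    (auto simp: pcompose_pCons polys_over_pCons polys_over_0 intro!: polys_over_add polys_over_mult)

lemma polys_over_pderiv: "P \<in> polys_over A \<Longrightarrow> pderiv P \<in> polys_over A"
  unfolding polys_over_def
  by (auto simp: coeff_pderiv simp del: of_nat_Suc intro!: subring_setD[OF A] subring_of_nat[OF A])

lemma poly_in_subring: "P \<in> polys_over A \<Longrightarrow> x \<in> A \<Longrightarrow> poly P x \<in> A"
  by (induction P) (auto simp: polys_over_pCons subring_setD[OF A])

text \<open>A leading coefficient 1 keeps quotient and remainder over the subring; this is what
  allows division over \<open>K \<inter> R\<close> later on.\<close>

lemma monic_division:
  assumes g: "g \<in> polys_over A" "lead_coeff g = 1" and h: "h \<in> polys_over A"
  obtains q r where "q \<in> polys_over A" "r \<in> polys_over A" "h = g * q + r" "r = 0 \<or> degree r < degree g"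
proof -
  have "\<exists>q r. q \<in> polys_over A \<and> r \<in> polys_over A \<and> h = g * q + r \<and> (r = 0 \<or> degree r < degree g)"
    using h
  proof (induction "degree h" arbitrary: h rule: less_induct)
    case less
    show ?case
    proof (cases "h = 0 \<or> degree h < degree g")
      case True
      then show ?thesis using less.prems polys_over_0 by (intro exI[of _ 0] exI[of _ h]) auto
    next
      case False
      define m where "m = monom (lead_coeff h) (degree h - degree g)"
      define h' where "h' = h - g * m"
      have m: "m \<in> polys_over A" unfolding m_def using less.prems
        by (intro polys_over_monom) (simp add: polys_overD)
      have h'A: "h' \<in> polys_over A" unfolding h'_def
        using m less.prems g by (intro polys_over_diff polys_over_mult)
      have lc: "lead_coeff h \<noteq> 0" using False by auto
      have g0: "g \<noteq> 0" using g(2) by auto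
      have lm: "degree m = degree h - degree g" "lead_coeff m = lead_coeff h" "m \<noteq> 0"
        unfolding m_def using lc by (simp_all add: degree_monom_eq monom_eq_0_iff)
      have dm: "degree (g * m) = degree h" "lead_coeff (g * m) = lead_coeff h"
        using False g0 lm by (simp add: degree_mult_eq) (simp only: lead_coeff_mult g(2) lm(2) mult_1)
      have "h' = 0 \<or> degree h' < degree h"
      proof (cases "h' = 0")
        case nz: False
        have "degree h' \<le> degree h" unfolding h'_def
          using dm by (metis degree_diff_le order_refl)
        moreover have "coeff h' (degree h) = 0" unfolding h'_def using dm by simp
        ultimately show ?thesis using nz by (metis leading_coeff_0_iff order_le_less)
      qed simp
      then obtain q r where "q \<in> polys_over A" "r \<in> polys_over A" "h' = g * q + r"
        "r = 0 \<or> degree r < degree g"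
        using less.hyps[of h'] h'A polys_over_0 by (metis add_0_right mult_zero_right)
      then show ?thesis using m
        by (intro exI[of _ "q + m"] exI[of _ r]) (auto simp: h'_def algebra_simps intro: polys_over_add)
    qed
  qed
  then show ?thesis using that by blast
qed

end

lemma coeff_sum_monom: "coeff (\<Sum>i<n. monom (c i :: 'a::field) i) k = (if k < n then c k else 0)"
  by (simp add: coeff_sum coeff_monom)

lemma poly_sum_monom: "poly (\<Sum>i<n. monom (c i :: 'a::field) i) x = (\<Sum>i<n. c i * x ^ i)"
  by (simp add: poly_sum poly_monom)

lemma degree_sum_monom: "0 < n \<Longrightarrow> degree (\<Sum>i<n. monom (c i :: 'a::field) i) < n"
  by (intro le_less_trans[OF degree_le[of "n - 1"]]) (auto simp: coeff_sum_monom)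

lemma poly_eq_sum: "degree P < n \<Longrightarrow> poly P (x::'a::field) = (\<Sum>i<n. coeff P i * x ^ i)"
  unfolding poly_altdef by (rule sum.mono_neutral_left) (auto simp: coeff_eq_0)

lemma map_poly_mult_hom:
  fixes f :: "'a::comm_ring_1 \<Rightarrow> 'a"
  assumes "\<And>x y. f (x + y) = f x + f y" "\<And>x y. f (x * y) = f x * f y" "f 0 = 0"
  shows "map_poly f (P * Q) = map_poly f P * map_poly f Q"
proof (rule poly_eqI)
  have "f (sum g I) = (\<Sum>i\<in>I. f (g i))" for g :: "nat \<Rightarrow> 'a" and I
    by (induction I rule: infinite_finite_induct) (auto simp: assms)
  then show "coeff (map_poly f (P * Q)) n = coeff (map_poly f P * map_poly f Q) n" for n
    by (simp add: coeff_map_poly coeff_mult assms)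
qed

section \<open>Galois extensions of prime degree\<close>

lemma GalD:
  assumes "\<sigma> \<in> Gal K"
  shows "bij \<sigma>" "\<sigma> (x + y) = \<sigma> x + \<sigma> y" "\<sigma> (x * y) = \<sigma> x * \<sigma> y" "x \<in> K \<Longrightarrow> \<sigma> x = x"
  using assms unfolding Gal_def by blast+

lemma Gal_hom:
  assumes "\<sigma> \<in> Gal K"
  shows "\<sigma> 0 = 0" "\<sigma> 1 = 1" "\<sigma> (- x) = - \<sigma> x" "\<sigma> (x - y) = \<sigma> x - \<sigma> y"
    "\<sigma> (inverse x) = inverse (\<sigma> x)" "\<sigma> (x / y) = \<sigma> x / \<sigma> y" "\<sigma> (x ^ n) = \<sigma> x ^ n"
    "\<sigma> x = \<sigma> y \<longleftrightarrow> x = y" "\<sigma> x = 0 \<longleftrightarrow> x = 0"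
proof -
  note h = GalD[OF assms]
  have "\<sigma> 0 + 0 = \<sigma> 0 + \<sigma> 0" using h(2)[of 0 0] by (simp only: add_0_right)
  then show 0: "\<sigma> 0 = 0" by (simp only: add_left_cancel)
  show i: "\<sigma> x = \<sigma> y \<longleftrightarrow> x = y" for x y using h(1) by (auto simp: bij_def inj_def)
  show z: "\<sigma> x = 0 \<longleftrightarrow> x = 0" for x using i[of x 0] 0 by simp
  show 1: "\<sigma> 1 = 1" using h(3)[of 1 1] z[of 1] by simp
  show m: "\<sigma> (- x) = - \<sigma> x" for x using h(2)[of x "- x"] 0 by (simp add: eq_neg_iff_add_eq_0 add.commute)
  show "\<sigma> (x - y) = \<sigma> x - \<sigma> y" using h(2)[of x "- y"] m by simp
  show inv: "\<sigma> (inverse x) = inverse (\<sigma> x)" for x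
  proof (cases "x = 0")
    case False
    then have "\<sigma> x * \<sigma> (inverse x) = 1" using h(3)[of x "inverse x"] 1 by simp
    then show ?thesis by (metis inverse_unique)
  qed (simp add: 0)
  show "\<sigma> (x / y) = \<sigma> x / \<sigma> y" by (simp add: divide_inverse h inv)
  show "\<sigma> (x ^ n) = \<sigma> x ^ n" by (induction n) (simp_all add: 1 h)
qed

lemma Gal_sum: "\<sigma> \<in> Gal K \<Longrightarrow> \<sigma> (sum f I) = (\<Sum>i\<in>I. \<sigma> (f i))"
  by (induction I rule: infinite_finite_induct) (auto simp: GalD Gal_hom)

lemma Gal_prod: "\<sigma> \<in> Gal K \<Longrightarrow> \<sigma> (prod f I) = (\<Prod>i\<in>I. \<sigma> (f i))"
  by (induction I rule: infinite_finite_induct) (auto simp: GalD Gal_hom)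

lemma Gal_poly: "\<sigma> \<in> Gal K \<Longrightarrow> P \<in> polys_over K \<Longrightarrow> \<sigma> (poly P x) = poly P (\<sigma> x)"
  by (simp add: poly_altdef Gal_sum GalD Gal_hom polys_overD)

lemma id_in_Gal: "id \<in> Gal K"
  by (simp add: Gal_def)

lemma Gal_funpow: "\<sigma> \<in> Gal K \<Longrightarrow> \<sigma> ^^ n \<in> Gal K"
proof (induction n)
  case (Suc n)
  then have "bij (\<sigma> ^^ Suc n)" using bij_comp[of "\<sigma> ^^ n" \<sigma>] by (simp add: Gal_def)
  with Suc show ?case by (simp add: Gal_def comp_def)
qed (simp add: Gal_def)

locale prime_galois =
  fixes K :: "'a::field set" and p :: nat
  assumes K: "subfield K" and p: "prime p" and deg: "has_degree K p" and gal: "galois_ext K"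
begin

lemmas KD = subfieldD[OF K]
lemmas K_ring = subfield_imp_subring[OF K]

lemma p_gt_1: "1 < p" using p prime_gt_1_nat by blast

lemma K_ne_UNIV: "K \<noteq> UNIV"
proof
  assume "K = UNIV"
  then have "x \<in> lin_span K {..<1::nat} (\<lambda>_. 1)" for x
    unfolding lin_span_def by (intro CollectI exI[of _ "\<lambda>_. x"]) auto
  then have "p \<le> card {..<1::nat}" by (intro has_degree_span_card[OF K deg]) auto
  then show False using p_gt_1 by simp
qed

section \<open>Simple extensions inside the field\<close>

lemma annihilating_poly:
  obtains P where "P \<in> polys_over K" "P \<noteq> 0" "degree P \<le> p" "poly P x = 0"
proof -
  have "lin_dep K {..<Suc p} (\<lambda>i. x ^ i)"
    using has_degree_lin_dep[OF K deg, of "{..<Suc p}"] by simp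
  then obtain c where c: "\<forall>i\<in>{..<Suc p}. c i \<in> K" "\<exists>i\<in>{..<Suc p}. c i \<noteq> 0"
    "(\<Sum>i<Suc p. c i * x ^ i) = 0" unfolding lin_dep_def by blast
  define P where "P = (\<Sum>i<Suc p. monom (c i) i)"
  have cP: "coeff P k = (if k < Suc p then c k else 0)" for k
    unfolding P_def by (rule coeff_sum_monom)
  have "P \<in> polys_over K" using c(1) KD by (simp add: polys_over_def cP)
  moreover have "P \<noteq> 0" using c(2) cP by (metis coeff_0 lessThan_iff)
  moreover have "degree P \<le> p" using degree_sum_monom[of "Suc p" c] by (simp add: P_def)
  moreover have "poly P x = 0" using c(3) by (simp only: P_def poly_sum_monom)
  ultimately show ?thesis using that by blast
qed

text \<open>If the constant term is nonzero, the relation \<open>r + x * poly P x = 0\<close>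
  exhibits the inverse; otherwise a factor \<open>X\<close> can be cancelled.\<close>

lemma inverse_as_poly:
  assumes "P \<in> polys_over K" "P \<noteq> 0" "poly P x = 0" "x \<noteq> 0"
  shows "\<exists>Q\<in>polys_over K. inverse x = poly Q x"
  using assms
proof (induction P)
  case (pCons r P)
  have r: "r \<in> K" "P \<in> polys_over K" using pCons.prems polys_over_pCons[OF K_ring] by auto
  show ?case
  proof (cases "r = 0")
    case True
    then show ?thesis using pCons r by auto
  next
    case False
    have "x * (- (poly P x) / r) = 1" using pCons.prems False
      by (simp add: field_simps add_eq_0_iff)
    then have "inverse x = poly (smult (- 1 / r) P) x"
      using pCons.prems(4) by (simp add: field_simps)
    moreover have "smult (- 1 / r) P \<in> polys_over K"
      using r KD by (intro polys_over_smult[OF K_ring]) auto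
    ultimately show ?thesis by blast
  qed
qed simp

lemma polys_range_subfield: "subfield {poly P x | P. P \<in> polys_over K}" (is "subfield ?V")
  unfolding subfield_def
proof (intro conjI ballI)
  show "0 \<in> ?V" using polys_over_0[OF K_ring] by force
  show "1 \<in> ?V" using polys_over_monom[OF K_ring KD(2), of 0] by (force simp: monom_0)
  show "u + v \<in> ?V" "u - v \<in> ?V" "u * v \<in> ?V" if "u \<in> ?V" "v \<in> ?V" for u v
    using that polys_over_add[OF K_ring] polys_over_diff[OF K_ring] polys_over_mult[OF K_ring]
    by (auto simp flip: poly_add poly_diff poly_mult)
  show "inverse u \<in> ?V" if u: "u \<in> ?V" for u
  proof (cases "u = 0")
    case True
    then show ?thesis using u by simp
  next
    case False
    obtain P where "P \<in> polys_over K" "P \<noteq> 0" "poly P u = 0" by (rule annihilating_poly)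
    from inverse_as_poly[OF this False] obtain Q where Q: "Q \<in> polys_over K" "inverse u = poly Q u"
      by blast
    obtain R where R: "R \<in> polys_over K" "u = poly R x" using u by blast
    have "inverse u = poly (pcompose Q R) x" using Q R by (simp add: poly_pcompose)
    then show ?thesis using polys_over_pcompose[OF K_ring Q(1) R(1)] by blast
  qed
qed

text \<open>The elements \<open>poly P b\<close> form a field larger than \<open>K\<close>, hence
  everything. Division by a monic annihilator of least degree shows that so many powers of
  \<open>b\<close> already span, so this degree is at least \<open>p\<close>.\<close>

lemma powers_independent:
  assumes b: "b \<notin> K" and P: "P \<in> polys_over K" "degree P < p" "poly P b = 0"
  shows "P = 0"
proof (rule ccontr)
  assume "P \<noteq> 0"
  let ?Ann = "\<lambda>Q. Q \<in> polys_over K \<and> Q \<noteq> 0 \<and> poly Q b = 0"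
  obtain Q0 where Q0: "?Ann Q0" and mn: "\<And>Q. ?Ann Q \<Longrightarrow> degree Q0 \<le> degree Q"
    using ex_has_least_nat[of ?Ann P degree] P \<open>P \<noteq> 0\<close> by blast
  define Q where "Q = smult (inverse (lead_coeff Q0)) Q0"
  have Q: "Q \<in> polys_over K" "lead_coeff Q = 1" "poly Q b = 0" "degree Q = degree Q0"
    using Q0 by (auto simp: Q_def intro!: polys_over_smult[OF K_ring] KD polys_overD)
  have mp: "degree Q < p" using mn[of P] P \<open>P \<noteq> 0\<close> Q(4) by auto
  have "{poly P b | P. P \<in> polys_over K} = UNIV"
  proof -
    have "K \<subseteq> {poly P b | P. P \<in> polys_over K}"
      using polys_over_monom[OF K_ring, of _ 0] by (force simp: monom_0)
    moreover have "b \<in> {poly P b | P. P \<in> polys_over K}"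
      using polys_over_monom[OF K_ring KD(2), of 1] by (force simp: poly_monom)
    ultimately show ?thesis
      using intermediate_field_prime_degree[OF K p deg polys_range_subfield[of b]] b by blast
  qed
  then have "x \<in> lin_span K {..<degree Q} (\<lambda>i. b ^ i)" for x
  proof -
    obtain F where F: "F \<in> polys_over K" "x = poly F b"
      using \<open>{poly P b | P. P \<in> polys_over K} = UNIV\<close> by blast
    obtain q r where qr: "r \<in> polys_over K" "F = Q * q + r" "r = 0 \<or> degree r < degree Q"
      using monic_division[OF K_ring Q(1,2) F(1)] by metis
    have "x = poly r b" using F qr Q(3) by simp
    also have "\<dots> = (\<Sum>i<degree Q. coeff r i * b ^ i)"
      using qr(3) poly_eq_sum by fastforce
    finally show ?thesis unfolding lin_span_def using polys_overD[OF qr(1)] by blast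
  qed
  then have "lin_span K {..<degree Q} (\<lambda>i. b ^ i) = UNIV" by blast
  then have "p \<le> card {..<degree Q}" by (rule has_degree_span_card[OF K deg finite_lessThan])
  then show False using mp by simp
qed

lemma poly_representation:
  assumes b: "b \<notin> K"
  obtains P where "P \<in> polys_over K" "degree P < p" "poly P b = x"
proof -
  have "lin_dep K {..<Suc p} (\<lambda>i. if i < p then b ^ i else x)"
    using has_degree_lin_dep[OF K deg, of "{..<Suc p}"] by simp
  then obtain c where c: "\<forall>i\<in>{..<Suc p}. c i \<in> K" "\<exists>i\<in>{..<Suc p}. c i \<noteq> 0"
    "(\<Sum>i<Suc p. c i * (if i < p then b ^ i else x)) = 0" unfolding lin_dep_def by blast
  \<comment> \<open>One family serves twice: \<open>P 1\<close> shows that the coefficient of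
    \<open>x\<close> cannot vanish, and \<open>P (- c p)\<close> is the solution.\<close>
  define P where "P d = (\<Sum>i<p. monom (c i / d) i)" for d
  have PK: "P d \<in> polys_over K" if "d \<in> K" for d
    using c(1) KD that by (simp add: polys_over_def P_def coeff_sum_monom)
  have Pd: "degree (P d) < p" for d unfolding P_def using p_gt_1 by (intro degree_sum_monom) auto
  have s: "(\<Sum>i<p. c i * b ^ i) + c p * x = 0" using c(3) by simp
  have "c p \<noteq> 0"
  proof
    assume 0: "c p = 0"
    then have "poly (P 1) b = 0" using s by (simp add: P_def poly_sum_monom)
    then have "P 1 = 0" using powers_independent[OF b PK[OF KD(2)] Pd] by blast
    then have "c i = 0" if "i < p" for i
      using coeff_sum_monom[of "\<lambda>i. c i / 1" p i] that by (simp add: P_def)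
    then show False using 0 c(2) by (metis lessThan_iff less_Suc_eq)
  qed
  then have "x = - (\<Sum>i<p. c i * b ^ i) / c p" using s by (simp add: field_simps eq_neg_iff_add_eq_0)
  also have "\<dots> = poly (P (- c p)) b"
    by (simp add: P_def poly_sum_monom sum_divide_distrib sum_negf)
  finally show ?thesis using that[OF PK Pd, of "- c p"] c(1) KD by auto
qed

section \<open>Structure of the Galois group\<close>

lemma Gal_fixed_field:
  assumes \<sigma>: "\<sigma> \<in> Gal K" "\<sigma> \<noteq> id"
  shows "\<sigma> x = x \<longleftrightarrow> x \<in> K"
proof -
  have "subfield {x. \<sigma> x = x}" unfolding subfield_def
    using GalD[OF \<sigma>(1)] Gal_hom[OF \<sigma>(1)] by auto
  moreover have "{x. \<sigma> x = x} \<noteq> UNIV" using \<sigma>(2) by (auto simp: fun_eq_iff set_eq_iff)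
  moreover have "K \<subseteq> {x. \<sigma> x = x}" using GalD(4)[OF \<sigma>(1)] by auto
  ultimately show ?thesis using intermediate_field_prime_degree[OF K p deg] by blast
qed

lemma Gal_eqI:
  assumes "\<sigma> \<in> Gal K" "\<tau> \<in> Gal K" "a \<notin> K" "\<sigma> a = \<tau> a"
  shows "\<sigma> = \<tau>"
proof
  fix x
  obtain P where "P \<in> polys_over K" "poly P a = x" using poly_representation[OF assms(3)] by metis
  then show "\<sigma> x = \<tau> x" using Gal_poly assms by metis
qed

text \<open>Applying \<open>\<sigma>\<close> to the coefficients shifts the factors cyclically, so
  every coefficient is fixed by \<open>\<sigma>\<close> and lies in \<open>K\<close>.\<close>

lemma orbit_poly_over:
  assumes \<sigma>: "\<sigma> \<in> Gal K" "\<sigma> \<noteq> id" and n: "(\<sigma> ^^ n) y = y"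
  shows "(\<Prod>i<n. [:- (\<sigma> ^^ i) y, 1:]) \<in> polys_over K" (is "?h n \<in> _")
proof -
  note s = GalD[OF \<sigma>(1)] Gal_hom[OF \<sigma>(1)]
  have "map_poly \<sigma> (?h m) = (\<Prod>i<m. [:- (\<sigma> ^^ Suc i) y, 1:])" for m
  proof (induction m)
    case (Suc m)
    have "map_poly \<sigma> (?h m * [:- (\<sigma> ^^ m) y, 1:]) = map_poly \<sigma> (?h m) * map_poly \<sigma> [:- (\<sigma> ^^ m) y, 1:]"
      by (rule map_poly_mult_hom) (simp_all only: s)
    also have "map_poly \<sigma> [:- (\<sigma> ^^ m) y, 1:] = [:- (\<sigma> ^^ Suc m) y, 1:]"
      by (simp add: s map_poly_pCons)
    finally show ?case using Suc by (simp only: prod.lessThan_Suc)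
  qed (simp add: s)
  \<comment> \<open>Both products are completed to the same \<open>n + 1\<close> factors, the first
    and the last being equal, and then this factor is cancelled.\<close>
  moreover have "[:- (\<sigma> ^^ 0) y, 1:] * (\<Prod>i<n. [:- (\<sigma> ^^ Suc i) y, 1:]) = ?h (Suc n)"
    by (rule prod.lessThan_Suc_shift[symmetric])
  then have "[:- y, 1:] * (\<Prod>i<n. [:- (\<sigma> ^^ Suc i) y, 1:]) = [:- y, 1:] * ?h n"
    using n by (simp add: mult.commute del: funpow.simps)
  then have "(\<Prod>i<n. [:- (\<sigma> ^^ Suc i) y, 1:]) = ?h n"
    by (subst (asm) mult_cancel_left) simp
  ultimately have "map_poly \<sigma> (?h n) = ?h n" by metis
  then have "\<sigma> (coeff (?h n) i) = coeff (?h n) i" for i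
    by (metis coeff_map_poly s(5))
  then show ?thesis using Gal_fixed_field[OF \<sigma>] by (simp add: polys_over_def)
qed

lemma degree_prod_linear: "degree (\<Prod>i<n. [:- f i, 1::'a:]) = n" "lead_coeff (\<Prod>i<n. [:- f i, 1::'a:]) = 1"
proof -
  show "degree (\<Prod>i<n. [:- f i, 1::'a:]) = n" by (subst degree_prod_eq_sum_degree) auto
  show "lead_coeff (\<Prod>i<n. [:- f i, 1::'a:]) = 1" by (subst lead_coeff_prod) auto
qed

text \<open>Counting roots of an annihilating polynomial gives the orbit of \<open>a\<close> a
  period of at most \<open>p\<close>. The orbit polynomial of that period annihilates
  \<open>a\<close> over \<open>K\<close>, so the period cannot be below \<open>p\<close>
  either.\<close>

lemma Gal_order_aux:
  assumes \<sigma>: "\<sigma> \<in> Gal K" "\<sigma> \<noteq> id" and a: "a \<notin> K"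
  shows "(\<sigma> ^^ p) a = a"
proof -
  obtain P where P: "P \<in> polys_over K" "P \<noteq> 0" "degree P \<le> p" "poly P a = 0"
    by (rule annihilating_poly)
  have "\<not> inj_on (\<lambda>i. (\<sigma> ^^ i) a) {..p}"
  proof
    assume "inj_on (\<lambda>i. (\<sigma> ^^ i) a) {..p}"
    then have "card ((\<lambda>i. (\<sigma> ^^ i) a) ` {..p}) = Suc p" by (simp add: card_image)
    moreover have "(\<lambda>i. (\<sigma> ^^ i) a) ` {..p} \<subseteq> {x. poly P x = 0}"
      using Gal_poly[OF Gal_funpow[OF \<sigma>(1)] P(1), of _ a] P(4) Gal_hom(1)[OF Gal_funpow[OF \<sigma>(1)]]
      by (auto; metis)
    ultimately have "Suc p \<le> card {x. poly P x = 0}"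
      using poly_roots_finite[OF P(2)] by (metis card_mono)
    then show False using card_poly_roots_bound[OF P(2)] P(3) by simp
  qed
  then obtain i j where ij: "i < j" "j \<le> p" "(\<sigma> ^^ i) a = (\<sigma> ^^ j) a"
    unfolding inj_on_def by (metis atMost_iff linorder_neqE_nat)
  then have "(\<sigma> ^^ i) ((\<sigma> ^^ (j - i)) a) = (\<sigma> ^^ i) a"
    by (metis add_diff_inverse_nat comp_apply funpow_add less_asym)
  then have m: "(\<sigma> ^^ (j - i)) a = a" using Gal_hom(8)[OF Gal_funpow[OF \<sigma>(1)]] by blast
  let ?h = "\<Prod>k<j - i. [:- (\<sigma> ^^ k) a, 1:]"
  have "poly ?h a = 0" unfolding poly_prod using ij
    by (intro prod_zero) (auto intro!: bexI[of _ 0])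
  moreover have "?h \<noteq> 0" by (metis degree_prod_linear(2) leading_coeff_0_iff zero_neq_one)
  ultimately have "\<not> degree ?h < p"
    using powers_independent[OF a orbit_poly_over[OF \<sigma> m]] by blast
  then have "j - i = p" using ij degree_prod_linear(1) by auto
  then show ?thesis using m by simp
qed

lemma Gal_order:
  assumes \<sigma>: "\<sigma> \<in> Gal K"
  shows "(\<sigma> ^^ p) x = x"
proof (cases "\<sigma> = id \<or> x \<in> K")
  case True
  then show ?thesis using GalD(4)[OF Gal_funpow[OF \<sigma>]] by auto
qed (use Gal_order_aux[OF \<sigma>] in auto)

text \<open>\<open>\<tau> a\<close> is a root of the orbit polynomial of \<open>a\<close> under
  \<open>\<sigma>\<close>, and an automorphism is determined by its value at
  \<open>a\<close>.\<close>

lemma Gal_cyclic: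
  assumes \<sigma>: "\<sigma> \<in> Gal K" "\<sigma> \<noteq> id" and \<tau>: "\<tau> \<in> Gal K"
  obtains i where "i < p" "\<tau> = \<sigma> ^^ i"
proof -
  obtain a where a: "a \<notin> K" using K_ne_UNIV by blast
  let ?h = "\<Prod>k<p. [:- (\<sigma> ^^ k) a, 1:]"
  have "poly ?h a = 0" unfolding poly_prod using p_gt_1
    by (intro prod_zero) (auto intro!: bexI[of _ 0])
  then have "poly ?h (\<tau> a) = 0"
    using Gal_poly[OF \<tau> orbit_poly_over[OF \<sigma> Gal_order[OF \<sigma>(1)]]] Gal_hom(1)[OF \<tau>] by metis
  then obtain i where i: "i < p" "\<tau> a = (\<sigma> ^^ i) a" by (auto simp: poly_prod)
  then have "\<tau> = \<sigma> ^^ i" using Gal_eqI[OF \<tau> Gal_funpow[OF \<sigma>(1)] a] by blast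
  then show ?thesis using that i by blast
qed

lemma Gal_nontrivial: obtains \<sigma> where "\<sigma> \<in> Gal K" "\<sigma> \<noteq> id"
proof -
  have "\<exists>\<sigma>\<in>Gal K. \<sigma> \<noteq> id"
  proof (rule ccontr)
    assume "\<not> ?thesis"
    then have "{x. \<forall>\<sigma>\<in>Gal K. \<sigma> x = x} = UNIV" by auto
    then show False using gal K_ne_UNIV unfolding galois_ext_def by simp
  qed
  then show ?thesis using that by blast
qed

lemma generator_iff: "generator (Gal K) \<sigma> \<longleftrightarrow> \<sigma> \<in> Gal K \<and> \<sigma> \<noteq> id"
proof
  assume g: "generator (Gal K) \<sigma>"
  obtain \<tau> where "\<tau> \<in> Gal K" "\<tau> \<noteq> id" by (rule Gal_nontrivial)
  then show "\<sigma> \<in> Gal K \<and> \<sigma> \<noteq> id" using g unfolding generator_def by (auto simp: id_funpow)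
next
  assume \<sigma>: "\<sigma> \<in> Gal K \<and> \<sigma> \<noteq> id"
  then show "generator (Gal K) \<sigma>" unfolding generator_def
    using Gal_cyclic[of \<sigma>] Gal_funpow by (auto simp: image_iff) metis
qed

lemma trace_in_K:
  assumes \<sigma>: "\<sigma> \<in> Gal K" "\<sigma> \<noteq> id"
  shows "(\<Sum>i<p. (\<sigma> ^^ i) y) \<in> K"
proof -
  have "(\<Sum>i<p. (\<sigma> ^^ Suc i) y) + y = (\<Sum>i<p. (\<sigma> ^^ i) y) + y"
    using sum.lessThan_Suc_shift[of "\<lambda>i. (\<sigma> ^^ i) y" p] sum.lessThan_Suc[of "\<lambda>i. (\<sigma> ^^ i) y" p]
      Gal_order[OF \<sigma>(1), of y] by (simp add: add.commute)
  then show ?thesis by (simp flip: Gal_fixed_field[OF \<sigma>] add: Gal_sum[OF \<sigma>(1)])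
qed

lemma norm_in_K:
  assumes \<sigma>: "\<sigma> \<in> Gal K" "\<sigma> \<noteq> id"
  shows "(\<Prod>i<p. (\<sigma> ^^ i) y) \<in> K"
proof (cases "y = 0")
  case True
  then show ?thesis using p_gt_1 KD Gal_hom(1)[OF Gal_funpow[OF \<sigma>(1)]] by (simp add: power_0_left)
next
  case False
  have "(\<Prod>i<p. (\<sigma> ^^ Suc i) y) * y = (\<Prod>i<p. (\<sigma> ^^ i) y) * y"
    using prod.lessThan_Suc_shift[of "\<lambda>i. (\<sigma> ^^ i) y" p] prod.lessThan_Suc[of "\<lambda>i. (\<sigma> ^^ i) y" p]
      Gal_order[OF \<sigma>(1), of y] by (metis funpow_0 mult.commute)
  then show ?thesis using False by (simp flip: Gal_fixed_field[OF \<sigma>] add: Gal_prod[OF \<sigma>(1)])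
qed

lemma gen_field_imp_notin:
  assumes "gen_field K a = UNIV" shows "a \<notin> K"
proof
  assume "a \<in> K"
  then have "gen_field K a \<subseteq> K" unfolding gen_field_def using K by auto
  then show False using assms K_ne_UNIV by auto
qed

end

section \<open>Purely inseparable residues\<close>

text \<open>\<open>M\<close> is the maximal ideal, as everything outside it is a unit. Congruence
  modulo \<open>M\<close> stands for equality in the residue field, which is never formed.\<close>

definition local_subring :: "'a::field set \<Rightarrow> 'a set \<Rightarrow> bool" where
  "local_subring R M \<longleftrightarrow> subring_set R \<and> M \<subseteq> R \<and> 0 \<in> M \<and> 1 \<notin> M \<and> (\<forall>x\<in>M. \<forall>y\<in>M. x + y \<in> M)
     \<and> (\<forall>r\<in>R. \<forall>x\<in>M. r * x \<in> M) \<and> (\<forall>x\<in>R - M. inverse x \<in> R)"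

text \<open>The coefficient that gives \<open>y\<close> away: if a polynomial over \<open>K\<close>
  is congruent to \<open>(X - y)^j\<close> and \<open>j\<close> is a unit, then \<open>y\<close> is
  congruent to an element of \<open>K\<close>.\<close>

lemma coeff_linear_power_pred:
  "0 < j \<Longrightarrow> coeff ([:- y, 1::'a::field:] ^ j) (j - 1) = - (of_nat j * y)"
  by (cases j) (simp_all add: coeff_linear_poly_power del: power_Suc)

lemma pcompose_linear_power:
  "pcompose ([:a, 1::'a::field:] ^ n) [:b, 1:] = [:a + b, 1:] ^ n"
  by (induction n) (simp_all add: pcompose_mult pcompose_pCons pcompose_1 del: mult_pCons_left)

context
  fixes R M :: "'a::field set"
  assumes loc: "local_subring R M"
begin

lemma local_subring_ring: "subring_set R" using loc unfolding local_subring_def by blast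

lemmas local_subringD = subring_setD[OF local_subring_ring]

lemma idealD: "0 \<in> M" "1 \<notin> M" "x \<in> M \<Longrightarrow> x \<in> R" "x \<in> M \<Longrightarrow> y \<in> M \<Longrightarrow> x + y \<in> M"
  "r \<in> R \<Longrightarrow> x \<in> M \<Longrightarrow> r * x \<in> M" "x \<in> R \<Longrightarrow> x \<notin> M \<Longrightarrow> inverse x \<in> R"
  using loc unfolding local_subring_def by auto

lemma ideal_diff: "x \<in> M \<Longrightarrow> y \<in> M \<Longrightarrow> x - y \<in> M"
  using idealD(4)[of x "(- 1) * y"] idealD(5)[of "- 1" y] local_subringD(6)[OF local_subringD(2)] by simp

lemma ideal_sum: "(\<And>i. i \<in> I \<Longrightarrow> f i \<in> M) \<Longrightarrow> sum f I \<in> M"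
  by (induction I rule: infinite_finite_induct) (auto simp: idealD)

lemma ideal_prime: "x \<in> R \<Longrightarrow> x \<notin> M \<Longrightarrow> x * y \<in> M \<Longrightarrow> y \<in> M"
  using idealD(5)[of "inverse x" "x * y"] idealD(1) idealD(6)[of x]
  by (cases "x = 0") (auto simp flip: mult.assoc)

lemma polys_ideal_diff: "P \<in> polys_over M \<Longrightarrow> Q \<in> polys_over M \<Longrightarrow> P - Q \<in> polys_over M"
  and polys_ideal_add: "P \<in> polys_over M \<Longrightarrow> Q \<in> polys_over M \<Longrightarrow> P + Q \<in> polys_over M"
  by (auto simp: polys_over_def ideal_diff idealD)

lemma polys_ideal_mult: "P \<in> polys_over R \<Longrightarrow> Q \<in> polys_over M \<Longrightarrow> P * Q \<in> polys_over M"
  by (auto simp: polys_over_def coeff_mult intro!: ideal_sum idealD(5))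

lemma polys_ideal_pcompose:
  "P \<in> polys_over M \<Longrightarrow> Q \<in> polys_over R \<Longrightarrow> pcompose P Q \<in> polys_over M"
proof (induction P)
  case (pCons a P)
  have "coeff (pCons a P) 0 \<in> M" "coeff (pCons a P) (Suc i) \<in> M" for i
    using pCons.prems(1) unfolding polys_over_def by blast+
  then have "a \<in> M" "P \<in> polys_over M" by (auto simp: polys_over_def)
  moreover from this have "[:a:] \<in> polys_over M"
    by (auto simp: polys_over_def coeff_pCons idealD split: nat.splits)
  ultimately show ?case using pCons by (auto simp: pcompose_pCons intro!: polys_ideal_add polys_ideal_mult)
qed (simp add: polys_over_def idealD)

lemma poly_ideal: "P \<in> polys_over M \<Longrightarrow> x \<in> R \<Longrightarrow> poly P x \<in> M"
  unfolding poly_altdef polys_over_def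
  using subring_power[OF local_subring_ring] idealD(5) by (auto intro!: ideal_sum simp: mult.commute[of "coeff P _"])

text \<open>Over the residue field a monic factor of a power of \<open>X\<close> is a power of
  \<open>X\<close>. As in Gauss's lemma, the lowest coefficients of \<open>G\<close> and
  \<open>Q\<close> outside \<open>M\<close> produce a coefficient of the product outside
  \<open>M\<close>, which can only be the leading one.\<close>

lemma monic_factor_of_power_mod_ideal:
  assumes G: "G \<in> polys_over R" "lead_coeff G = 1" and Q: "Q \<in> polys_over R" "lead_coeff Q = 1"
    and M: "G * Q - monom 1 (degree G + degree Q) \<in> polys_over M" and i: "i < degree G"
  shows "coeff G i \<in> M"
proof -
  define s where "s = (LEAST i. coeff G i \<notin> M)"
  define t where "t = (LEAST i. coeff Q i \<notin> M)"
  have ex: "coeff G (degree G) \<notin> M" "coeff Q (degree Q) \<notin> M"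
    using G(2) Q(2) idealD(2) by auto
  then have s: "coeff G s \<notin> M" "s \<le> degree G" "\<And>i. i < s \<Longrightarrow> coeff G i \<in> M"
    unfolding s_def using LeastI[of "\<lambda>i. coeff G i \<notin> M"] Least_le[of "\<lambda>i. coeff G i \<notin> M"] not_less_Least
    by blast+
  from ex have t: "coeff Q t \<notin> M" "t \<le> degree Q" "\<And>i. i < t \<Longrightarrow> coeff Q i \<in> M"
    unfolding t_def using LeastI[of "\<lambda>i. coeff Q i \<notin> M"] Least_le[of "\<lambda>i. coeff Q i \<notin> M"] not_less_Least
    by blast+
  have "coeff (G * Q) (s + t) = coeff G s * coeff Q t + (\<Sum>i\<in>{..s+t} - {s}. coeff G i * coeff Q (s + t - i))"
    unfolding coeff_mult by (subst sum.remove[of _ s]) auto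
  moreover have "(\<Sum>i\<in>{..s+t} - {s}. coeff G i * coeff Q (s + t - i)) \<in> M"
  proof (rule ideal_sum)
    fix i assume "i \<in> {..s+t} - {s}"
    then have "i < s \<or> s + t - i < t" by auto
    then show "coeff G i * coeff Q (s + t - i) \<in> M"
      using idealD(5)[OF polys_overD[OF G(1)] t(3)] idealD(5)[OF polys_overD[OF Q(1)] s(3)]
      by (auto simp: mult.commute)
  qed
  moreover have "coeff G s * coeff Q t \<notin> M"
    using ideal_prime[OF polys_overD[OF G(1)] s(1)] t(1) by blast
  ultimately have "coeff (G * Q) (s + t) \<notin> M"
    using ideal_diff by (metis add_diff_cancel_right')
  then have "s + t = degree G + degree Q"
    using polys_overD[OF M, of "s + t"] by (auto simp: coeff_monom split: if_splits)
  then have "s = degree G" using s t by linarith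
  then show ?thesis using i s(3) by simp
qed

lemma of_nat_notin_ideal:
  assumes "prime p" "of_nat p \<in> M" "0 < j" "j < p"
  shows "of_nat j \<notin> M"
proof
  assume j: "of_nat j \<in> M"
  have "coprime j p" using assms(1,3,4)
    by (metis coprime_commute nat_dvd_not_less prime_imp_coprime)
  then obtain x y where "j * x - p * y = 1 \<or> p * y - j * x = (1::nat)"
    using bezout_nat[of j p] assms(3) by (metis add_diff_cancel_left' coprime_iff_gcd_eq_1 neq0_conv)
  moreover have "of_nat x * of_nat j - of_nat y * of_nat p \<in> M"
    "of_nat y * of_nat p - of_nat x * of_nat j \<in> M"
    using j assms(2) idealD(5)[OF subring_of_nat[OF local_subring_ring]] ideal_diff by blast+
  ultimately have "1 \<in> M"
    by (metis (no_types, lifting) diff_is_0_eq mult.commute nat_le_linear of_nat_1 of_nat_diff of_nat_mult zero_neq_one)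
  then show False using idealD by blast
qed

text \<open>Modulo \<open>M\<close> the polynomial \<open>h\<close> is \<open>(X - y)^p\<close>, so
  a minimal polynomial of the residue of \<open>y\<close> is \<open>(X - y)^m\<close>. If
  \<open>m < p\<close>, its second coefficient \<open>- m y\<close> puts \<open>y\<close> into
  \<open>K + M\<close>, contrary to hypothesis; so the powers of \<open>y\<close> below
  \<open>p\<close> are independent modulo \<open>M\<close>.\<close>

lemma inseparable_independence:
  assumes K: "subfield K" and p: "prime p" and y: "y \<in> R"
    and ynot: "\<And>c. c \<in> K \<Longrightarrow> c \<in> R \<Longrightarrow> y - c \<notin> M"
    and h: "h \<in> polys_over (K \<inter> R)" "lead_coeff h = 1" "degree h = p"
    and hM: "h - [:- y, 1:] ^ p \<in> polys_over M"
    and g: "g \<in> polys_over (K \<inter> R)" "degree g < p" "poly g y \<in> M"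
  shows "g \<in> polys_over M"
proof (rule ccontr)
  assume notM: "g \<notin> polys_over M"
  have KR: "subring_set (K \<inter> R)"
    using subfieldD[OF K] local_subringD unfolding subring_set_def by auto
  have KRinv: "inverse x \<in> K \<inter> R" if "x \<in> K \<inter> R" "x \<notin> M" for x
    using that subfieldD[OF K] idealD by auto
  \<comment> \<open>a relation \<open>m y + c \<in> M\<close> with \<open>m\<close> invertible would put \<open>y\<close> into \<open>K + M\<close>\<close>
  have no_rel: False if "of_nat m \<notin> M" "c \<in> K \<inter> R" "c + of_nat m * y \<in> M" for m c
  proof -
    have m: "of_nat m \<in> K \<inter> R" using subring_of_nat[OF KR] .
    have m0: "of_nat m \<noteq> (0::'a)" using that(1) idealD(1) by metis
    have "inverse (of_nat m) * (c + of_nat m * y) \<in> M"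
      using that(3) KRinv[OF m that(1)] idealD(5) by blast
    moreover have "inverse (of_nat m) * (c + of_nat m * y) = y - (- (inverse (of_nat m) * c))"
      using m0 by (simp add: field_simps)
    moreover have "- (inverse (of_nat m) * c) \<in> K \<inter> R"
      by (rule subring_setD(6)[OF KR subring_setD(5)[OF KR KRinv[OF m that(1)] that(2)]])
    ultimately show False using ynot[of "- (inverse (of_nat m) * c)"] by simp
  qed
  have pM: "of_nat p \<in> M"
  proof (rule ccontr)
    assume "of_nat p \<notin> M"
    moreover have "coeff h (p - 1) + of_nat p * y \<in> M"
      using polys_overD[OF hM, of "p - 1"] coeff_linear_power_pred[of p y] prime_gt_0_nat[OF p] by simp
    ultimately show False using no_rel polys_overD[OF h(1)] by blast
  qed
  let ?P = "\<lambda>g. g \<in> polys_over (K \<inter> R) \<and> poly g y \<in> M \<and> g \<notin> polys_over M"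
  obtain g0 where g0: "?P g0" and mn: "\<And>q. ?P q \<Longrightarrow> degree g0 \<le> degree q"
    using ex_has_least_nat[of ?P g degree] g notM by blast
  \<comment> \<open>Otherwise dropping the leading term would give a counterexample of smaller
    degree; so \<open>g0\<close> can be made monic over \<open>K \<inter> R\<close>.\<close>
  have lc: "lead_coeff g0 \<notin> M"
  proof
    assume lcM: "lead_coeff g0 \<in> M"
    let ?m = "monom (lead_coeff g0) (degree g0)"
    have mM: "?m \<in> polys_over M" using lcM idealD(1) by (auto simp: polys_over_def coeff_monom)
    have "g0 - ?m \<notin> polys_over M"
      using polys_ideal_add[OF _ mM, of "g0 - ?m"] g0 by auto
    then have P': "?P (g0 - ?m)"
      using g0 mM polys_over_diff[OF KR] polys_over_monom[OF KR polys_overD] poly_ideal[OF mM y] ideal_diff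
      by auto
    have "0 \<in> polys_over M" using idealD(1) by (simp add: polys_over_def)
    then have "g0 - ?m \<noteq> 0" using \<open>g0 - ?m \<notin> polys_over M\<close> by metis
    moreover have "degree (g0 - ?m) \<le> degree g0"
      by (intro degree_diff_le) (auto simp: degree_monom_le)
    moreover have "coeff (g0 - ?m) (degree g0) = 0" by simp
    ultimately have "degree (g0 - ?m) < degree g0" by (metis leading_coeff_0_iff order_le_less)
    then show False using mn[OF P'] by simp
  qed
  define f where "f = smult (inverse (lead_coeff g0)) g0"
  have lc0: "lead_coeff g0 \<noteq> 0" using lc idealD(1) by metis
  have invlc: "inverse (lead_coeff g0) \<in> K \<inter> R"
    using KRinv[OF polys_overD lc] g0 by blast
  have f: "f \<in> polys_over (K \<inter> R)" "lead_coeff f = 1" "poly f y \<in> M" "degree f = degree g0"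
    using g0 lc0 invlc idealD(5) polys_over_smult[OF KR invlc] unfolding f_def by auto
  have fp: "degree f < p" using mn[of g] g notM f(4) by auto
  have fpos: "0 < degree f"
  proof (rule ccontr)
    assume "\<not> 0 < degree f"
    then have "f = 1" using f(2) by (metis degree_0_id gr0I of_nat_1 one_pCons)
    then show False using f(3) idealD(2) by simp
  qed
  obtain q r where qr: "q \<in> polys_over (K \<inter> R)" "r \<in> polys_over (K \<inter> R)" "h = f * q + r"
    "r = 0 \<or> degree r < degree f"
    using monic_division[OF KR f(1,2) h(1)] by metis
  have "poly h y = poly (h - [:- y, 1:] ^ p) y" using prime_gt_0_nat[OF p] by simp
  then have "poly h y \<in> M" using poly_ideal[OF hM y] by (simp only:)
  then have "poly f y * poly q y + poly r y \<in> M" using qr(3) by simp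
  moreover have qR: "q \<in> polys_over R" "f \<in> polys_over R" using qr(1) f(1) by (auto simp: polys_over_def)
  then have "poly f y * poly q y \<in> M"
    using idealD(5)[OF poly_in_subring[OF local_subring_ring _ y] f(3)] by (metis mult.commute)
  ultimately have "poly r y \<in> M" using ideal_diff by (metis add_diff_cancel_left')
  \<comment> \<open>By minimality of \<open>f\<close> the remainder vanishes modulo
    \<open>M\<close>, so \<open>f\<close> divides \<open>(X - y)^p\<close> there.\<close>
  then have rM: "r \<in> polys_over M"
  proof (cases "r = 0")
    case True
    then show ?thesis using idealD(1) by (simp add: polys_over_def)
  next
    case False
    then show ?thesis using mn[of r] qr(2,4) f(4) \<open>poly r y \<in> M\<close> not_less by metis
  qed
  have r0: "degree (h - r) = p" "lead_coeff (h - r) = 1"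
  proof -
    have "degree r < degree h" using qr(4) fp h(3) by auto
    then show "degree (h - r) = p"
      using h(3) by (metis diff_conv_add_uminus degree_add_eq_left degree_minus)
    then show "lead_coeff (h - r) = 1"
      using h(2,3) \<open>degree r < degree h\<close> by (simp add: coeff_eq_0)
  qed
  have fq: "f * q = h - r" using qr(3) by simp
  have q1: "lead_coeff q = 1" using r0(2) lead_coeff_mult[of f q] f(2) fq by simp
  have dq: "degree f + degree q = p"
    using r0(1) fq degree_mult_eq[of f q] f(2) q1 by (metis leading_coeff_0_iff one_neq_zero)
  \<comment> \<open>The translation turns \<open>(X - y)^p\<close> into \<open>X^p\<close>; the
    coefficients now lie in \<open>R\<close> only, which suffices for factoring.\<close>
  let ?s = "[:y, 1:]"
  have sR: "[:y, 1:] \<in> polys_over R" "[:- y, 1:] \<in> polys_over R"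
    using y local_subringD polys_over_0[OF local_subring_ring] by (auto simp: polys_over_pCons[OF local_subring_ring])
  define G where "G = pcompose f ?s"
  define Q where "Q = pcompose q ?s"
  have lcs: "lead_coeff (pcompose P ?s) = lead_coeff P" for P :: "'a poly"
    by (subst lead_coeff_comp) auto
  have GQ: "lead_coeff G = 1" "lead_coeff Q = 1"
    unfolding G_def Q_def lcs by (fact f(2) q1)+
  have GQ': "degree G = degree f" "degree Q = degree q" "G \<in> polys_over R" "Q \<in> polys_over R"
    unfolding G_def Q_def using polys_over_pcompose[OF local_subring_ring _ sR(1)] qR by (simp_all add: degree_pcompose)
  have "f * q - [:- y, 1:] ^ p = (h - [:- y, 1:] ^ p) - r" using fq by simp
  then have "f * q - [:- y, 1:] ^ p \<in> polys_over M" using polys_ideal_diff[OF hM rM] by (simp only:)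
  then have "pcompose (f * q - [:- y, 1:] ^ p) ?s \<in> polys_over M"
    using polys_ideal_pcompose sR by blast
  then have "G * Q - monom 1 (degree G + degree Q) \<in> polys_over M"
    using dq GQ' by (simp add: pcompose_diff pcompose_mult pcompose_linear_power G_def Q_def monom_altdef)
  then have "coeff G i \<in> M" if "i < degree f" for i
    using monic_factor_of_power_mod_ideal[of G Q i] GQ GQ' that by simp
  then have "G - monom 1 (degree f) \<in> polys_over M"
    using GQ GQ' idealD(1) unfolding polys_over_def
    by (auto simp: coeff_monom coeff_eq_0 not_less le_less) (metis linorder_less_linear coeff_eq_0)
  then have "pcompose (G - [:0, 1:] ^ degree f) [:- y, 1:] \<in> polys_over M"
    using polys_ideal_pcompose sR by (simp add: monom_altdef)
  moreover have "pcompose G [:- y, 1:] = f"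
    unfolding G_def by (simp flip: pcompose_assoc add: pcompose_pCons)
  ultimately have "f - [:- y, 1:] ^ degree f \<in> polys_over M"
    by (simp add: pcompose_diff pcompose_linear_power)
  then have "coeff f (degree f - 1) + of_nat (degree f) * y \<in> M"
    using polys_overD[of "f - [:- y, 1:] ^ degree f" M "degree f - 1"]
      coeff_linear_power_pred[OF fpos, of y] by simp
  then show False
    using no_rel[OF of_nat_notin_ideal[OF p pM fpos fp]] polys_overD[OF f(1)] by blast
qed

lemma prod_linear_over:
  "(\<And>i::nat. i < n \<Longrightarrow> z i \<in> R) \<Longrightarrow> (\<Prod>i<n. [:- z i, 1:]) \<in> polys_over R"
proof (induction n)
  case 0
  show ?case using polys_over_monom[OF local_subring_ring local_subringD(2), of 0] by (simp add: monom_0 one_pCons)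
next
  case (Suc n)
  have "[:- z n, 1:] \<in> polys_over R"
    using Suc.prems[of n] local_subringD polys_over_0[OF local_subring_ring] by (simp add: polys_over_pCons[OF local_subring_ring])
  then show ?case using Suc polys_over_mult[OF local_subring_ring] by (simp only: prod.lessThan_Suc less_SucI)
qed

text \<open>Used for the orbit polynomial: once all conjugates of \<open>y\<close> are congruent to
  \<open>y\<close>, it becomes \<open>(X - y)^p\<close> modulo \<open>M\<close>.\<close>

lemma prod_linear_cong:
  assumes y: "y \<in> R"
  shows "(\<And>i::nat. i < n \<Longrightarrow> z i - y \<in> M) \<Longrightarrow> (\<Prod>i<n. [:- z i, 1:]) - [:- y, 1:] ^ n \<in> polys_over M"
proof (induction n)
  case 0
  show ?case using idealD(1) by (simp add: polys_over_def)
next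
  case (Suc n)
  let ?P = "\<Prod>i<n. [:- z i, 1:]" and ?Q = "[:- y, 1:] ^ n"
  have zn: "z n - y \<in> M" using Suc.prems by blast
  then have "z n \<in> R" using y idealD(3) local_subringD(3) by (metis diff_add_cancel)
  then have l: "[:- z n, 1:] \<in> polys_over R"
    using local_subringD polys_over_0[OF local_subring_ring] by (simp add: polys_over_pCons[OF local_subring_ring])
  have d: "[:- (z n - y):] \<in> polys_over M"
    using ideal_diff[OF idealD(1) zn] idealD(1) by (auto simp: polys_over_def coeff_pCons split: nat.splits)
  have Q: "?Q \<in> polys_over R" using prod_linear_over[of n "\<lambda>_. y"] y by simp
  have "(\<Prod>i<Suc n. [:- z i, 1:]) - [:- y, 1:] ^ Suc n
    = [:- z n, 1:] * (?P - ?Q) + ?Q * [:- (z n - y):]"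
  proof -
    have "[:- (z n - y):] = [:- z n, 1:] - [:- y, 1:]" by simp
    then show ?thesis by (simp only: prod.lessThan_Suc power_Suc) (simp only: algebra_simps)
  qed
  also have "\<dots> \<in> polys_over M"
    using Suc polys_ideal_mult[OF l] polys_ideal_mult[OF Q d] by (intro polys_ideal_add) auto
  finally show ?case .
qed

end

section \<open>Krull valuations\<close>

locale krull_valuation =
  fixes v :: "'a::field \<Rightarrow> 'b::linordered_ab_group_add"
  assumes val: "valuation v"
begin

lemma v_mult: "x \<noteq> 0 \<Longrightarrow> y \<noteq> 0 \<Longrightarrow> v (x * y) = v x + v y"
  using val unfolding valuation_def by blast

lemma v_one: "v 1 = 0"
  using v_mult[of 1 1] by simp

lemma v_minus: "v (- x) = v x"
proof (cases "x = 0")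
  case False
  have "v (- 1) + v (- 1) = 0" using v_mult[of "- 1" "- 1"] v_one by simp
  then have "v (- 1) = 0" by (simp only: double_zero)
  then show ?thesis using v_mult[of "- 1" x] False by simp
qed simp

lemma v_inverse: "x \<noteq> 0 \<Longrightarrow> v (inverse x) = - v x"
  using v_mult[of x "inverse x"] v_one by (simp add: eq_neg_iff_add_eq_0 add.commute)

lemma v_divide: "x \<noteq> 0 \<Longrightarrow> y \<noteq> 0 \<Longrightarrow> v (x / y) = v x - v y"
  by (simp add: divide_inverse v_mult v_inverse)

lemma v_prod: "finite I \<Longrightarrow> (\<And>i. i \<in> I \<Longrightarrow> f i \<noteq> 0) \<Longrightarrow> v (prod f I) = (\<Sum>i\<in>I. v (f i))"
  by (induction I rule: finite_induct) (auto simp: v_one v_mult)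

text \<open>The value at \<open>0\<close> is unspecified, so bounds on values are stated with \<open>0\<close> allowed explicitly.\<close>

definition vge :: "'b \<Rightarrow> 'a \<Rightarrow> bool" where "vge \<gamma> x \<longleftrightarrow> x = 0 \<or> \<gamma> \<le> v x"
definition vgt :: "'b \<Rightarrow> 'a \<Rightarrow> bool" where "vgt \<gamma> x \<longleftrightarrow> x = 0 \<or> \<gamma> < v x"

lemma vge_0 [simp]: "vge \<gamma> 0" and vgt_0 [simp]: "vgt \<gamma> 0"
  by (auto simp: vge_def vgt_def)

lemma vgt_imp_vge: "vgt \<gamma> x \<Longrightarrow> vge \<gamma> x"
  by (auto simp: vge_def vgt_def)

lemma vge_mono: "vge \<gamma> x \<Longrightarrow> \<delta> \<le> \<gamma> \<Longrightarrow> vge \<delta> x" and vgt_mono: "vgt \<gamma> x \<Longrightarrow> \<delta> \<le> \<gamma> \<Longrightarrow> vgt \<delta> x"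
  and vge_imp_vgt: "vge \<gamma> x \<Longrightarrow> \<delta> < \<gamma> \<Longrightarrow> vgt \<delta> x"
  by (auto simp: vge_def vgt_def)

lemma vge_self [simp]: "vge (v x) x" by (simp add: vge_def)

lemma vge_minus [simp]: "vge \<gamma> (- x) = vge \<gamma> x" and vgt_minus [simp]: "vgt \<gamma> (- x) = vgt \<gamma> x"
  by (auto simp: vge_def vgt_def v_minus)

lemma vge_add: "vge \<gamma> x \<Longrightarrow> vge \<gamma> y \<Longrightarrow> vge \<gamma> (x + y)"
  and vgt_add: "vgt \<gamma> x \<Longrightarrow> vgt \<gamma> y \<Longrightarrow> vgt \<gamma> (x + y)"
proof -
  have "x = 0 \<or> y = 0 \<or> x + y = 0 \<or> min (v x) (v y) \<le> v (x + y)"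
    using val unfolding valuation_def by blast
  then show "vge \<gamma> x \<Longrightarrow> vge \<gamma> y \<Longrightarrow> vge \<gamma> (x + y)" "vgt \<gamma> x \<Longrightarrow> vgt \<gamma> y \<Longrightarrow> vgt \<gamma> (x + y)"
    unfolding vge_def vgt_def by (auto simp: min_def split: if_splits)
qed

lemma vge_diff: "vge \<gamma> x \<Longrightarrow> vge \<gamma> y \<Longrightarrow> vge \<gamma> (x - y)"
  and vgt_diff: "vgt \<gamma> x \<Longrightarrow> vgt \<gamma> y \<Longrightarrow> vgt \<gamma> (x - y)"
  using vge_add[of \<gamma> x "- y"] vgt_add[of \<gamma> x "- y"] by auto

lemma vgt_diff_commute: "vgt \<gamma> (x - y) = vgt \<gamma> (y - x)"
  using vgt_minus[of \<gamma> "x - y"] by auto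

lemma v_diff_commute: "v (x - y) = v (y - x)"
  using v_minus[of "x - y"] by simp

lemma vge_sum: "(\<And>i. i \<in> I \<Longrightarrow> vge \<gamma> (f i)) \<Longrightarrow> vge \<gamma> (sum f I)"
  and vgt_sum: "(\<And>i. i \<in> I \<Longrightarrow> vgt \<gamma> (f i)) \<Longrightarrow> vgt \<gamma> (sum f I)"
  by (induction I rule: infinite_finite_induct) (auto intro: vge_add vgt_add)

lemma vge_mult: "vge \<gamma> x \<Longrightarrow> vge \<delta> y \<Longrightarrow> vge (\<gamma> + \<delta>) (x * y)"
  and vgt_mult: "vge \<gamma> x \<Longrightarrow> vgt \<delta> y \<Longrightarrow> vgt (\<gamma> + \<delta>) (x * y)"
  by (cases "x = 0 \<or> y = 0"; auto simp: vge_def vgt_def v_mult intro: add_mono add_le_less_mono)+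

lemma vge_mult_ring: "vge 0 x \<Longrightarrow> vge \<gamma> y \<Longrightarrow> vge \<gamma> (x * y)"
  and vgt_mult_ring: "vge 0 x \<Longrightarrow> vgt \<gamma> y \<Longrightarrow> vgt \<gamma> (x * y)"
  using vge_mult[of 0 x \<gamma> y] vgt_mult[of 0 x \<gamma> y] by auto

lemma vgt_mult_cancel: "x \<noteq> 0 \<Longrightarrow> vgt (v x + \<gamma>) (x * y) \<longleftrightarrow> vgt \<gamma> y"
  by (cases "y = 0"; auto simp: vgt_def v_mult)

lemma v_add_eq:
  assumes "x \<noteq> 0" "vgt (v x) y"
  shows "x + y \<noteq> 0" "v (x + y) = v x"
proof -
  show nz: "x + y \<noteq> 0"
  proof
    assume "x + y = 0"
    then have "y = - x" by (simp add: eq_neg_iff_add_eq_0 add.commute)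
    then show False using assms by (auto simp: vgt_def v_minus)
  qed
  have "vge (v x) (x + y)" using assms vgt_imp_vge by (intro vge_add) auto
  moreover have False if "vgt (v x) (x + y)"
    using vgt_diff[OF that assms(2)] assms(1) by (simp add: vgt_def)
  ultimately show "v (x + y) = v x" using nz by (force simp: vge_def vgt_def)
qed

lemma v_eq_of_close:
  assumes "x \<noteq> 0" "vgt (v x) (x - y)"
  shows "y \<noteq> 0" "v y = v x"
  using v_add_eq[of x "y - x"] assms vgt_diff_commute by auto

lemma val_ring_iff: "x \<in> val_ring v \<longleftrightarrow> vge 0 x" and val_ideal_iff: "x \<in> val_ideal v \<longleftrightarrow> vgt 0 x"
  by (auto simp: val_ring_def val_ideal_def vge_def vgt_def)

lemma vge_one [simp]: "vge 0 1" by (simp add: vge_def v_one)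

lemma val_ring_subring: "subring_set (val_ring v)"
  unfolding subring_set_def by (auto simp: val_ring_iff intro: vge_add vge_diff vge_mult_ring)

lemma val_ring_local: "local_subring (val_ring v) (val_ideal v)"
  unfolding local_subring_def
  using val_ring_subring vgt_add vgt_mult_ring
  by (auto simp: val_ring_iff val_ideal_iff subset_iff intro: vgt_imp_vge)
    (auto simp: vge_def vgt_def v_one v_inverse)

lemma vge_of_nat: "vge 0 (of_nat n)"
  using subring_of_nat[OF val_ring_subring] val_ring_iff by blast

text \<open>The determinant is avoided: dividing by \<open>X - x n\<close> gives a quotient that is
  again small at the other points, because the differences of the points are units.\<close>

lemma vandermonde:
  assumes "degree P < n" "\<And>i. i < n \<Longrightarrow> vge 0 (x i)"
    and "\<And>i j. i < j \<Longrightarrow> j < n \<Longrightarrow> x i \<noteq> x j \<and> v (x i - x j) = 0"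
    and "\<And>i. i < n \<Longrightarrow> vgt \<gamma> (poly P (x i))"
  shows "vgt \<gamma> (coeff P k)"
  using assms
proof (induction n arbitrary: P k)
  case (Suc n)
  show ?case
  proof (cases "degree P = 0")
    case True
    then obtain c where "P = [:c:]" by (rule degree_eq_zeroE)
    then show ?thesis using Suc.prems(4)[of 0] by (auto simp: coeff_pCons split: nat.splits)
  next
    case False
    define Q where "Q = synthetic_div P (x n)"
    have PQ: "P = pCons (poly P (x n)) Q - smult (x n) Q"
      using synthetic_div_correct[of P "x n"] by (simp add: Q_def algebra_simps)
    have "vgt \<gamma> (coeff Q k)" for k
    proof (rule Suc.IH)
      show "degree Q < n" using False Suc.prems(1) by (simp add: Q_def degree_synthetic_div)
      show "vgt \<gamma> (poly Q (x i))" if "i < n" for i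
      proof -
        have "poly P (x i) - poly P (x n) = (x i - x n) * poly Q (x i)"
          using arg_cong[OF PQ, of "\<lambda>P. poly P (x i)"] by (simp add: algebra_simps)
        then have "vgt \<gamma> ((x i - x n) * poly Q (x i))"
          using vgt_diff[OF Suc.prems(4)[of i] Suc.prems(4)[of n]] that by simp
        then show ?thesis using Suc.prems(3)[of i n] that vgt_mult_cancel[of "x i - x n" \<gamma>] by simp
      qed
    qed (use Suc.prems in auto)
    then show ?thesis using Suc.prems(4)[of n] Suc.prems(2)[of n]
      by (subst PQ) (auto simp: coeff_pCons split: nat.splits intro!: vgt_diff vgt_mult_ring)
  qed
qed simp

end

section \<open>Defect extensions of prime degree are immediate\<close>

locale defect_extension = prime_galois K p + krull_valuation v
  for K :: "'a::field set" and p :: nat and v :: "'a \<Rightarrow> 'b::linordered_ab_group_add" +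
  assumes uniq: "unique_extension K v" and defect: "nontrivial_defect K v"
begin

section \<open>Invariance of the valuation under the Galois group\<close>

lemma Gal_val_ring:
  assumes \<sigma>: "\<sigma> \<in> Gal K"
  shows "\<sigma> ` val_ring v = val_ring v"
proof -
  note s = GalD[OF \<sigma>] Gal_hom[OF \<sigma>]
  note O = subring_setD[OF val_ring_subring]
  have surj: "\<exists>z. x = \<sigma> z" for x using s(1) by (metis bij_pointE)
  have "is_valuation_ring (\<sigma> ` val_ring v)" unfolding is_valuation_ring_def
  proof (intro conjI ballI allI impI)
    show "0 \<in> \<sigma> ` val_ring v" "1 \<in> \<sigma> ` val_ring v"
      using O(1,2) s(5,6) by (metis imageI)+
    show "x + y \<in> \<sigma> ` val_ring v" "x - y \<in> \<sigma> ` val_ring v" "x * y \<in> \<sigma> ` val_ring v"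
      if "x \<in> \<sigma> ` val_ring v" "y \<in> \<sigma> ` val_ring v" for x y
      using that O(3-5) by (auto simp flip: s(2,3,8))
    show "x \<in> \<sigma> ` val_ring v \<or> inverse x \<in> \<sigma> ` val_ring v" if "x \<noteq> 0" for x
    proof -
      obtain z where z: "x = \<sigma> z" using surj by blast
      have "z \<in> val_ring v \<or> inverse z \<in> val_ring v"
        using that z s(5) by (cases "z = 0") (auto simp: val_ring_def v_inverse)
      then show ?thesis using z s(9) by (metis imageI)
    qed
  qed
  moreover have "\<sigma> ` val_ring v \<inter> K = val_ring v \<inter> K"
  proof (intro equalityI subsetI)
    fix x assume "x \<in> \<sigma> ` val_ring v \<inter> K"
    then obtain z where z: "x = \<sigma> z" "z \<in> val_ring v" "x \<in> K" by auto
    then have "\<sigma> z = \<sigma> x" using s(4) by simp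
    then show "x \<in> val_ring v \<inter> K" using z s(12) by simp
  next
    fix x assume "x \<in> val_ring v \<inter> K"
    then show "x \<in> \<sigma> ` val_ring v \<inter> K" using s(4) by (metis IntD1 IntD2 IntI imageI)
  qed
  ultimately show ?thesis using uniq unfolding unique_extension_def by blast
qed

text \<open>Invariance of the valuation ring alone does not give equality of values. If
  \<open>v (\<sigma> x)\<close> were larger than \<open>v x\<close>, the quotient
  \<open>\<sigma> x / x\<close> would have norm 1, although it has positive value and all its
  conjugates are integral.\<close>

lemma v_Gal:
  assumes \<sigma>: "\<sigma> \<in> Gal K"
  shows "v (\<sigma> x) = v x"
proof (cases "x = 0 \<or> \<sigma> = id")
  case True
  then show ?thesis using Gal_hom(1)[OF \<sigma>] by auto
next
  case False
  have pos: "vge 0 ((\<sigma> ^^ i) u)" if "vge 0 u" for i u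
    using that Gal_val_ring[OF \<sigma>] by (induction i) (auto simp flip: val_ring_iff)
  have le: "\<not> v x < v (\<sigma> x)" if x: "x \<noteq> 0" for x
  proof
    assume lt: "v x < v (\<sigma> x)"
    let ?N = "\<lambda>y. \<Prod>i<p. (\<sigma> ^^ i) y"
    have \<sigma>x: "\<sigma> x \<noteq> 0" using Gal_hom(9)[OF \<sigma>] x by simp
    define u where "u = \<sigma> x / x"
    have u: "vgt 0 u" using lt x \<sigma>x by (simp add: u_def vgt_def v_divide)
    have "?N (\<sigma> x) = \<sigma> (?N x)" by (simp add: Gal_prod[OF \<sigma>] funpow_swap1)
    also have "\<dots> = ?N x" using norm_in_K[OF \<sigma>, of x] False GalD(4)[OF \<sigma>] by blast
    finally have "?N u = ?N x / ?N x"
      by (simp add: u_def Gal_hom(6)[OF Gal_funpow[OF \<sigma>]] prod_dividef)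
    moreover have "?N x \<noteq> 0" using x Gal_hom(9)[OF Gal_funpow[OF \<sigma>]] by simp
    ultimately have "?N u = 1" by simp
    moreover obtain n where "p = Suc n" using p_gt_1 by (metis less_natE)
    ultimately have "(\<Prod>i<n. (\<sigma> ^^ Suc i) u) * u = 1" by (simp add: prod.lessThan_Suc_shift mult.commute del: funpow.simps(2) prod.lessThan_Suc)
    moreover have "vge 0 (\<Prod>i<n. (\<sigma> ^^ Suc i) u)"
    proof -
      have "vge 0 (\<Prod>i<k. (\<sigma> ^^ Suc i) u)" for k
        by (induction k) (auto intro!: vge_mult_ring pos vgt_imp_vge[OF u] simp del: funpow.simps(2))
      then show ?thesis .
    qed
    ultimately have "vgt 0 1" using vgt_mult_ring[OF _ u] by metis
    then show False by (simp add: vgt_def v_one)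
  qed
  have "\<not> v (\<sigma> x) < v x"
    using le[of "inverse x"] False Gal_hom(9)[OF \<sigma>] by (simp add: v_inverse Gal_hom(5)[OF \<sigma>])
  then show ?thesis using le[of x] False by auto
qed

lemma vge_Gal: "\<sigma> \<in> Gal K \<Longrightarrow> vge \<gamma> (\<sigma> x) \<longleftrightarrow> vge \<gamma> x"
  and vgt_Gal: "\<sigma> \<in> Gal K \<Longrightarrow> vgt \<gamma> (\<sigma> x) \<longleftrightarrow> vgt \<gamma> x"
  by (simp_all add: vge_def vgt_def v_Gal Gal_hom)

lemma vge_Gal_diff:
  assumes \<sigma>: "\<sigma> \<in> Gal K" "\<sigma> \<noteq> id" and \<tau>: "\<tau> \<in> Gal K"
  shows "vge (v (\<sigma> f - f)) (\<tau> f - f)"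
proof -
  have "vge (v (\<sigma> f - f)) ((\<sigma> ^^ i) f - f)" for i
  proof (induction i)
    case (Suc i)
    \<comment> \<open>Both summands are bounded below by \<open>v (\<sigma> f - f)\<close>. As every
      nontrivial automorphism generates the group, the bound is symmetric and becomes an equality
      for nontrivial ones.\<close>
    have "(\<sigma> ^^ Suc i) f - f = \<sigma> ((\<sigma> ^^ i) f - f) + (\<sigma> f - f)" by (simp add: Gal_hom[OF \<sigma>(1)])
    then show ?case using Suc by (metis vge_add vge_self vge_Gal[OF \<sigma>(1)])
  qed simp
  then show ?thesis using Gal_cyclic[OF \<sigma> \<tau>] by metis
qed

lemma v_Gal_diff:
  assumes \<sigma>: "\<sigma> \<in> Gal K" "\<sigma> \<noteq> id" and \<tau>: "\<tau> \<in> Gal K" "\<tau> \<noteq> id"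
  shows "v (\<tau> f - f) = v (\<sigma> f - f)"
proof (cases "f \<in> K")
  case True
  then show ?thesis using GalD(4) \<sigma> \<tau> by metis
next
  case False
  then have "\<sigma> f - f \<noteq> 0" "\<tau> f - f \<noteq> 0" using Gal_fixed_field \<sigma> \<tau> by auto
  then show ?thesis using vge_Gal_diff[OF \<sigma> \<tau>(1), of f] vge_Gal_diff[OF \<tau> \<sigma>(1), of f]
    by (auto simp: vge_def)
qed

section \<open>Ramification index, residue degree and immediacy\<close>

lemma value_groupI: "x \<in> K \<Longrightarrow> x \<noteq> 0 \<Longrightarrow> v x \<in> value_group v K"
  by (auto simp: value_group_def)

lemma value_groupE: assumes "g \<in> value_group v K" obtains c where "c \<in> K" "c \<noteq> 0" "v c = g"
  using assms by (auto simp: value_group_def)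

lemma value_group_closed:
  "0 \<in> value_group v K"
  "g \<in> value_group v K \<Longrightarrow> h \<in> value_group v K \<Longrightarrow> g + h \<in> value_group v K"
  "g \<in> value_group v K \<Longrightarrow> - g \<in> value_group v K"
  "g \<in> value_group v K \<Longrightarrow> h \<in> value_group v K \<Longrightarrow> g - h \<in> value_group v K"
proof -
  show "0 \<in> value_group v K" using value_groupI[of 1] KD v_one by auto
  show add: "g \<in> value_group v K \<Longrightarrow> h \<in> value_group v K \<Longrightarrow> g + h \<in> value_group v K" for g h
    by (elim value_groupE) (metis KD(5) mult_eq_0_iff v_mult value_groupI)
  show minus: "g \<in> value_group v K \<Longrightarrow> - g \<in> value_group v K" for g
    by (elim value_groupE) (metis KD(6) inverse_nonzero_iff_nonzero v_inverse value_groupI)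
  show "g \<in> value_group v K \<Longrightarrow> h \<in> value_group v K \<Longrightarrow> g - h \<in> value_group v K"
    using add[of g "- h"] minus[of h] by simp
qed

text \<open>The nonzero terms of a relation would have pairwise distinct values, so the one of least
  value could not be cancelled.\<close>

lemma distinct_cosets_independent:
  assumes I: "finite I" and nz: "\<And>i. i \<in> I \<Longrightarrow> x i \<noteq> 0"
    and dist: "\<And>i j. i \<in> I \<Longrightarrow> j \<in> I \<Longrightarrow> i \<noteq> j \<Longrightarrow> v (x i) - v (x j) \<notin> value_group v K"
  shows "\<not> lin_dep K I x"
proof
  assume "lin_dep K I x"
  then obtain c where c: "\<forall>i\<in>I. c i \<in> K" "\<exists>i\<in>I. c i \<noteq> 0" "(\<Sum>i\<in>I. c i * x i) = 0"
    unfolding lin_dep_def by blast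
  define J where "J = {i \<in> I. c i \<noteq> 0}"
  have J: "finite J" "J \<noteq> {}" using I c(2) by (auto simp: J_def)
  obtain k where k: "k \<in> J" and mn: "\<And>j. j \<in> J \<Longrightarrow> v (c k * x k) \<le> v (c j * x j)"
    using ex_is_arg_min_if_finite[OF J, of "\<lambda>j. v (c j * x j)"]
    by (auto simp: is_arg_min_def not_less)
  have cx: "c j * x j \<noteq> 0" "v (c j * x j) = v (c j) + v (x j)" "c j \<in> K" if "j \<in> J" for j
    using that nz c(1) by (auto simp: J_def v_mult)
  have "vgt (v (c k * x k)) (c j * x j)" if j: "j \<in> J - {k}" for j
  proof -
    have "v (c k * x k) \<noteq> v (c j * x j)"
    proof
      assume "v (c k * x k) = v (c j * x j)"
      then have "v (x k) - v (x j) = v (c j) - v (c k)" using cx[of j] cx[of k] j k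
        by (simp add: algebra_simps)
      moreover have "v (c j) - v (c k) \<in> value_group v K"
        using cx[of j] cx[of k] j k by (intro value_group_closed value_groupI) (auto simp: J_def)
      ultimately show False using dist[of k j] j k by (auto simp: J_def)
    qed
    then show ?thesis using mn[of j] j by (auto simp: vgt_def)
  qed
  then have "vgt (v (c k * x k)) (\<Sum>j\<in>J - {k}. c j * x j)" by (rule vgt_sum)
  then have "c k * x k + (\<Sum>j\<in>J - {k}. c j * x j) \<noteq> 0" using v_add_eq(1) cx(1)[OF k] by blast
  moreover have "c k * x k + (\<Sum>j\<in>J - {k}. c j * x j) = (\<Sum>j\<in>J. c j * x j)"
    using J k by (simp add: sum.remove)
  moreover have "(\<Sum>j\<in>J. c j * x j) = (\<Sum>j\<in>I. c j * x j)"
    using I by (intro sum.mono_neutral_left) (auto simp: J_def)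
  ultimately show False using c(3) by simp
qed

text \<open>Dividing a linear relation by a coefficient of least value makes it a relation between
  residues. The bound is what gives \<open>GREATEST\<close> in the residue degree its
  meaning.\<close>

lemma res_indep_le:
  assumes "res_indep K v n" shows "n \<le> p"
proof (rule ccontr)
  assume "\<not> n \<le> p"
  obtain u where u: "\<And>c. (\<forall>i<n. c i \<in> K \<inter> val_ring v) \<Longrightarrow> (\<Sum>i<n. c i * u i) \<in> val_ideal v
            \<Longrightarrow> (\<forall>i<n. c i \<in> val_ideal v)"
    using assms unfolding res_indep_def by blast
  have "lin_dep K {..<n} u" using has_degree_lin_dep[OF K deg, of "{..<n}"] \<open>\<not> n \<le> p\<close> by simp
  then obtain c where c: "\<forall>i<n. c i \<in> K" "\<exists>i<n. c i \<noteq> 0" "(\<Sum>i<n. c i * u i) = 0"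
    unfolding lin_dep_def by auto
  define J where "J = {i. i < n \<and> c i \<noteq> 0}"
  have J: "finite J" "J \<noteq> {}" using c(2) by (auto simp: J_def)
  obtain k where k: "k \<in> J" and mn: "\<And>j. j \<in> J \<Longrightarrow> v (c k) \<le> v (c j)"
    using ex_is_arg_min_if_finite[OF J, of "\<lambda>j. v (c j)"]
    by (auto simp: is_arg_min_def not_less)
  have k': "k < n" "c k \<noteq> 0" "c k \<in> K" using k c(1) by (auto simp: J_def)
  have "(\<Sum>i<n. c i / c k * u i) = (\<Sum>i<n. c i * u i) / c k"
    by (simp add: sum_divide_distrib)
  then have "(\<Sum>i<n. c i / c k * u i) \<in> val_ideal v" using c(3) by (simp add: val_ideal_def)
  moreover have "c i / c k \<in> K \<inter> val_ring v" if "i < n" for i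
    using that mn[of i] k' c(1) KD by (cases "c i = 0") (auto simp: J_def val_ring_def v_divide)
  ultimately have "c k / c k \<in> val_ideal v" using u[of "\<lambda>i. c i / c k"] k' by blast
  then show False using k' by (simp add: val_ideal_def v_one)
qed

lemma res_degree_ge: "res_indep K v n \<Longrightarrow> n \<le> res_degree K v"
  unfolding res_degree_def using res_indep_le by (intro Greatest_le_nat) auto

lemma res_degree_pos: "1 \<le> res_degree K v"
proof (rule res_degree_ge)
  show "res_indep K v 1" unfolding res_indep_def
    by (intro exI[of _ "\<lambda>_. 1"]) (auto simp: val_ring_iff)
qed

lemma ef_less: "ram_index K v * res_degree K v < p"
  using defect has_degree_unique[OF K deg] unfolding nontrivial_defect_def by auto

lemma v_power_p_in_K:
  assumes "x \<noteq> 0" shows "v (x ^ p) \<in> value_group v K"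
proof -
  obtain \<sigma> where \<sigma>: "\<sigma> \<in> Gal K" "\<sigma> \<noteq> id" by (rule Gal_nontrivial)
  have nz: "(\<sigma> ^^ i) x \<noteq> 0" for i using assms Gal_hom(9)[OF Gal_funpow[OF \<sigma>(1)]] by simp
  have "v (\<Prod>i<p. (\<sigma> ^^ i) x) = (\<Sum>i<p. v x)"
    using nz v_prod[of "{..<p}" "\<lambda>i. (\<sigma> ^^ i) x"] v_Gal[OF Gal_funpow[OF \<sigma>(1)]] by simp
  also have "\<dots> = v (\<Prod>i<p. x)" using assms v_prod[of "{..<p}" "\<lambda>i. x"] by simp
  finally have "v (x ^ p) = v (\<Prod>i<p. (\<sigma> ^^ i) x)" by simp
  then show ?thesis using norm_in_K[OF \<sigma>, of x] nz by (auto intro!: value_groupI)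
qed

lemma value_group_eq:
  assumes x: "x \<noteq> 0" shows "v x \<in> value_group v K"
proof (rule ccontr)
  assume notin: "v x \<notin> value_group v K"
  define cs where "cs g = {g + h | h. h \<in> value_group v K}" for g
  have cs_eq: "g - g' \<in> value_group v K" if "cs g = cs g'" for g g'
  proof -
    have "g + 0 \<in> cs g" unfolding cs_def using value_group_closed(1) by blast
    then have "g \<in> cs g'" using that by simp
    then show ?thesis by (auto simp: cs_def)
  qed
  let ?C = "{cs (v x) | x. x \<noteq> 0}"
  have C: "ram_index K v = card ?C" unfolding ram_index_def cs_def ..
  \<comment> \<open>An infinite set has \<open>card\<close> 0, so finiteness must come before any
    lower bound for the ramification index; more than \<open>p\<close> cosets would give too many
    independent elements.\<close>
  have fin: "finite ?C"
  proof (rule ccontr)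
    assume "infinite ?C"
    from infinite_arbitrarily_large[OF this, of "Suc p"]
    obtain B where B: "finite B" "card B = Suc p" "B \<subseteq> ?C" by (elim exE conjE)
    define r where "r b = (SOME x. x \<noteq> 0 \<and> b = cs (v x))" for b
    have r: "r b \<noteq> 0" "b = cs (v (r b))" if "b \<in> B" for b
    proof -
      have "\<exists>x. x \<noteq> 0 \<and> b = cs (v x)" using B that by blast
      then have "r b \<noteq> 0 \<and> b = cs (v (r b))" unfolding r_def by (rule someI_ex)
      then show "r b \<noteq> 0" "b = cs (v (r b))" by auto
    qed
    have "lin_dep K B r" using has_degree_lin_dep[OF K deg B(1)] B(2) by simp
    moreover have "v (r b) - v (r b') \<notin> value_group v K" if "b \<in> B" "b' \<in> B" "b \<noteq> b'" for b b'
    proof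
      assume d: "v (r b) - v (r b') \<in> value_group v K"
      have "cs (v (r b)) = cs (v (r b'))"
      proof (intro equalityI subsetI)
        fix z assume "z \<in> cs (v (r b))"
        then obtain h where "z = v (r b) + h" "h \<in> value_group v K" by (auto simp: cs_def)
        then have "z = v (r b') + (v (r b) - v (r b') + h)" "v (r b) - v (r b') + h \<in> value_group v K"
          using d value_group_closed by auto
        then show "z \<in> cs (v (r b'))" unfolding cs_def by blast
      next
        fix z assume "z \<in> cs (v (r b'))"
        then obtain h where "z = v (r b') + h" "h \<in> value_group v K" by (auto simp: cs_def)
        then have "z = v (r b) + (h - (v (r b) - v (r b')))" "h - (v (r b) - v (r b')) \<in> value_group v K"
          using d value_group_closed by auto
        then show "z \<in> cs (v (r b))" unfolding cs_def by blast
      qed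
      then show False using r that by metis
    qed
    ultimately show False using distinct_cosets_independent[OF B(1), of r] r by blast
  qed
  have vpow: "v (y ^ n) \<in> value_group v K" if "y \<noteq> 0" "v y \<in> value_group v K" for y n
    using that by (induction n) (auto simp: v_one v_mult value_group_closed)
  have "inj_on (\<lambda>i. cs (v (x ^ i))) {..<p}"
  proof (rule linorder_inj_onI)
    fix i j assume ij: "i < j" "i \<in> {..<p}" "j \<in> {..<p}"
    show "cs (v (x ^ i)) \<noteq> cs (v (x ^ j))"
    proof
      assume "cs (v (x ^ i)) = cs (v (x ^ j))"
      then have "v (x ^ j) - v (x ^ i) \<in> value_group v K" using cs_eq by metis
      moreover define k where "k = j - i"
      have "x ^ j = x ^ k * x ^ i" using ij by (simp add: k_def flip: power_add)
      then have "v (x ^ j) - v (x ^ i) = v (x ^ k)" using x v_mult by simp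
      ultimately have k: "v (x ^ k) \<in> value_group v K" by simp
      have "0 < k" "k < p" using ij by (auto simp: k_def)
      then have "coprime k p" using p by (metis coprime_commute nat_dvd_not_less prime_imp_coprime)
      \<comment> \<open>\<open>v (x ^ k)\<close> and \<open>v (x ^ p)\<close> both lie in
        \<open>vK\<close>, and a Bezout combination of them is \<open>v x\<close>.\<close>
      then obtain a b where ab: "k * a = p * b + 1" using bezout_nat[of k p] \<open>0 < k\<close> by auto
      have "(x ^ k) ^ a = x * (x ^ p) ^ b" using ab by (simp flip: power_mult)
      then have "v x = v ((x ^ k) ^ a) - v ((x ^ p) ^ b)" using x by (simp add: v_mult)
      then have "v x \<in> value_group v K"
        using vpow[OF _ k, of a] vpow[OF _ v_power_p_in_K[OF x], of b] x value_group_closed(4) by simp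
      then show False using notin by simp
    qed
  qed auto
  then have p_eq: "card ((\<lambda>i. cs (v (x ^ i))) ` {..<p}) = p" by (simp add: card_image)
  have "(\<lambda>i. cs (v (x ^ i))) ` {..<p} \<subseteq> ?C" using x by (auto intro!: exI[of _ "x ^ _"])
  from card_mono[OF fin this] have "p \<le> ram_index K v" unfolding C p_eq .
  then show False using ef_less res_degree_pos by (metis leD le_trans mult.right_neutral mult_le_mono)
qed

lemma immediate_unit:
  assumes y: "y \<noteq> 0" "v y = 0"
  obtains c where "c \<in> K" "vgt 0 (y - c)"
proof -
  have "\<exists>c\<in>K. vgt 0 (y - c)"
  proof (rule ccontr)
    assume "\<not> ?thesis"
    then have no: "\<not> vgt 0 (y - c)" if "c \<in> K" for c using that by blast
    obtain \<sigma> where \<sigma>: "\<sigma> \<in> Gal K" "\<sigma> \<noteq> id" by (rule Gal_nontrivial)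
    have yO: "vge 0 y" using y by (simp add: vge_def)
    have sO: "vge 0 ((\<sigma> ^^ i) y)" for i using yO vge_Gal[OF Gal_funpow[OF \<sigma>(1)]] by simp
    \<comment> \<open>The residues of the first \<open>p\<close> powers of \<open>y\<close> are
      independent, so the residue degree is at least \<open>p\<close>, which the defect forbids. The
      cases differ in whether the conjugates of \<open>y\<close> share one residue.\<close>
    have indep: "vgt 0 (coeff P i)"
      if P: "P \<in> polys_over (K \<inter> val_ring v)" "degree P < p" "vgt 0 (poly P y)" for P i
    proof (cases "vgt 0 (\<sigma> y - y)")
      case True
      let ?h = "\<Prod>i<p. [:- (\<sigma> ^^ i) y, 1:]"
      have "P \<in> polys_over (val_ideal v)"
      proof (rule inseparable_independence[OF val_ring_local K p])
        show "y \<in> val_ring v" using yO by (simp add: val_ring_iff)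
        show "y - c \<notin> val_ideal v" if "c \<in> K" for c using no[OF that] by (simp add: val_ideal_iff)
        show "?h \<in> polys_over (K \<inter> val_ring v)"
          using orbit_poly_over[OF \<sigma> Gal_order[OF \<sigma>(1)]]
            prod_linear_over[OF val_ring_local, of p "\<lambda>i. (\<sigma> ^^ i) y"] sO
          by (simp add: polys_over_def val_ring_iff)
        show "lead_coeff ?h = 1" "degree ?h = p" by (rule degree_prod_linear)+
        show "?h - [:- y, 1:] ^ p \<in> polys_over (val_ideal v)"
        proof (rule prod_linear_cong[OF val_ring_local])
          show "(\<sigma> ^^ i) y - y \<in> val_ideal v" for i
            using vge_Gal_diff[OF \<sigma> Gal_funpow[OF \<sigma>(1)], of y i] True
            by (auto simp: val_ideal_iff vgt_def vge_def)
              (metis Gal_order_aux Gal_fixed_field Gal_funpow GalD(4) \<sigma>)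
        qed (simp add: val_ring_iff yO)
      qed (use P in \<open>auto simp: val_ideal_iff\<close>)
      then show ?thesis by (simp add: polys_over_def val_ideal_iff)
    next
      case False
      \<comment> \<open>One unit difference makes all differences of conjugates units, so
        \<open>P\<close>, which is small at all \<open>p\<close> conjugates, has small
        coefficients.\<close>
      then have ys: "\<sigma> y - y \<noteq> 0" "v (\<sigma> y - y) = 0"
        using vge_diff[OF sO[of 1] yO] by (auto simp: vgt_def vge_def)
      show ?thesis
      proof (rule vandermonde[where x = "\<lambda>i. (\<sigma> ^^ i) y" and n = p])
        show "vgt 0 (poly P ((\<sigma> ^^ i) y))" for i
        proof -
          have "P \<in> polys_over K" using P(1) by (auto simp: polys_over_def)
          from Gal_poly[OF Gal_funpow[OF \<sigma>(1)] this, symmetric] show ?thesis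
            using P(3) vgt_Gal[OF Gal_funpow[OF \<sigma>(1)]] by metis
        qed
        show "(\<sigma> ^^ i) y \<noteq> (\<sigma> ^^ j) y \<and> v ((\<sigma> ^^ i) y - (\<sigma> ^^ j) y) = 0" if ij: "i < j" "j < p" for i j
        proof -
          define k where "k = j - i"
          have k: "0 < k" "k < p" "j = i + k" using ij by (auto simp: k_def)
          have ne: "\<sigma> ^^ k \<noteq> id"
          proof
            assume id: "\<sigma> ^^ k = id"
            have "coprime k p" using k p by (metis coprime_commute nat_dvd_not_less prime_imp_coprime)
            then obtain a b where ab: "k * a = p * b + 1" using bezout_nat[of k p] k(1) by auto
            have "\<sigma> ^^ p = id" using Gal_order[OF \<sigma>(1)] by (auto simp: fun_eq_iff)
            then have "\<sigma> ^^ (p * b + 1) = \<sigma>" by (simp add: funpow_add funpow_mult[symmetric] id_funpow)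
            moreover have "\<sigma> ^^ (k * a) = id" using id by (simp add: funpow_mult[symmetric] id_funpow)
            ultimately show False using \<sigma>(2) ab by simp
          qed
          have "v ((\<sigma> ^^ k) y - y) = 0" "(\<sigma> ^^ k) y - y \<noteq> 0"
            using v_Gal_diff[OF \<sigma> Gal_funpow[OF \<sigma>(1)] ne, of y] ys
              Gal_fixed_field[OF \<sigma>, of y] Gal_fixed_field[OF Gal_funpow[OF \<sigma>(1)] ne, of y] by auto
          moreover have "(\<sigma> ^^ j) y - (\<sigma> ^^ i) y = (\<sigma> ^^ i) ((\<sigma> ^^ k) y - y)"
            using k(3) by (simp add: funpow_add Gal_hom[OF Gal_funpow[OF \<sigma>(1)]])
          ultimately have "(\<sigma> ^^ j) y - (\<sigma> ^^ i) y \<noteq> 0" "v ((\<sigma> ^^ j) y - (\<sigma> ^^ i) y) = 0"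
            using v_Gal[OF Gal_funpow[OF \<sigma>(1)]] Gal_hom(9)[OF Gal_funpow[OF \<sigma>(1)]] by simp_all
          then show ?thesis using v_diff_commute by force
        qed
      qed (use P sO in auto)
    qed
    have "res_indep K v p" unfolding res_indep_def
    proof (intro exI[of _ "\<lambda>i. y ^ i"] conjI allI impI)
      show "y ^ i \<in> val_ring v" for i
        using subring_power[OF val_ring_subring] yO val_ring_iff by blast
      fix c i assume c: "(\<forall>i<p. c i \<in> K \<inter> val_ring v) \<and> (\<Sum>i<p. c i * y ^ i) \<in> val_ideal v" and i: "i < p"
      let ?P = "\<Sum>i<p. monom (c i) i"
      have "?P \<in> polys_over (K \<inter> val_ring v)"
        using c KD(1) subring_setD(1)[OF val_ring_subring] by (auto simp: polys_over_def coeff_sum_monom)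
      moreover have "degree ?P < p" using p_gt_1 by (intro degree_sum_monom) auto
      moreover have "vgt 0 (poly ?P y)" using c by (simp add: poly_sum_monom val_ideal_iff)
      ultimately have "vgt 0 (coeff ?P i)" by (rule indep)
      then show "c i \<in> val_ideal v" using i by (simp add: coeff_sum_monom val_ideal_iff)
    qed
    then have "p \<le> res_degree K v" by (rule res_degree_ge)
    \<comment> \<open>The index is a cardinality and could in principle be 0; since
      \<open>vL = vK\<close>, there is exactly one coset.\<close>
    moreover have "ram_index K v = 1"
    proof -
      have "{v x + h | h. h \<in> value_group v K} = value_group v K" if "x \<noteq> 0" for x
      proof (intro equalityI subsetI)
        fix z assume "z \<in> value_group v K"
        then have "z = v x + (z - v x)" "z - v x \<in> value_group v K"
          using value_group_closed(4) value_group_eq[OF that] by auto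
        then show "z \<in> {v x + h | h. h \<in> value_group v K}" by blast
      qed (use value_group_closed(2) value_group_eq[OF that] in auto)
      then have "(\<lambda>x. {v x + h | h. h \<in> value_group v K}) ` {x. x \<noteq> 0}
          = (\<lambda>x. value_group v K) ` {x::'a. x \<noteq> 0}" by (intro image_cong) simp_all
      also have "\<dots> = {value_group v K}" by (rule image_constant[of 1]) simp
      finally have "{{v x + h | h. h \<in> value_group v K} | x. x \<noteq> 0} = {value_group v K}"
        using image_Collect[of "\<lambda>x. {v x + h | h. h \<in> value_group v K}" "\<lambda>x. x \<noteq> 0"]
        by (simp only:)
      from arg_cong[OF this, of card] show ?thesis unfolding ram_index_def by simp
    qed
    ultimately show False using ef_less by simp
  qed
  then show ?thesis using that by blast
qed

lemma immediate:
  assumes x: "x \<noteq> 0"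
  obtains c where "c \<in> K" "vgt (v x) (x - c)"
proof -
  obtain d where d: "d \<in> K" "d \<noteq> 0" "v d = v x" using value_group_eq[OF x] by (rule value_groupE)
  obtain c where c: "c \<in> K" "vgt 0 (x / d - c)"
    using immediate_unit[of "x / d"] x d by (auto simp: v_divide)
  have "x - c * d = d * (x / d - c)" using d(2) by (simp add: field_simps)
  then have "vgt (v x) (x - c * d)" using vgt_mult_cancel[OF d(2), of 0 "x / d - c"] c(2) d(3) by simp
  then show ?thesis using that c d KD(5) by blast
qed

text \<open>Immediacy applied to the error \<open>f - c\<close> improves any approximation of
  \<open>f\<close> from \<open>K\<close>.\<close>

lemma closer_approximation:
  assumes "f \<notin> K" "c \<in> K"
  obtains c' where "c' \<in> K" "v (f - c) < v (f - c')"
proof -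
  have "f - c \<noteq> 0" using assms by auto
  then obtain d where "d \<in> K" "vgt (v (f - c)) (f - c - d)" by (rule immediate)
  moreover have "f - (c + d) \<noteq> 0" using assms \<open>d \<in> K\<close> KD(3) by auto
  ultimately show ?thesis using that[of "c + d"] assms KD(3) by (auto simp: vgt_def algebra_simps)
qed

text \<open>\<open>\<sigma> f - f\<close> is unchanged when an element of \<open>K\<close> is
  subtracted from \<open>f\<close>, so it can be computed from an error of value above
  \<open>v (f - c)\<close>. Thus conjugates are closer to \<open>f\<close> than any element of
  \<open>K\<close> is.\<close>

lemma vgt_Gal_diff:
  assumes \<sigma>: "\<sigma> \<in> Gal K" and c: "c \<in> K" and "f \<noteq> c"
  shows "vgt (v (f - c)) (\<sigma> f - f)"
proof -
  obtain d where d: "d \<in> K" "vgt (v (f - c)) (f - c - d)" using immediate[of "f - c"] assms by auto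
  have "\<sigma> f - f = \<sigma> (f - c - d) - (f - c - d)"
    using c d GalD(4)[OF \<sigma>] by (simp add: Gal_hom[OF \<sigma>])
  then show ?thesis using d vgt_diff vgt_Gal[OF \<sigma>] by metis
qed

text \<open>If \<open>p\<close> were a unit, an element outside \<open>K\<close> could be normalised to have trace \<open>0\<close>; but
  \<open>x = c (1 + m)\<close> with \<open>c\<close> in \<open>K\<close> has trace \<open>c (p + Tr m)\<close>.\<close>

lemma residue_char: "vgt 0 (of_nat p)"
proof (rule ccontr)
  assume "\<not> ?thesis"
  then have p0: "of_nat p \<noteq> (0::'a)" "v (of_nat p) = 0" using vge_of_nat[of p] by (auto simp: vge_def vgt_def)
  obtain \<sigma> where \<sigma>: "\<sigma> \<in> Gal K" "\<sigma> \<noteq> id" by (rule Gal_nontrivial)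
  obtain a where a: "a \<notin> K" using K_ne_UNIV by blast
  let ?Tr = "\<lambda>y. \<Sum>i<p. (\<sigma> ^^ i) y"
  note s = Gal_hom[OF Gal_funpow[OF \<sigma>(1)]]
  have TrK: "?Tr c = of_nat p * c" if "c \<in> K" for c
    using that GalD(4)[OF Gal_funpow[OF \<sigma>(1)]] by simp
  have Trd: "?Tr (x - y) = ?Tr x - ?Tr y" for x y by (simp add: s sum_subtractf)
  define t where "t = ?Tr a / of_nat p"
  have t: "t \<in> K" unfolding t_def by (rule KD(7)[OF trace_in_K[OF \<sigma>] subring_of_nat[OF K_ring]])
  define x where "x = a - t"
  have x: "x \<noteq> 0" using a t by (auto simp: x_def)
  have Trx: "?Tr x = 0" unfolding x_def Trd TrK[OF t] using p0 by (simp add: t_def)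
  obtain c where c: "c \<in> K" "vgt (v x) (x - c)" using immediate[OF x] .
  have "vgt (v x) (?Tr (x - c))"
    using c by (intro vgt_sum) (simp add: vgt_Gal[OF Gal_funpow[OF \<sigma>(1)]])
  then have "vgt (v x) (of_nat p * c)" unfolding Trd Trx TrK[OF c(1)] by simp
  moreover have "c \<noteq> 0" "v c = v x" using v_eq_of_close[OF x c(2)] by auto
  ultimately show False using p0 by (simp add: vgt_def v_mult)
qed

lemma v_of_nat_less: "0 < j \<Longrightarrow> j < p \<Longrightarrow> of_nat j \<noteq> (0::'a) \<and> v (of_nat j) = 0"
  using of_nat_notin_ideal[OF val_ring_local p, of j] residue_char vge_of_nat[of j]
  by (auto simp: val_ideal_iff vgt_def vge_def)

section \<open>The ramification ideal\<close>

text \<open>These are the values \<open>D (a - c)\<close>, because \<open>\<sigma>\<close> moves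
  \<open>a - c\<close> by the same amount as \<open>a\<close>.\<close>

definition approx_values :: "('a \<Rightarrow> 'a) \<Rightarrow> 'a \<Rightarrow> 'b set" where
  "approx_values \<sigma> a = {v (\<sigma> a - a) - v (a - c) | c. c \<in> K}"

context
  fixes \<sigma> :: "'a \<Rightarrow> 'a"
  assumes \<sigma>: "\<sigma> \<in> Gal K" "\<sigma> \<noteq> id"
begin

abbreviation "S \<equiv> Sigma_sigma v \<sigma>"

lemma \<sigma>_diff: "f \<notin> K \<Longrightarrow> \<sigma> f - f \<noteq> 0" using Gal_fixed_field[OF \<sigma>] by auto

lemma Sigma_sigma_iff: "\<gamma> \<in> S \<longleftrightarrow> (\<exists>f. f \<notin> K \<and> \<gamma> = v (\<sigma> f - f) - v f)"
proof -
  have "v ((\<sigma> f - f) / f) = v (\<sigma> f - f) - v f" if "f \<noteq> 0" "\<sigma> f \<noteq> f" for f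
    using that by (simp add: v_divide)
  moreover have "f \<noteq> 0 \<and> \<sigma> f \<noteq> f \<longleftrightarrow> f \<notin> K" for f
    using Gal_fixed_field[OF \<sigma>] KD(1) by auto
  ultimately show ?thesis unfolding Sigma_sigma_def by (auto; metis)
qed

lemma approx_values_subset: assumes "a \<notin> K" shows "approx_values \<sigma> a \<subseteq> S"
proof
  fix \<gamma> assume "\<gamma> \<in> approx_values \<sigma> a"
  then obtain c where c: "c \<in> K" "\<gamma> = v (\<sigma> a - a) - v (a - c)" by (auto simp: approx_values_def)
  have "a - c \<notin> K" using assms c KD(3)[of "a - c" c] by auto
  moreover have "\<sigma> (a - c) - (a - c) = \<sigma> a - a" using c GalD(4)[OF \<sigma>(1)] by (simp add: Gal_hom[OF \<sigma>(1)])
  ultimately show "\<gamma> \<in> S" using c unfolding Sigma_sigma_iff by metis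
qed

lemma approx_values_up:
  assumes a: "a \<notin> K" and \<gamma>: "\<gamma> \<in> approx_values \<sigma> a" and \<delta>: "\<delta> \<in> value_group v K" "\<gamma> \<le> \<delta>"
  shows "\<delta> \<in> approx_values \<sigma> a"
proof (cases "\<gamma> = \<delta>")
  case False
  obtain c where c: "c \<in> K" "\<gamma> = v (\<sigma> a - a) - v (a - c)" using \<gamma> by (auto simp: approx_values_def)
  have "v (\<sigma> a - a) - \<delta> \<in> value_group v K"
    using value_group_eq[OF \<sigma>_diff[OF a]] \<delta>(1) value_group_closed(4) by blast
  \<comment> \<open>To reach the larger value \<open>\<delta>\<close> the approximation
    \<open>c\<close> is spoiled on purpose by an element \<open>b\<close> that dominates
    \<open>a - c\<close>.\<close>
  then obtain b where b: "b \<in> K" "b \<noteq> 0" "v b = v (\<sigma> a - a) - \<delta>" by (rule value_groupE)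
  have "\<gamma> < \<delta>" using False \<delta>(2) by simp
  then have "v b < v (a - c)" unfolding b(3) c(2) by (simp add: diff_less_eq add.commute)
  then have "v (b + (a - c)) = v b" using b(2) by (intro v_add_eq) (auto simp: vgt_def)
  then have "\<delta> = v (\<sigma> a - a) - v (a - (c - b))" using b(3) by (simp add: algebra_simps)
  then show ?thesis unfolding approx_values_def using KD(4) b c by blast
qed (use \<gamma> in simp)

lemma Sigma_sigma_up:
  assumes "\<gamma> \<in> S" "\<delta> \<in> value_group v K" "\<gamma> \<le> \<delta>" shows "\<delta> \<in> S"
proof -
  obtain f where f: "f \<notin> K" "\<gamma> = v (\<sigma> f - f) - v f" using assms(1) Sigma_sigma_iff by blast
  then have "\<gamma> \<in> approx_values \<sigma> f" unfolding approx_values_def using KD(1) by (force intro!: exI[of _ 0])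
  then show ?thesis using approx_values_up[OF f(1)] approx_values_subset[OF f(1)] assms by blast
qed

lemma Sigma_sigma_pos: assumes "\<gamma> \<in> S" shows "0 < \<gamma>" "\<gamma> \<in> value_group v K"
proof -
  obtain f where f: "f \<notin> K" "\<gamma> = v (\<sigma> f - f) - v f" using assms Sigma_sigma_iff by blast
  then have f0: "f \<noteq> 0" using KD(1) by auto
  show "0 < \<gamma>" using vgt_Gal_diff[OF \<sigma>(1) KD(1) f0] \<sigma>_diff[OF f(1)] f by (simp add: vgt_def)
  show "\<gamma> \<in> value_group v K" unfolding f(2)
    using value_group_eq f0 \<sigma>_diff[OF f(1)] by (intro value_group_closed) auto
qed

text \<open>Passing from \<open>f\<close> to \<open>f - c\<close> of larger value keeps
  \<open>\<sigma> f - f\<close> and so lowers \<open>D\<close>.\<close>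

lemma Sigma_sigma_no_min: assumes "\<gamma> \<in> S" obtains \<gamma>' where "\<gamma>' \<in> S" "\<gamma>' < \<gamma>"
proof -
  obtain f where f: "f \<notin> K" "\<gamma> = v (\<sigma> f - f) - v f" using assms Sigma_sigma_iff by blast
  obtain c where c: "c \<in> K" "v (f - 0) < v (f - c)" using closer_approximation[OF f(1) KD(1)] .
  have "v (\<sigma> f - f) - v (f - c) \<in> S"
    using approx_values_subset[OF f(1)] c unfolding approx_values_def by blast
  then show ?thesis using that c f by simp
qed

lemma Sigma_sigma_nonempty: "S \<noteq> {}"
  using K_ne_UNIV Sigma_sigma_iff by blast

lemma value_group_UNIV: "value_group v UNIV = value_group v K"
  using value_group_eq by (auto simp: value_group_def)

lemma quotient_in_Sigma:
  assumes \<tau>: "\<tau> \<in> Gal K" and f: "f \<noteq> 0" "\<tau> f \<noteq> f"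
  shows "v ((\<tau> f - f) / f) \<in> S"
proof -
  have "\<tau> \<noteq> id" using f by auto
  moreover have "f \<notin> K" using f GalD(4)[OF \<tau>] by blast
  ultimately show ?thesis unfolding Sigma_sigma_iff using v_Gal_diff[OF \<sigma> \<tau>, of f] f
    by (intro exI[of _ f]) (simp add: v_divide)
qed

lemma Sigma_sigma_quotientE:
  assumes "\<gamma> \<in> S" obtains f where "f \<noteq> 0" "\<sigma> f \<noteq> f" "v ((\<sigma> f - f) / f) = \<gamma>"
  using assms unfolding Sigma_sigma_def by blast

lemma final_seg_Sigma: "final_seg_vL v S" "final_seg_vK_pos K v S"
proof -
  show "final_seg_vK_pos K v S" unfolding final_seg_vK_pos_def
    using Sigma_sigma_pos Sigma_sigma_up by blast
  then show "final_seg_vL v S" unfolding final_seg_vL_def final_seg_vK_pos_def value_group_UNIV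
    using less_imp_le by blast
qed

lemma G_Sigma_iff: "\<tau> \<in> G_Sigma K v U \<longleftrightarrow> \<tau> \<in> Gal K \<and> (\<tau> = id \<or> S \<subseteq> U)"
proof (cases "\<tau> \<in> Gal K \<and> \<tau> \<noteq> id")
  case True
  then have \<tau>: "\<tau> \<in> Gal K" "\<tau> \<noteq> id" by auto
  have fx: "\<tau> f = f \<longleftrightarrow> \<sigma> f = f" for f using Gal_fixed_field \<sigma> \<tau> by simp
  have "v ((\<tau> f - f) / f) = v ((\<sigma> f - f) / f)" if "f \<noteq> 0" "\<sigma> f \<noteq> f" for f
    using that fx v_Gal_diff[OF \<sigma> \<tau>] by (simp add: v_divide)
  then have "\<tau> \<in> G_Sigma K v U \<longleftrightarrow> (\<forall>f. f \<noteq> 0 \<longrightarrow> \<sigma> f \<noteq> f \<longrightarrow> v ((\<sigma> f - f) / f) \<in> U)"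
    using \<tau> fx unfolding G_Sigma_def G_I_def I_of_Sigma_def by auto
  then show ?thesis using \<tau> unfolding Sigma_sigma_def by auto
next
  case False
  then show ?thesis unfolding G_Sigma_def G_I_def I_of_Sigma_def using id_in_Gal by auto
qed

lemma Sigma_minus_Gal: "Sigma_minus K v (Gal K) = S"
proof -
  have "Gal K \<subseteq> G_Sigma K v U \<longleftrightarrow> S \<subseteq> U" for U using G_Sigma_iff \<sigma> by blast
  then show ?thesis unfolding Sigma_minus_def using final_seg_Sigma(1) by auto
qed

lemma Sigma_plus_trivial: "Sigma_plus K v {id} = S"
proof -
  have *: "G_Sigma K v U \<subseteq> {id} \<longleftrightarrow> \<not> S \<subseteq> U" for U using G_Sigma_iff \<sigma> by blast
  show ?thesis unfolding Sigma_plus_def *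
  proof (intro equalityI subsetI)
    fix \<gamma> assume "\<gamma> \<in> \<Union> {U. final_seg_vL v U \<and> \<not> S \<subseteq> U}"
    then obtain U \<delta> where U: "final_seg_vL v U" "\<gamma> \<in> U" "\<delta> \<in> S" "\<delta> \<notin> U" by blast
    have g: "\<gamma> \<in> value_group v K" using U(1,2) unfolding final_seg_vL_def value_group_UNIV by auto
    have "\<not> \<gamma> \<le> \<delta>"
      using U Sigma_sigma_pos(2)[OF U(3)] unfolding final_seg_vL_def value_group_UNIV by blast
    then show "\<gamma> \<in> S" using Sigma_sigma_up[OF U(3) g] by simp
  next
    fix \<gamma> assume g: "\<gamma> \<in> S"
    \<comment> \<open>The segment of all values from \<open>\<gamma>\<close> on contains
      \<open>\<gamma>\<close> but misses \<open>\<gamma>'\<close>, so its ramification group is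
      trivial.\<close>
    obtain \<gamma>' where "\<gamma>' \<in> S" "\<gamma>' < \<gamma>" using Sigma_sigma_no_min[OF g] .
    moreover have "final_seg_vL v {\<delta> \<in> value_group v UNIV. \<gamma> \<le> \<delta>}"
      using Sigma_sigma_pos[OF g] unfolding final_seg_vL_def by auto
    moreover have "\<gamma> \<in> {\<delta> \<in> value_group v UNIV. \<gamma> \<le> \<delta>}" using Sigma_sigma_pos[OF g] value_group_UNIV by simp
    ultimately show "\<gamma> \<in> \<Union> {U. final_seg_vL v U \<and> \<not> S \<subseteq> U}" by fastforce
  qed
qed

section \<open>The ramification ideal and ideals of the valuation ring\<close>

abbreviation "J \<equiv> I_of_Sigma v S"

lemma J_iff: "x \<in> J \<longleftrightarrow> x = 0 \<or> v x \<in> S"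
  by (auto simp: I_of_Sigma_def)

lemma OL_ideal_up:
  assumes I: "OL_ideal v I" and x: "x \<in> I" "x \<noteq> 0" and y: "vge (v x) y" shows "y \<in> I"
proof -
  have "y / x \<in> val_ring v" using x y by (cases "y = 0") (auto simp: val_ring_iff vge_def v_divide)
  then have "y / x * x \<in> I" using I x unfolding OL_ideal_def by blast
  then show ?thesis using x by simp
qed

lemma OL_ideal_J: "OL_ideal v J"
proof -
  have J': "y \<in> J" if "x \<in> J" "x \<noteq> 0" "vge (v x) y" for x y
    using that Sigma_sigma_up[of "v x" "v y"] value_group_eq unfolding J_iff vge_def by blast
  show ?thesis unfolding OL_ideal_def
  proof (intro conjI ballI)
    show "J \<subseteq> val_ring v" using Sigma_sigma_pos(1) by (auto simp: J_iff val_ring_def less_imp_le)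
    show "0 \<in> J" by (simp add: J_iff)
    show "x + y \<in> J" if "x \<in> J" "y \<in> J" for x y
    proof (cases "x = 0 \<or> y = 0")
      case False
      then have "vge (v x) (x + y) \<or> vge (v y) (x + y)"
        by (metis vge_add vge_self vge_mono linear)
      then show ?thesis using J' False that by blast
    qed (use that in auto)
    show "r * x \<in> J" if "r \<in> val_ring v" "x \<in> J" for r x
    proof (cases "x = 0")
      case False
      then show ?thesis using J' that vge_mult_ring[of r "v x" x] by (simp add: val_ring_iff)
    qed (simp add: J_iff)
  qed
qed

text \<open>An ideal contains every element of at least the value of one of its nonzero members, and
  each nonzero element of \<open>J\<close> has the value of some quotient.\<close>

lemma quotients_subset_iff:
  assumes I: "OL_ideal v I"
  shows "{(\<sigma> f - f) / f | f. f \<noteq> 0} \<subseteq> I \<longleftrightarrow> J \<subseteq> I"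
proof
  assume sub: "{(\<sigma> f - f) / f | f. f \<noteq> 0} \<subseteq> I"
  show "J \<subseteq> I"
  proof
    fix y assume y: "y \<in> J"
    show "y \<in> I"
    proof (cases "y = 0")
      case True
      then show ?thesis using I unfolding OL_ideal_def by blast
    next
      case False
      then obtain f where f: "f \<noteq> 0" "\<sigma> f \<noteq> f" "v ((\<sigma> f - f) / f) = v y"
        using y J_iff Sigma_sigma_quotientE by metis
      then show ?thesis using sub OL_ideal_up[OF I, of "(\<sigma> f - f) / f" y] by (auto simp: vge_def)
    qed
  qed
next
  assume sub: "J \<subseteq> I"
  have "(\<sigma> f - f) / f \<in> J" if "f \<noteq> 0" for f
    using quotient_in_Sigma[OF \<sigma>(1) that] by (cases "\<sigma> f = f") (auto simp: J_iff)
  then show "{(\<sigma> f - f) / f | f. f \<noteq> 0} \<subseteq> I" using sub by blast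
qed

lemma G_I_iff:
  assumes I: "OL_ideal v I"
  shows "\<tau> \<in> G_I K I \<longleftrightarrow> \<tau> \<in> Gal K \<and> (\<tau> = id \<or> J \<subseteq> I)"
proof (cases "\<tau> \<in> Gal K \<and> \<tau> \<noteq> id")
  case True
  then have \<tau>: "\<tau> \<in> Gal K" "\<tau> \<noteq> id" by auto
  have "(\<tau> f - f) / f \<in> I \<longleftrightarrow> (\<sigma> f - f) / f \<in> I" if "f \<noteq> 0" for f
  proof (cases "f \<in> K")
    case True
    then show ?thesis using GalD(4) \<sigma> \<tau> by metis
  next
    case False
    then have nz: "\<tau> f - f \<noteq> 0" "\<sigma> f - f \<noteq> 0" using Gal_fixed_field \<sigma> \<tau> by auto
    have "v ((\<tau> f - f) / f) = v ((\<sigma> f - f) / f)" using nz that v_Gal_diff[OF \<sigma> \<tau>] by (simp add: v_divide)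
    then show ?thesis using OL_ideal_up[OF I] nz that
      by (metis divide_eq_0_iff vge_self)
  qed
  then have "\<tau> \<in> G_I K I \<longleftrightarrow> {(\<sigma> f - f) / f | f. f \<noteq> 0} \<subseteq> I"
    using \<tau> unfolding G_I_def by auto
  then show ?thesis using quotients_subset_iff[OF I] \<tau> by simp
next
  case False
  then show ?thesis using I id_in_Gal unfolding G_I_def OL_ideal_def by auto
qed

lemma I_minus_Gal: "I_minus K v (Gal K) = J"
proof -
  have "Gal K \<subseteq> G_I K I \<longleftrightarrow> J \<subseteq> I" if "OL_ideal v I" for I using G_I_iff[OF that] \<sigma> by blast
  then show ?thesis unfolding I_minus_def using OL_ideal_J by blast
qed

lemma ideal_gen_eq: "OL_ideal_gen v {(\<sigma> f - f) / f | f. f \<noteq> 0} = J"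
  unfolding OL_ideal_gen_def using OL_ideal_J quotients_subset_iff by blast

lemma I_plus_trivial: "I_plus K v {id} = J"
proof -
  have *: "G_I K I \<subseteq> {id} \<longleftrightarrow> \<not> J \<subseteq> I" if "OL_ideal v I" for I using G_I_iff[OF that] \<sigma> by blast
  show ?thesis unfolding I_plus_def
  proof (intro equalityI subsetI)
    fix x assume "x \<in> \<Union> {I. OL_ideal v I \<and> G_I K I \<subseteq> {id}}"
    then obtain I z where I: "OL_ideal v I" "x \<in> I" "z \<in> J" "z \<notin> I" using * by blast
    have z0: "z \<noteq> 0" using I(1,4) unfolding OL_ideal_def by blast
    show "x \<in> J"
    proof (cases "x = 0")
      case False
      then have "\<not> vge (v x) z" using OL_ideal_up[OF I(1,2)] I(4) by blast
      then have "vge (v z) x" using z0 by (auto simp: vge_def)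
      then show ?thesis using OL_ideal_up[OF OL_ideal_J I(3) z0] by blast
    qed (simp add: J_iff)
  next
    fix x assume "x \<in> J"
    \<comment> \<open>A value is also needed for \<open>x = 0\<close>, where any member of
      \<open>S\<close> will do.\<close>
    then obtain \<gamma> where g: "\<gamma> \<in> S" "vge \<gamma> x" using Sigma_sigma_nonempty by (auto simp: J_iff vge_def)
    obtain \<gamma>' where g': "\<gamma>' \<in> S" "\<gamma>' < \<gamma>" using Sigma_sigma_no_min[OF g(1)] .
    obtain z where z: "z \<noteq> 0" "v z = \<gamma>'" using Sigma_sigma_pos(2)[OF g'(1)] by (auto elim: value_groupE)
    have "OL_ideal v {x. vge \<gamma> x}" unfolding OL_ideal_def
      using Sigma_sigma_pos(1)[OF g(1)] vge_add vge_mult_ring vge_mono[of \<gamma> _ 0]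
      by (auto simp: val_ring_iff less_imp_le)
    moreover have "z \<in> J" "z \<notin> {x. vge \<gamma> x}" using z g' by (auto simp: J_iff vge_def)
    ultimately show "x \<in> \<Union> {I. OL_ideal v I \<and> G_I K I \<subseteq> {id}}" using * g(2) by blast
  qed
qed

end

end

section \<open>Approximation of polynomial values\<close>

text \<open>The remainder is found by recursion, without dividing by 2, so it stays in
  \<open>A\<close> in every characteristic; this is what a Newton step needs.\<close>

lemma taylor_second_order:
  assumes A: "subring_set A" and x: "x \<in> A" "h \<in> A"
  shows "P \<in> polys_over A \<Longrightarrow> \<exists>r\<in>A. poly P (x + h) = poly P x + h * poly (pderiv P) x + h * h * r"
proof (induction P)
  case 0
  then show ?case using subring_setD(1)[OF A] by auto
next
  case (pCons c Q)
  have Q: "Q \<in> polys_over A" using pCons.prems polys_over_pCons[OF A] by blast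
  obtain r where r: "r \<in> A" "poly Q (x + h) = poly Q x + h * poly (pderiv Q) x + h * h * r"
    using pCons.IH[OF Q] by blast
  have "poly (pderiv Q) x \<in> A" using poly_in_subring[OF A polys_over_pderiv[OF A Q] x(1)] .
  then have "poly (pderiv Q) x + x * r + h * r \<in> A" using r x subring_setD[OF A] by auto
  moreover have "poly (pCons c Q) (x + h) = poly (pCons c Q) x + h * poly (pderiv (pCons c Q)) x
      + h * h * (poly (pderiv Q) x + x * r + h * r)"
    by (simp add: pderiv_pCons r(2)) (simp add: algebra_simps)
  ultimately show ?case by blast
qed

lemma synthetic_div_over:
  assumes A: "subring_set A" "c \<in> A"
  shows "P \<in> polys_over A \<Longrightarrow> synthetic_div P c \<in> polys_over A"
  by (induction P) (auto simp: polys_over_pCons[OF A(1)] polys_over_0[OF A(1)] poly_in_subring[OF A(1) _ A(2)])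

lemma pderiv_ideal:
  assumes "local_subring R M" "P \<in> polys_over M" shows "pderiv P \<in> polys_over M"
  using assms(2) idealD(5)[OF assms(1) subring_of_nat[OF local_subring_ring[OF assms(1)]]]
  unfolding polys_over_def by (auto simp: coeff_pderiv simp del: of_nat_Suc)

context krull_valuation
begin

lemma poly_diff_vgt:
  assumes x: "vge 0 x" "vge 0 y"
  shows "P \<in> polys_over (val_ideal v) \<Longrightarrow> vgt (v (x - y)) (poly P x - poly P y)"
proof (induction P)
  case (pCons c Q)
  have "coeff (pCons c Q) (Suc i) \<in> val_ideal v" for i using pCons.prems polys_overD by blast
  then have Q: "Q \<in> polys_over (val_ideal v)" by (simp add: polys_over_def)
  have "vgt 0 (poly Q y)" using poly_ideal[OF val_ring_local Q, of y] x by (simp add: val_ring_iff val_ideal_iff)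
  then have "vgt (v (x - y) + 0) ((x - y) * poly Q y)" by (intro vgt_mult) auto
  then have "vgt (v (x - y)) (x * (poly Q x - poly Q y) + (x - y) * poly Q y)"
    using vgt_add[OF vgt_mult_ring[OF x(1) pCons.IH[OF Q]]] by simp
  moreover have "poly (pCons c Q) x - poly (pCons c Q) y = x * (poly Q x - poly Q y) + (x - y) * poly Q y"
    by (simp add: algebra_simps)
  ultimately show ?case by simp
qed simp

text \<open>\<open>N\<close> is a translation plus a polynomial with coefficients in the maximal
  ideal, and the latter shrinks distances strictly.\<close>

lemma isometric_poly:
  assumes E: "N - [:coeff N 0, 1:] \<in> polys_over (val_ideal v)"
    and x: "vge 0 x" "vge 0 y" "x \<noteq> y"
  shows "poly N x - poly N y \<noteq> 0" "v (poly N x - poly N y) = v (x - y)"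
proof -
  let ?E = "N - [:coeff N 0, 1:]"
  have "poly N x - poly N y = (x - y) + (poly ?E x - poly ?E y)" by simp
  moreover have "vgt (v (x - y)) (poly ?E x - poly ?E y)" by (rule poly_diff_vgt[OF x(1,2) E])
  ultimately show "poly N x - poly N y \<noteq> 0" "v (poly N x - poly N y) = v (x - y)"
    using v_add_eq[of "x - y" "poly ?E x - poly ?E y"] x(3) by auto
qed

end

context defect_extension
begin

text \<open>By Newton's method the values \<open>v (y - z)\<close>, \<open>z\<close> in the valuation ring of \<open>K\<close>, are closed under
  doubling. Hence they are cofinal in a convex subgroup; in the residue field of the corresponding
  coarsening of \<open>v\<close>, the residue of \<open>y\<close> is purely inseparable over that of \<open>K\<close> but a root of \<open>N\<close>,
  which has degree less than \<open>p\<close>.\<close>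

lemma no_newton_limit:
  assumes y: "y \<notin> K" "vge 0 y"
    and N: "N \<in> polys_over (K \<inter> val_ring v)" "degree N < p"
    and E: "N - [:coeff N 0, 1:] \<in> polys_over (val_ideal v)"
    and far: "\<And>z. z \<in> K \<Longrightarrow> vge 0 z \<Longrightarrow> v (y - z) < v (poly N y)"
  shows False
proof -
  let ?O = "val_ring v" and ?M = "val_ideal v"
  have NK: "N \<in> polys_over K" and NO: "N \<in> polys_over ?O" using N(1) by (auto simp: polys_over_def)
  have N1: "coeff N 1 = 1 \<or> vgt 0 (coeff N 1 - 1)"
    using polys_overD[OF E, of 1] by (simp add: val_ideal_iff)
  have yz: "y - z \<noteq> 0" if "z \<in> K" for z using that y by auto
  have vyz: "0 \<le> v (y - z)" if "z \<in> K" "vge 0 z" for z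
    using vge_diff[OF y(2) that(2)] yz[OF that(1)] by (simp add: vge_def)
  \<comment> \<open>By \<open>far\<close>, \<open>y\<close> behaves like a root of \<open>N\<close>,
    so the value at \<open>z\<close> measures the distance from \<open>z\<close> to
    \<open>y\<close>.\<close>
  have Nz: "poly N z \<noteq> 0" "v (poly N z) = v (y - z)" if z: "z \<in> K" "vge 0 z" for z
  proof -
    have d: "poly N y - poly N z \<noteq> 0" "v (poly N y - poly N z) = v (y - z)"
      using isometric_poly[OF E y(2) z(2)] z y by auto
    have "vgt (v (poly N y - poly N z)) (poly N y)" unfolding d(2) using far[OF z] by (simp add: vgt_def)
    then show "poly N z \<noteq> 0" "v (poly N z) = v (y - z)"
      using v_eq_of_close[OF d(1), of "- poly N z"] d(2) by (auto simp: v_minus)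
  qed
  have newton: "\<exists>z'\<in>K. vge 0 z' \<and> v (y - z) + v (y - z) \<le> v (y - z')" if z: "z \<in> K" "vge 0 z" for z
  proof -
    define D where "D = poly (pderiv N) z"
    have "pderiv N = 1 + pderiv (N - [:coeff N 0, 1:])"
      by (simp add: pderiv_diff pderiv_pCons one_pCons)
    then have "D = 1 + poly (pderiv (N - [:coeff N 0, 1:])) z" unfolding D_def by (metis poly_1 poly_add)
    moreover have "vgt 0 (poly (pderiv (N - [:coeff N 0, 1:])) z)"
      using poly_ideal[OF val_ring_local pderiv_ideal[OF val_ring_local E], of z] z
      by (simp add: val_ring_iff val_ideal_iff)
    ultimately have D: "D \<noteq> 0" "v D = 0" using v_add_eq[of 1 "poly (pderiv (N - [:coeff N 0, 1:])) z"] v_one by auto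
    have DK: "D \<in> K" unfolding D_def by (rule poly_in_subring[OF K_ring polys_over_pderiv[OF K_ring NK] z(1)])
    \<comment> \<open>The Newton correction cancels the constant and linear Taylor terms; only a
      multiple of \<open>h * h\<close> remains, hence the doubling.\<close>
    define h where "h = - (poly N z) / D"
    have hK: "h \<in> K" unfolding h_def using DK poly_in_subring[OF K_ring NK z(1)] KD(7,8) by simp
    have vh: "v h = v (y - z)" unfolding h_def using v_divide[of "- poly N z" D] D Nz[OF z] by (simp add: v_minus)
    then have h: "vge 0 h" using vyz[OF z] by (simp add: vge_def)
    obtain r where r: "r \<in> ?O" "poly N (z + h) = poly N z + h * D + h * h * r"
      using taylor_second_order[OF val_ring_subring _ _ NO, of z h] z h unfolding D_def by (auto simp: val_ring_iff)
    then have "poly N (z + h) = r * (h * h)" using D by (simp add: h_def)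
    moreover have "vge (v h + v h) (r * (h * h))"
      using r(1) by (intro vge_mult_ring vge_mult) (auto simp: val_ring_iff)
    moreover have zh: "z + h \<in> K" "vge 0 (z + h)" using z hK h KD(3) vge_add by auto
    ultimately have "v (y - z) + v (y - z) \<le> v (y - (z + h))"
      using Nz[OF zh] vh by (simp add: vge_def)
    then show ?thesis using zh by blast
  qed
  define V where "V = {v (y - z) | z. z \<in> K \<and> vge 0 z}"
  have V0: "0 \<le> s" if "s \<in> V" for s using that vyz by (auto simp: V_def)
  have Vne: "v (y - 0) \<in> V" unfolding V_def using KD(1) by (intro CollectI exI[of _ 0]) auto
  have Vadd: "\<exists>u\<in>V. s + t \<le> u" if st: "s \<in> V" "t \<in> V" for s t
  proof -
    have dbl: "\<exists>u\<in>V. s + s \<le> u" if "s \<in> V" for s using that newton unfolding V_def by blast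
    have "max s t \<in> V" using st by (simp add: max_def)
    then obtain u where "u \<in> V" "max s t + max s t \<le> u" using dbl by blast
    moreover have "s + t \<le> max s t + max s t" by (intro add_mono) auto
    ultimately show ?thesis using order_trans by blast
  qed
  \<comment> \<open>\<open>R\<close> and \<open>M\<close> are the valuation ring and maximal ideal
    of the coarsening. Closure of \<open>V\<close> under addition up to larger elements makes
    \<open>R\<close> a ring and \<open>M\<close> an ideal of it.\<close>
  define R where "R = {x. \<exists>s\<in>V. vge (- s) x}"
  define M where "M = {x. \<forall>s\<in>V. vgt s x}"
  have OR: "x \<in> R" if "vge 0 x" for x
    unfolding R_def using vge_mono[OF that, of "- v (y - 0)"] Vne V0[OF Vne] by auto
  have Rmax: "\<exists>s\<in>V. vge (- s) x \<and> vge (- s) x'" if xx': "x \<in> R" "x' \<in> R" for x x'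
  proof -
    obtain s t where st: "s \<in> V" "vge (- s) x" "t \<in> V" "vge (- t) x'" using xx' unfolding R_def by blast
    show ?thesis
    proof (cases "s \<le> t")
      case True
      then show ?thesis using st vge_mono[of "- s" x "- t"] by auto
    next
      case False
      then show ?thesis using st vge_mono[of "- t" x' "- s"] by auto
    qed
  qed
  have loc: "local_subring R M"
    unfolding local_subring_def subring_set_def
  proof (intro conjI ballI)
    show "0 \<in> R" "1 \<in> R" using OR by auto
    show "0 \<in> M" by (simp add: M_def)
    show "1 \<notin> M" using Vne V0[OF Vne] unfolding M_def by (force simp: vgt_def v_one)
    show "x + x' \<in> R" "x - x' \<in> R" if "x \<in> R" "x' \<in> R" for x x'
      using Rmax[OF that] vge_add vge_diff unfolding R_def by blast+
    show "x * x' \<in> R" if xx': "x \<in> R" "x' \<in> R" for x x'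
    proof -
      obtain s t where st: "s \<in> V" "vge (- s) x" "t \<in> V" "vge (- t) x'" using xx' unfolding R_def by blast
      obtain u where "u \<in> V" "s + t \<le> u" using Vadd st by blast
      moreover have "vge (- s + - t) (x * x')" using st by (intro vge_mult)
      moreover from \<open>s + t \<le> u\<close> have "- u \<le> - s + - t" by (metis minus_add_distrib neg_le_iff_le)
      ultimately have "u \<in> V" "vge (- u) (x * x')" using vge_mono[of "- s + - t" _ "- u"] by blast+
      then show ?thesis unfolding R_def by blast
    qed
    show "M \<subseteq> R"
    proof
      fix x assume "x \<in> M"
      then have "vgt (v (y - 0)) x" using Vne unfolding M_def by blast
      then show "x \<in> R" using OR[OF vge_mono[OF vgt_imp_vge V0[OF Vne]]] by blast
    qed
    show "x + x' \<in> M" if "x \<in> M" "x' \<in> M" for x x' using that vgt_add unfolding M_def by blast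
    show "r * x \<in> M" if rx: "r \<in> R" "x \<in> M" for r x
      unfolding M_def
    proof (intro CollectI ballI)
      fix t assume t: "t \<in> V"
      obtain s where s: "s \<in> V" "vge (- s) r" using rx unfolding R_def by blast
      obtain u where u: "u \<in> V" "s + t \<le> u" using Vadd s t by blast
      then have "vgt (- s + u) (r * x)" using rx s unfolding M_def by (intro vgt_mult) auto
      moreover have "t \<le> - s + u" using u(2) by (simp add: algebra_simps)
      ultimately show "vgt t (r * x)" by (rule vgt_mono)
    qed
    show "inverse x \<in> R" if x: "x \<in> R - M" for x
    proof -
      have x0: "x \<noteq> 0" using x \<open>0 \<in> M\<close> by auto
      obtain s where s: "s \<in> V" "\<not> vgt s x" using x unfolding M_def by blast
      then have "vge (- s) (inverse x)" using x0 by (simp add: vgt_def vge_def v_inverse)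
      then show ?thesis using s unfolding R_def by blast
    qed
  qed
  obtain \<sigma> where \<sigma>: "\<sigma> \<in> Gal K" "\<sigma> \<noteq> id" by (rule Gal_nontrivial)
  let ?h = "\<Prod>i<p. [:- (\<sigma> ^^ i) y, 1:]"
  have "N \<in> polys_over M"
  proof (rule inseparable_independence[OF loc K p OR[OF y(2)]])
    show "y - c \<notin> M" if c: "c \<in> K" for c
    proof (cases "vge 0 c")
      case True
      then have "v (y - c) \<in> V" using c unfolding V_def by blast
      then show ?thesis unfolding M_def using yz[OF c] by (auto simp: vgt_def)
    next
      case False
      then have c0: "c \<noteq> 0" "v c < 0" by (auto simp: vge_def)
      then have "vgt (v (- c)) y" using vge_imp_vgt[OF y(2)] by (simp add: v_minus)
      then have "v (y - c) = v c" using v_add_eq[of "- c" y] c0 by (simp add: v_minus)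
      then show ?thesis using Vne V0[OF Vne] c0 yz[OF c] unfolding M_def by (force simp: vgt_def)
    qed
    show "?h \<in> polys_over (K \<inter> R)"
      using orbit_poly_over[OF \<sigma> Gal_order[OF \<sigma>(1)]]
        prod_linear_over[OF loc, of p "\<lambda>i. (\<sigma> ^^ i) y"] OR vge_Gal[OF Gal_funpow[OF \<sigma>(1)]] y(2)
      by (simp add: polys_over_def)
    show "lead_coeff ?h = 1" "degree ?h = p" by (rule degree_prod_linear)+
    show "?h - [:- y, 1:] ^ p \<in> polys_over M"
    proof (rule prod_linear_cong[OF loc OR[OF y(2)]])
      show "(\<sigma> ^^ i) y - y \<in> M" for i
        unfolding M_def V_def using vgt_Gal_diff[OF Gal_funpow[OF \<sigma>(1)], of _ y i] y(1) by auto
    qed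
    show "N \<in> polys_over (K \<inter> R)" using N(1) OR by (auto simp: polys_over_def val_ring_iff)
    show "poly N y \<in> M" unfolding M_def V_def using far by (auto simp: vgt_def)
  qed (use N in auto)
  \<comment> \<open>This contradicts the linear coefficient of \<open>N\<close> being congruent to
    1.\<close>
  then have "coeff N 1 \<in> M" by (rule polys_overD)
  then have "vgt 0 (coeff N 1)" using Vne V0[OF Vne] vgt_mono unfolding M_def by blast
  then have "vgt 0 (coeff N 1 - (coeff N 1 - 1))" using N1 vgt_diff by (metis vgt_0 right_minus_eq)
  then show False by (simp add: vgt_def v_one)
qed

text \<open>Induction through the derivative. Near \<open>a\<close> the values of \<open>F'\<close>
  agree up to smaller terms, so after rescaling to \<open>a = c0 + b * y\<close> the polynomial
  \<open>F\<close> is a constant times an isometry \<open>N\<close>. Either some \<open>z\<close> is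
  closer to \<open>y\<close> than the size of \<open>poly N y\<close>, and then
  \<open>c0 + b * z\<close> works, or Newton's method applies to \<open>N\<close>.\<close>

lemma poly_value_approx:
  assumes a: "a \<notin> K"
  shows "F \<in> polys_over K \<Longrightarrow> F \<noteq> 0 \<Longrightarrow> degree F < p \<Longrightarrow>
    \<exists>c\<in>K. \<forall>c'\<in>K. v (a - c) \<le> v (a - c') \<longrightarrow> vgt (v (poly F a)) (poly F a - poly F c')"
proof (induction "degree F" arbitrary: F rule: less_induct)
  case less
  note FK = less.prems(1)
  have ac: "a - c \<noteq> 0" if "c \<in> K" for c using that a by auto
  have Fa: "poly F a \<noteq> 0" using powers_independent[OF a] less.prems by blast
  show ?case
  proof (cases "degree F = 0")
    case True
    then obtain k where "F = [:k:]" by (rule degree_eq_zeroE)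
    then show ?thesis using KD(1) by auto
  next
    case False
    define F' where "F' = pderiv F"
    have F'K: "F' \<in> polys_over K" unfolding F'_def by (rule polys_over_pderiv[OF K_ring FK])
    have "coeff F' (degree F - 1) = of_nat (degree F) * lead_coeff F"
      using False by (simp add: F'_def coeff_pderiv)
    \<comment> \<open>\<open>degree F < p\<close> is a unit even in characteristic \<open>p\<close>,
      so the derivative does not vanish.\<close>
    then have F'0: "F' \<noteq> 0" using v_of_nat_less[of "degree F"] False less.prems by auto
    have "degree F' \<le> degree F - 1" unfolding F'_def
      by (rule degree_le) (auto simp: coeff_pderiv intro!: coeff_eq_0)
    then have dF': "degree F' < degree F" "degree F' < p" using False less.prems by auto
    have F'a: "poly F' a \<noteq> 0" using powers_independent[OF a F'K dF'(2)] F'0 by blast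
    define \<gamma> where "\<gamma> = v (poly F' a)"
    obtain c0 where c0: "c0 \<in> K"
      and near: "\<And>c. c \<in> K \<Longrightarrow> v (a - c0) \<le> v (a - c) \<Longrightarrow> vgt \<gamma> (poly F' a - poly F' c)"
      using less.hyps[OF dF'(1) F'K F'0 dF'(2)] unfolding \<gamma>_def by blast
    obtain b where b: "b \<in> K" "b \<noteq> 0" "v b = v (a - c0)"
      using value_group_eq[OF ac[OF c0]] by (rule value_groupE)
    define y where "y = (a - c0) / b"
    have y: "vge 0 y" "v y = 0" using ac[OF c0] b by (auto simp: y_def vge_def v_divide)
    have a_eq: "a = c0 + b * y" using b by (simp add: y_def)
    have yK: "y \<notin> K"
    proof
      assume "y \<in> K"
      then have "a \<in> K" using a_eq KD(3)[OF c0 KD(5)[OF b(1)]] by simp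
      then show False using a by blast
    qed
    let ?l = "[:c0, b:]"
    have lK: "?l \<in> polys_over K" using c0 b polys_over_0[OF K_ring] by (simp add: polys_over_pCons[OF K_ring])
    define P where "P = pcompose F ?l"
    define Q where "Q = pcompose F' ?l"
    have PK: "P \<in> polys_over K" unfolding P_def by (rule polys_over_pcompose[OF K_ring FK lK])
    have dP: "degree P < p" "degree Q < p" using b less.prems dF' by (auto simp: P_def Q_def degree_pcompose)
    have polyP: "poly P z = poly F (c0 + b * z)" and polyQ: "poly Q z = poly F' (c0 + b * z)" for z
      by (auto simp: P_def Q_def poly_pcompose mult.commute)
    have PQ: "of_nat (Suc i) * coeff P (Suc i) = b * coeff Q i" for i
    proof -
      have "pderiv P = Q * [:b:]" unfolding P_def Q_def F'_def by (simp add: pderiv_pcompose pderiv_pCons)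
      then have "coeff (pderiv P) i = coeff (Q * [:b:]) i" by simp
      then show ?thesis by (simp add: coeff_pderiv)
    qed
    have near_c: "c0 + b * z \<in> K" "v (a - c0) \<le> v (a - (c0 + b * z))" if "z \<in> K" "vge 0 z" for z
    proof -
      show zK: "c0 + b * z \<in> K" by (rule KD(3)[OF c0 KD(5)[OF b(1) that(1)]])
      have "vge (v b + 0) (b * (y - z))" using y that by (intro vge_mult vge_diff) auto
      moreover have "b * (y - z) = a - (c0 + b * z)" using a_eq by (simp add: algebra_simps)
      ultimately show "v (a - c0) \<le> v (a - (c0 + b * z))" using ac[OF zK] b(3) by (simp add: vge_def)
    qed
    \<comment> \<open>The points \<open>0, ..., p - 1\<close> have unit differences, so closeness of
      the values of \<open>Q\<close> to \<open>F' c0\<close> there passes to its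
      coefficients.\<close>
    have "vgt \<gamma> (coeff (Q - [:poly F' c0:]) i)" for i
    proof (rule vandermonde[where n = p and x = of_nat])
      show "degree (Q - [:poly F' c0:]) < p" using dP(2) p_gt_1 by (intro degree_diff_less) auto
      show "vge 0 (of_nat i)" for i by (rule vge_of_nat)
      show "of_nat i \<noteq> (of_nat j :: 'a) \<and> v (of_nat i - of_nat j) = 0" if "i < j" "j < p" for i j
      proof -
        have "(of_nat j - of_nat i :: 'a) = of_nat (j - i)" using that by (simp add: of_nat_diff)
        then have "of_nat j - of_nat i \<noteq> (0::'a)" "v (of_nat j - of_nat i) = 0"
          using v_of_nat_less[of "j - i"] that by auto
        then show ?thesis using v_diff_commute[of "of_nat i" "of_nat j"] by auto
      qed
      show "vgt \<gamma> (poly (Q - [:poly F' c0:]) (of_nat i))" for i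
      proof -
        have "vgt \<gamma> (poly F' a - poly F' (c0 + b * of_nat i))"
          using near near_c subring_of_nat[OF K_ring] vge_of_nat by blast
        then have "vgt \<gamma> ((poly F' a - poly F' c0) - (poly F' a - poly F' (c0 + b * of_nat i)))"
          using near[OF c0] vgt_diff by blast
        then show ?thesis by (simp add: polyQ)
      qed
    qed
    moreover have "coeff (Q - [:poly F' c0:]) (Suc i) = coeff Q (Suc i)" for i by simp
    ultimately have Qsmall: "vgt \<gamma> (coeff Q (Suc i))" for i by metis
    have Q0: "coeff Q 0 = poly F' c0" unfolding poly_0_coeff_0[symmetric] polyQ by simp
    have "vgt (v (poly F' a)) (poly F' a - poly F' c0)" using near[OF c0] by (simp add: \<gamma>_def)
    from v_eq_of_close[OF F'a this]
    have F'c0: "poly F' c0 \<noteq> 0" "v (poly F' c0) = \<gamma>" by (simp_all add: \<gamma>_def)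
    define f1 where "f1 = coeff P 1"
    have f1: "f1 \<noteq> 0" "v f1 = v b + \<gamma>" "f1 \<in> K"
      using PQ[of 0] Q0 F'c0 b polys_overD[OF PK, of 1] by (auto simp: f1_def v_mult)
    have Psmall: "vgt (v f1) (coeff P (Suc (Suc i)))" for i
    proof (cases "Suc (Suc i) < p")
      case True
      have "vgt (v b + \<gamma>) (of_nat (Suc (Suc i)) * coeff P (Suc (Suc i)))"
        unfolding PQ using Qsmall b(2) vgt_mult_cancel by blast
      then show ?thesis using v_of_nat_less[OF _ True] f1(2) vgt_mult_cancel[of "of_nat (Suc (Suc i))" "v f1"]
        by simp
    next
      case False
      then show ?thesis using dP(1) by (simp add: coeff_eq_0)
    qed
    define N where "N = smult (1 / f1) P"
    have NK: "N \<in> polys_over K" unfolding N_def using PK f1 KD by (intro polys_over_smult[OF K_ring]) auto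
    have polyN: "poly F (c0 + b * z) = f1 * poly N z" for z using f1 by (simp add: N_def polyP)
    have E: "N - [:coeff N 0, 1:] \<in> polys_over (val_ideal v)"
    proof -
      have "vgt 0 (coeff P (Suc (Suc i)) / f1)" for i
        using Psmall[of i] f1(1) vgt_mult_cancel[of f1 0 "coeff P (Suc (Suc i)) / f1"] by simp
      then show ?thesis using f1(1) unfolding polys_over_def val_ideal_iff
        by (auto simp: coeff_pCons N_def f1_def split: nat.splits)
    qed
    have Ny: "poly N y \<noteq> 0" using Fa a_eq polyN[of y] by auto
    show ?thesis
    proof (rule ccontr)
      assume fails: "\<not> ?thesis"
      have le: "v (y - z) \<le> v (poly N y)" if z: "z \<in> K" "vge 0 z" for z
      proof (rule ccontr)
        assume lt: "\<not> ?thesis"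
        have "vgt (v (poly F a)) (poly F a - poly F c')"
          if c': "c' \<in> K" "v (a - (c0 + b * z)) \<le> v (a - c')" for c'
        proof -
          define z' where "z' = (c' - c0) / b"
          have z'K: "z' \<in> K" unfolding z'_def by (rule KD(7)[OF KD(4)[OF c'(1) c0] b(1)])
          have c'_eq: "c' = c0 + b * z'" using b by (simp add: z'_def)
          have e: "a - (c0 + b * w) = b * (y - w)" for w using a_eq by (simp add: algebra_simps)
          have nz: "y - w \<noteq> 0" if "w \<in> K" for w using that yK by auto
          have zz': "v (y - z) \<le> v (y - z')"
            using c'(2) nz[OF z(1)] nz[OF z'K] b(2) unfolding c'_eq e by (simp add: v_mult)
          have "vge 0 (y - z')" using zz' vge_diff[OF y(1) z(2)] nz[OF z(1)] by (auto simp: vge_def)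
          then have "vge 0 (y - (y - z'))" using vge_diff[OF y(1)] by blast
          then have z': "vge 0 z'" by simp
          have "poly F a - poly F c' = f1 * (poly N y - poly N z')"
            unfolding c'_eq polyN using a_eq polyN[of y] by (simp add: algebra_simps)
          moreover have "vgt (v (poly N y)) (poly N y - poly N z')"
            using isometric_poly[OF E y(1) z'] nz[OF z'K] zz' lt by (auto simp: vgt_def)
          moreover have "v (poly F a) = v f1 + v (poly N y)" using a_eq polyN[of y] Ny f1 v_mult by simp
          ultimately show ?thesis using vgt_mult_cancel[OF f1(1)] by simp
        qed
        then show False using fails near_c(1)[OF z] by blast
      qed
      \<comment> \<open>Strictness comes from comparing with a better approximation
        \<open>z'\<close> of \<open>y\<close>.\<close>
      have far: "v (y - z) < v (poly N y)" if z: "z \<in> K" "vge 0 z" for z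
      proof -
        obtain z' where z': "z' \<in> K" "v (y - z) < v (y - z')" using closer_approximation[OF yK z(1)] .
        have "0 \<le> v (y - z)" using vge_diff[OF y(1) z(2)] yK z by (auto simp: vge_def)
        then have "vge 0 (y - z')" using z' by (auto simp: vge_def)
        then have "vge 0 (y - (y - z'))" by (rule vge_diff[OF y(1)])
        then show ?thesis using le[of z'] z' by simp
      qed
      \<comment> \<open>Only the constant term needs an argument: it is \<open>poly N y\<close>
        minus a difference of value \<open>v y = 0\<close>.\<close>
      have "vge 0 (coeff N i)" for i
      proof (cases i)
        case 0
        have d: "v (poly N y - poly N 0) = v y" "poly N y - poly N 0 \<noteq> 0"
          using isometric_poly[OF E y(1), of 0] yK KD(1) by auto
        have "vge 0 (poly N y)" using far[of 0] KD(1) y(2) by (auto simp: vge_def)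
        moreover have "vge 0 (poly N y - poly N 0)" using d y by (simp add: vge_def)
        ultimately have "vge 0 (poly N y - (poly N y - poly N 0))" by (rule vge_diff)
        then show ?thesis using 0 by (simp add: poly_0_coeff_0)
      next
        case (Suc j)
        have "vgt 0 (coeff N i - coeff [:coeff N 0, 1:] i)" using polys_overD[OF E, of i] by (simp add: val_ideal_iff)
        moreover have "vge 0 (coeff [:coeff N 0, 1:] i)" using Suc by (auto simp: coeff_pCons split: nat.splits)
        ultimately show ?thesis using vge_add[OF vgt_imp_vge] by (metis diff_add_cancel)
      qed
      then have "N \<in> polys_over (K \<inter> val_ring v)" using NK by (auto simp: polys_over_def val_ring_iff)
      moreover have "degree N < p" using dP f1 by (simp add: N_def)
      ultimately show False using no_newton_limit[OF yK y(1) _ _ E far] by blast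
    qed
  qed
qed

lemma Sigma_sigma_eq_approx_values:
  assumes \<sigma>: "\<sigma> \<in> Gal K" "\<sigma> \<noteq> id" and a: "a \<notin> K"
  shows "Sigma_sigma v \<sigma> = approx_values \<sigma> a"
proof
  show "approx_values \<sigma> a \<subseteq> Sigma_sigma v \<sigma>" by (rule approx_values_subset[OF \<sigma> a])
  note s = GalD[OF \<sigma>(1)] Gal_hom[OF \<sigma>(1)]
  have main: "v (\<sigma> (poly F a) - poly F a) - v (poly F a) \<in> approx_values \<sigma> a"
    if "F \<in> polys_over K" "degree F < p" "poly F a \<notin> K" for F
    using that
  proof (induction "degree F" arbitrary: F rule: less_induct)
    case less
    define f where "f = poly F a"
    have f: "f \<notin> K" "f \<noteq> 0" using less.prems KD(1) by (auto simp: f_def)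
    then have "F \<noteq> 0" by (auto simp: f_def)
    then obtain c where c: "c \<in> K" "vgt (v f) (f - poly F c)"
      using poly_value_approx[OF a less.prems(1) _ less.prems(2)] unfolding f_def by blast
    define G where "G = synthetic_div F c"
    define g where "g = poly G a"
    have GK: "G \<in> polys_over K" unfolding G_def by (rule synthetic_div_over[OF K_ring c(1) less.prems(1)])
    have "degree F \<noteq> 0"
    proof
      assume "degree F = 0"
      then obtain k where k: "F = [:k:]" by (rule degree_eq_zeroE)
      then have "f \<in> K" using polys_overD[OF less.prems(1), of 0] by (simp add: f_def)
      then show False using f by blast
    qed
    then have dG: "degree G < degree F" "degree G < p" using less.prems by (auto simp: G_def degree_synthetic_div)
    have Fc: "poly F c \<in> K" by (rule poly_in_subring[OF K_ring less.prems(1) c(1)])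
    define w where "w = f - poly F c"
    have w0: "w \<noteq> 0" using f Fc by (auto simp: w_def)
    have vw: "v f < v w" using c w0 by (simp add: w_def vgt_def)
    have weq: "w = (a - c) * g"
      using arg_cong[OF synthetic_div_correct[of F c], of "\<lambda>P. poly P a"]
      by (simp add: w_def f_def g_def G_def algebra_simps)
    have g0: "g \<noteq> 0" "a - c \<noteq> 0" using w0 weq by auto
    have ac: "v (\<sigma> a - a) - v (a - c) \<in> approx_values \<sigma> a" unfolding approx_values_def using c by blast
    \<comment> \<open>\<open>t\<close> is the smaller of \<open>D (a - c)\<close> and
      \<open>D g\<close>. The second bound is phrased by \<open>vge\<close> because \<open>g\<close>
      may lie in \<open>K\<close>, where \<open>\<sigma> g - g = 0\<close>.\<close>
    obtain t where t: "t \<in> approx_values \<sigma> a" "t \<le> v (\<sigma> a - a) - v (a - c)" "vge (t + v g) (\<sigma> g - g)"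
    proof (cases "g \<in> K")
      case True
      then show ?thesis using that[OF ac] s(4) by simp
    next
      case False
      then have gT: "v (\<sigma> g - g) - v g \<in> approx_values \<sigma> a"
        using less.hyps[OF dG(1) GK dG(2)] by (simp add: g_def)
      show ?thesis
      proof (cases "v (\<sigma> a - a) - v (a - c) \<le> v (\<sigma> g - g) - v g")
        case True
        then have "v (\<sigma> a - a) - v (a - c) + v g \<le> v (\<sigma> g - g)" by (simp add: le_diff_eq)
        then show ?thesis using that[OF ac] by (simp add: vge_def)
      next
        case False
        then show ?thesis using that[OF gT] by (simp add: vge_def)
      qed
    qed
    have \<sigma>c: "\<sigma> (a - c) - (a - c) = \<sigma> a - a" using s c by simp
    have "\<sigma> f - f = \<sigma> w - w" unfolding w_def using s Fc by simp
    \<comment> \<open>The twisted Leibniz rule for \<open>\<sigma> - id\<close>; it bounds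
      \<open>D w\<close> below by \<open>t\<close>, and \<open>v f < v w\<close> then gives
      \<open>t \<le> D f\<close>.\<close>
    also have "\<dots> = \<sigma> (a - c) * (\<sigma> g - g) + (\<sigma> a - a) * g"
      unfolding weq s(3) \<sigma>c[symmetric] by (simp add: algebra_simps)
    finally have eq: "\<sigma> f - f = \<sigma> (a - c) * (\<sigma> g - g) + (\<sigma> a - a) * g" .
    have "vge (v (a - c) + (t + v g)) (\<sigma> (a - c) * (\<sigma> g - g))"
      using t(3) by (intro vge_mult) (simp_all add: vge_Gal[OF \<sigma>(1)])
    moreover have "vge (v (a - c) + (t + v g)) ((\<sigma> a - a) * g)"
    proof -
      have "t + v (a - c) \<le> v (\<sigma> a - a)" using t(2) by (simp add: le_diff_eq)
      then have "v (a - c) + (t + v g) \<le> v (\<sigma> a - a) + v g"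
        by (metis add.assoc add.commute add_right_mono)
      then show ?thesis using vge_mult[of "v (\<sigma> a - a)" "\<sigma> a - a" "v g" g] vge_mono by auto
    qed
    ultimately have "vge (v (a - c) + (t + v g)) (\<sigma> f - f)" unfolding eq by (rule vge_add)
    moreover have "\<sigma> f - f \<noteq> 0" using Gal_fixed_field[OF \<sigma>] f by auto
    moreover have "v w = v (a - c) + v g" using weq g0 v_mult by simp
    ultimately have "t + v w \<le> v (\<sigma> f - f)" by (simp add: vge_def algebra_simps)
    moreover have "t + v f \<le> t + v w" using vw by simp
    ultimately have "t + v f \<le> v (\<sigma> f - f)" by (rule order_trans[rotated])
    then have "t \<le> v (\<sigma> f - f) - v f" by (simp add: le_diff_eq)
    moreover have "v (\<sigma> f - f) - v f \<in> value_group v K"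
      using value_group_eq \<open>\<sigma> f - f \<noteq> 0\<close> f by (intro value_group_closed) auto
    ultimately show ?case using approx_values_up[OF \<sigma> a t(1)] by (simp add: f_def)
  qed
  show "Sigma_sigma v \<sigma> \<subseteq> approx_values \<sigma> a"
  proof
    fix \<gamma> assume "\<gamma> \<in> Sigma_sigma v \<sigma>"
    then obtain f where f: "f \<notin> K" "\<gamma> = v (\<sigma> f - f) - v f" using Sigma_sigma_iff[OF \<sigma>] by blast
    obtain F where "F \<in> polys_over K" "degree F < p" "poly F a = f" using poly_representation[OF a] .
    then show "\<gamma> \<in> approx_values \<sigma> a" using main f by blast
  qed
qed

end

section \<open>Artin--Schreier and Kummer generators\<close>

lemma (in krull_valuation) v_root_of_unity:
  assumes "e ^ n = 1" "0 < n" shows "v e = 0"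
proof -
  have e0: "e \<noteq> 0" using assms by (metis power_eq_0_iff zero_neq_one)
  have no: "\<not> 0 < v e" if "e ^ n = 1" "e \<noteq> 0" for e
  proof
    assume pos: "0 < v e"
    then have "vge 0 e" by (auto simp: vge_def)
    obtain m where m: "n = Suc m" using assms(2) gr0_implies_Suc by blast
    have "vge 0 (e ^ m)"
      using subring_power[OF val_ring_subring, of e m] \<open>vge 0 e\<close> by (simp add: val_ring_iff)
    moreover have "vgt 0 e" using pos by (simp add: vgt_def)
    ultimately have "vgt 0 (e ^ m * e)" by (rule vgt_mult_ring)
    then have "vgt 0 1" using that(1) m by (simp only: power_Suc2)
    then show False by (simp add: vgt_def v_one)
  qed
  have "inverse e ^ n = 1" using assms by (simp add: power_inverse)
  then show ?thesis using no[of e] no[of "inverse e"] assms(1) e0 by (simp add: v_inverse)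
qed

lemma prime_root_power_ne_1:
  fixes \<zeta> :: "'a::field"
  assumes "prime p" "\<zeta> ^ p = 1" "\<zeta> \<noteq> 1" "0 < k" "k < p"
  shows "\<zeta> ^ k \<noteq> 1"
proof
  assume k: "\<zeta> ^ k = 1"
  have "coprime k p" using assms by (metis coprime_commute nat_dvd_not_less prime_imp_coprime)
  then obtain a b where "k * a = p * b + 1" using bezout_nat[of k p] assms(4) by auto
  then have "\<zeta> ^ (k * a) = \<zeta> * \<zeta> ^ (p * b)" by simp
  then have "\<zeta> = 1" using assms(2) k by (simp add: power_mult)
  then show False using assms(3) by blast
qed

lemma prime_root_powers_inj:
  fixes \<zeta> :: "'a::field"
  assumes "prime p" "\<zeta> ^ p = 1" "\<zeta> \<noteq> 1"
  shows "inj_on (\<lambda>i. \<zeta> ^ i) {..<p}"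
proof (rule linorder_inj_onI)
  fix i j assume ij: "i < j" "i \<in> {..<p}" "j \<in> {..<p}"
  have "\<zeta> \<noteq> 0" using assms(1,2) by (metis power_eq_0_iff prime_gt_0_nat zero_neq_one)
  moreover have "\<zeta> ^ j = \<zeta> ^ i * \<zeta> ^ (j - i)" using ij by (simp flip: power_add)
  moreover have "\<zeta> ^ (j - i) \<noteq> 1" using prime_root_power_ne_1[OF assms] ij by simp
  ultimately show "\<zeta> ^ i \<noteq> \<zeta> ^ j" by simp
qed auto

lemma prime_root_is_power:
  fixes \<zeta> :: "'a::field"
  assumes p: "prime p" and \<zeta>: "\<zeta> ^ p = 1" "\<zeta> \<noteq> 1" and \<eta>: "\<eta> ^ p = 1"
  obtains i where "\<eta> = \<zeta> ^ i"
proof -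
  let ?P = "monom 1 p - 1 :: 'a poly"
  have "coeff ?P p = 1" using prime_gt_0_nat[OF p] by simp
  then have P0: "?P \<noteq> 0" by force
  have "degree ?P \<le> p" by (intro degree_diff_le) (auto simp: degree_monom_le)
  then have "card {x. poly ?P x = 0} \<le> p" using card_poly_roots_bound[OF P0] by simp
  moreover have "card ((\<lambda>i. \<zeta> ^ i) ` {..<p}) = p" using prime_root_powers_inj[OF p \<zeta>] by (simp add: card_image)
  moreover have "(\<zeta> ^ i) ^ p = 1" for i using \<zeta>(1) by (metis power_mult mult.commute power_one)
  then have "(\<lambda>i. \<zeta> ^ i) ` {..<p} \<subseteq> {x. poly ?P x = 0}" by (auto simp: poly_monom)
  ultimately have "(\<lambda>i. \<zeta> ^ i) ` {..<p} = {x. poly ?P x = 0}"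
    using poly_roots_finite[OF P0] by (intro card_seteq) auto
  moreover have "\<eta> \<in> {x. poly ?P x = 0}" using \<eta> by (simp add: poly_monom)
  ultimately show ?thesis using that by blast
qed

text \<open>The polynomial \<open>1 + X + ... + X^(p-1)\<close> evaluated at 1, once as a sum and
  once in factored form.\<close>

lemma prod_one_minus_roots:
  fixes \<zeta> :: "'a::field"
  assumes p: "prime p" and \<zeta>: "\<zeta> ^ p = 1" "\<zeta> \<noteq> 1"
  shows "(\<Prod>i<p - 1. 1 - \<zeta> ^ Suc i) = of_nat p"
proof -
  let ?P = "\<Sum>i<p. monom 1 i :: 'a poly" and ?Q = "\<Prod>i<p - 1. [:- (\<zeta> ^ Suc i), 1:]"
  have p0: "0 < p" "1 < p" using p prime_gt_0_nat prime_gt_1_nat by auto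
  have dQ: "degree ?Q = p - 1" by (subst degree_prod_eq_sum_degree) auto
  have lQ: "lead_coeff ?Q = 1" by (subst lead_coeff_prod) auto
  have "?P = ?Q"
  proof (rule poly_eqI_degree_lead_coeff[where n = "p - 1" and A = "(\<lambda>i. \<zeta> ^ Suc i) ` {..<p - 1}"])
    show "coeff ?P (p - 1) = coeff ?Q (p - 1)" using lQ p0 unfolding dQ by (simp add: coeff_sum_monom)
    show "degree ?P \<le> p - 1" using degree_sum_monom[OF p0(1), of "\<lambda>_. 1::'a"] by linarith
    show "degree ?Q \<le> p - 1" using dQ by simp
    have "inj_on (\<lambda>i. \<zeta> ^ Suc i) {..<p - 1}"
    proof (rule inj_onI)
      fix i j assume ij: "i \<in> {..<p - 1}" "j \<in> {..<p - 1}" "\<zeta> ^ Suc i = \<zeta> ^ Suc j"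
      then have "Suc i = Suc j" using inj_onD[OF prime_root_powers_inj[OF p \<zeta>], of "Suc i" "Suc j"] by auto
      then show "i = j" by simp
    qed
    then show "p - 1 \<le> card ((\<lambda>i. \<zeta> ^ Suc i) ` {..<p - 1})" by (simp add: card_image del: power_Suc)
    show "poly ?P z = poly ?Q z" if z: "z \<in> (\<lambda>i. \<zeta> ^ Suc i) ` {..<p - 1}" for z
    proof -
      obtain i where i: "i < p - 1" "z = \<zeta> ^ Suc i" using z by blast
      have "z ^ p = 1" using \<zeta>(1) i(2) by (metis power_mult mult.commute power_one)
      then have "(z - 1) * (\<Sum>i<p. z ^ i) = 0" using power_diff_1_eq[of z p] by simp
      moreover have "z \<noteq> 1" using prime_root_power_ne_1[OF p \<zeta>, of "Suc i"] i by simp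
      ultimately have "poly ?P z = 0" by (simp add: poly_sum_monom)
      moreover have "poly ?Q z = 0" unfolding poly_prod using i by (intro prod_zero) (auto intro!: bexI[of _ i])
      ultimately show ?thesis by simp
    qed
  qed
  then have "poly ?P 1 = poly ?Q 1" by simp
  then show ?thesis by (simp add: poly_sum_monom poly_prod)
qed

context defect_extension
begin

text \<open>\<open>\<sigma> a - a\<close> is fixed by Frobenius, hence a root of unity of order
  dividing \<open>p - 1\<close>, hence of value 0.\<close>

lemma Sigma_Artin_Schreier:
  assumes char: "CHAR('a) = p" and a: "a \<notin> K" "a ^ p - a \<in> K" and \<sigma>: "\<sigma> \<in> Gal K" "\<sigma> \<noteq> id"
  shows "Sigma_sigma v \<sigma> = uminus ` dist_set v K a"
proof -
  define e where "e = \<sigma> a - a"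
  have e0: "e \<noteq> 0" using Gal_fixed_field[OF \<sigma>] a by (auto simp: e_def)
  have "\<sigma> a ^ p - \<sigma> a = a ^ p - a"
    using GalD(4)[OF \<sigma>(1) a(2)] by (simp add: Gal_hom[OF \<sigma>(1)])
  moreover have "(a + e) ^ p = a ^ p + e ^ p"
    by (rule freshmans_dream) (use p in \<open>simp_all only: char\<close>)
  moreover have "\<sigma> a = a + e" by (simp add: e_def)
  ultimately have "e ^ p = e" by simp
  moreover have "e ^ p = e ^ (p - 1) * e" using p_gt_1 by (metis power_minus_mult less_trans zero_less_one)
  ultimately have "e ^ (p - 1) = 1" using e0 by simp
  then have "v e = 0" using v_root_of_unity p_gt_1 by auto
  then show ?thesis unfolding Sigma_sigma_eq_approx_values[OF \<sigma> a(1)] approx_values_def dist_set_def e_def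
    by auto
qed

lemma vge_root_minus_1: "\<zeta> ^ p = 1 \<Longrightarrow> vge (v (\<zeta> - 1)) (\<zeta> ^ i - 1)"
proof -
  assume "\<zeta> ^ p = 1"
  then have "v \<zeta> = 0" using v_root_of_unity p_gt_1 by auto
  then have "vge 0 (\<zeta> ^ j)" for j
    using subring_power[OF val_ring_subring, of \<zeta> j] by (simp add: val_ring_iff vge_def)
  then have "vge (v (\<zeta> - 1)) ((\<Sum>j<i. \<zeta> ^ j) * (\<zeta> - 1))" by (intro vge_mult_ring vge_sum) auto
  then show "vge (v (\<zeta> - 1)) (\<zeta> ^ i - 1)" by (simp add: power_diff_1_eq mult.commute)
qed

text \<open>Each nontrivial \<open>p\<close>-th root of unity is a power of any other, and the
  geometric sum gives both inequalities.\<close>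

lemma v_root_minus_1:
  assumes "\<zeta> ^ p = 1" "\<zeta> \<noteq> 1" "\<eta> ^ p = 1" "\<eta> \<noteq> 1"
  shows "v (\<eta> - 1) = v (\<zeta> - 1)"
proof -
  have "v (\<zeta> - 1) \<le> v (\<eta> - 1)" if "\<zeta> ^ p = 1" "\<zeta> \<noteq> 1" "\<eta> ^ p = 1" "\<eta> \<noteq> 1" for \<zeta> \<eta>
    using prime_root_is_power[OF p that(1-3)] vge_root_minus_1[OF that(1)] that(4)
    by (metis right_minus_eq vge_def)
  then show ?thesis using assms by (simp add: antisym)
qed

text \<open>The value group need not be divisible, so \<open>vp / (p - 1)\<close> is expressed as an
  element whose \<open>(p - 1)\<close>-fold sum is \<open>vp\<close>; \<open>v (\<zeta> - 1)\<close>
  is that element.\<close>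

lemma v_p_eq:
  assumes \<zeta>: "\<zeta> ^ p = 1" "\<zeta> \<noteq> 1"
  shows "(\<Sum>i<p - 1. v (\<zeta> - 1)) = v (of_nat p)"
proof -
  have "1 - \<zeta> ^ Suc i \<noteq> 0 \<and> v (1 - \<zeta> ^ Suc i) = v (\<zeta> - 1)" if "i < p - 1" for i
  proof -
    have "\<zeta> ^ Suc i \<noteq> 1" using prime_root_power_ne_1[OF p \<zeta>, of "Suc i"] that by simp
    moreover have "(\<zeta> ^ Suc i) ^ p = 1" using \<zeta>(1) by (metis power_mult mult.commute power_one)
    ultimately show ?thesis
      using v_root_minus_1[OF \<zeta>] v_diff_commute[of 1 "\<zeta> ^ Suc i"] by auto
  qed
  then have "v (\<Prod>i<p - 1. 1 - \<zeta> ^ Suc i) = (\<Sum>i<p - 1. v (\<zeta> - 1))"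
    by (subst v_prod) (auto simp del: power_Suc)
  then show ?thesis using prod_one_minus_roots[OF p \<zeta>] by simp
qed

text \<open>\<open>\<sigma>\<close> multiplies \<open>a\<close> by a nontrivial root of unity
  \<open>\<eta>\<close>, and a 1-unit has value 0, so \<open>\<sigma> a - a\<close> has the value of
  \<open>\<eta> - 1\<close>.\<close>

lemma Sigma_Kummer:
  assumes \<zeta>: "\<zeta> ^ p = 1" "\<zeta> \<noteq> 1"
    and a: "a \<notin> K" "a ^ p \<in> K" "a - 1 \<in> val_ideal v" and \<sigma>: "\<sigma> \<in> Gal K" "\<sigma> \<noteq> id"
  shows "Sigma_sigma v \<sigma> = (\<lambda>\<gamma>. v (\<zeta> - 1) - \<gamma>) ` dist_set v K a"
proof -
  have a0: "a \<noteq> 0" "v a = 0" using v_add_eq[of 1 "a - 1"] a(3) v_one by (auto simp: val_ideal_iff)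
  define \<eta> where "\<eta> = \<sigma> a / a"
  have "\<sigma> a ^ p = a ^ p" using GalD(4)[OF \<sigma>(1) a(2)] by (simp add: Gal_hom[OF \<sigma>(1)])
  then have "\<eta> ^ p = 1" using a0 by (simp add: \<eta>_def power_divide)
  moreover have "\<eta> \<noteq> 1" using Gal_fixed_field[OF \<sigma>] a a0 by (simp add: \<eta>_def)
  ultimately have "v (\<eta> - 1) = v (\<zeta> - 1)" "\<eta> - 1 \<noteq> 0" using v_root_minus_1[OF \<zeta>] by auto
  moreover have "\<sigma> a - a = (\<eta> - 1) * a" using a0 by (simp add: \<eta>_def field_simps)
  ultimately have "v (\<sigma> a - a) = v (\<zeta> - 1)" using a0 v_mult by simp
  then show ?thesis unfolding Sigma_sigma_eq_approx_values[OF \<sigma> a(1)] approx_values_def dist_set_def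
    by auto
qed

end

theorem theorem3p5:
  fixes K :: "'a::field set" and v :: "'a \<Rightarrow> 'b::linordered_ab_group_add" and p :: nat
  assumes E: "galois_defect_ext_prime K v p"
  defines "G \<equiv> Gal K"
  shows "(\<forall>\<sigma> \<tau>. generator G \<sigma> \<and> generator G \<tau> \<longrightarrow> Sigma_sigma v \<sigma> = Sigma_sigma v \<tau>)
    \<and> (\<forall>\<sigma>. generator G \<sigma> \<longrightarrow>
          final_seg_vK_pos K v (Sigma_sigma v \<sigma>)
        \<and> Sigma_sigma v \<sigma> = Sigma_plus K v {id}
        \<and> Sigma_plus K v {id} = Sigma_minus K v G)
    \<and> I_minus K v G = I_plus K v {id}
    \<and> (\<forall>\<sigma>. generator G \<sigma> \<longrightarrow>
          I_minus K v G = OL_ideal_gen v {(\<sigma> f - f) / f | f. f \<noteq> 0})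
    \<and> (CHAR('a) = p \<longrightarrow>
        (\<forall>a. gen_field K a = UNIV \<and> a ^ p - a \<in> K \<longrightarrow>
          (\<forall>\<sigma>. generator G \<sigma> \<longrightarrow> Sigma_sigma v \<sigma> = uminus ` dist_set v K a)))
    \<and> ((\<exists>\<zeta>\<in>K. \<zeta> ^ p = 1 \<and> \<zeta> \<noteq> 1) \<longrightarrow>
        (\<forall>a. gen_field K a = UNIV \<and> a ^ p \<in> K \<and> a - 1 \<in> val_ideal v \<longrightarrow>
          (\<exists>\<delta>. (\<Sum>i<p - 1. \<delta>) = v (of_nat p) \<and>
            (\<forall>\<sigma>. generator G \<sigma> \<longrightarrow> Sigma_sigma v \<sigma> = (\<lambda>\<gamma>. \<delta> - \<gamma>) ` dist_set v K a))))"
proof -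
  interpret defect_extension K p v
    using E unfolding galois_defect_ext_prime_def
    by unfold_locales auto
  have gen: "generator G \<sigma> \<longleftrightarrow> \<sigma> \<in> Gal K \<and> \<sigma> \<noteq> id" for \<sigma> unfolding G_def by (rule generator_iff)
  obtain \<sigma>0 where \<sigma>0: "\<sigma>0 \<in> Gal K" "\<sigma>0 \<noteq> id" by (rule Gal_nontrivial)
  have Sp: "Sigma_sigma v \<sigma> = Sigma_plus K v {id}" if "generator G \<sigma>" for \<sigma>
    using that Sigma_plus_trivial by (auto simp: gen)
  have Sm: "Sigma_plus K v {id} = Sigma_minus K v G"
    unfolding G_def Sigma_plus_trivial[OF \<sigma>0] Sigma_minus_Gal[OF \<sigma>0] ..
  have I: "I_minus K v G = I_plus K v {id}"
    unfolding G_def I_minus_Gal[OF \<sigma>0] I_plus_trivial[OF \<sigma>0] ..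
  have Ig: "I_minus K v G = OL_ideal_gen v {(\<sigma> f - f) / f | f. f \<noteq> 0}" if "generator G \<sigma>" for \<sigma>
  proof -
    have \<sigma>: "\<sigma> \<in> Gal K" "\<sigma> \<noteq> id" using that gen by auto
    show ?thesis unfolding G_def ideal_gen_eq[OF \<sigma>] by (rule I_minus_Gal[OF \<sigma>])
  qed
  have fin: "final_seg_vK_pos K v (Sigma_sigma v \<sigma>)" if "generator G \<sigma>" for \<sigma>
    using that final_seg_Sigma(2) by (auto simp: gen)
  have AS: "Sigma_sigma v \<sigma> = uminus ` dist_set v K a"
    if "CHAR('a) = p" "gen_field K a = UNIV" "a ^ p - a \<in> K" "generator G \<sigma>" for a \<sigma>
    using that Sigma_Artin_Schreier gen_field_imp_notin by (auto simp: gen)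
  \<comment> \<open>The witness is \<open>v (\<zeta> - 1)\<close>, which does not depend on the
    generator.\<close>
  have Ku: "\<exists>\<delta>. (\<Sum>i<p - 1. \<delta>) = v (of_nat p) \<and>
      (\<forall>\<sigma>. generator G \<sigma> \<longrightarrow> Sigma_sigma v \<sigma> = (\<lambda>\<gamma>. \<delta> - \<gamma>) ` dist_set v K a)"
    if \<zeta>: "\<zeta> ^ p = 1" "\<zeta> \<noteq> 1" and a: "gen_field K a = UNIV" "a ^ p \<in> K" "a - 1 \<in> val_ideal v" for \<zeta> a :: 'a
    using v_p_eq[OF \<zeta>] Sigma_Kummer[OF \<zeta> gen_field_imp_notin[OF a(1)] a(2,3)]
    unfolding gen by blast
  show ?thesis using Sp Sm I Ig fin AS Ku by auto
qed

end
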